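(* Let $\boldsymbol{X}=\boldsymbol{V}_h\times Q_h$. For $\boldsymbol{x}=(\boldsymbol{u},p)\in\boldsymbol{X}$ and $\boldsymbol{y}=(\boldsymbol{v},q)\in\boldsymbol{X}$, let $$\mathcal{L}(\boldsymbol{x},\boldsymbol{y})=(A_{\boldsymbol{u}}\boldsymbol{u},\boldsymbol{v})+\alpha(B\boldsymbol{v},p)+\alpha(B\boldsymbol{u},q)-\tau(K\nabla p,\nabla q)-\eta h^2(\nabla p,\nabla q).$$ Suppose that the stabilization parameter is $\eta=\delta\frac{\alpha^2}{\zeta^2}$ with $\delta>0$, where $\zeta=\sqrt{\lambda+2\mu/d}$. Then there exist constants $\beta>0$ and $\gamma>0$, independent of the physical and discretization parameters, such that $$|\mathcal{L}(\boldsymbol{x},\boldsymbol{y})|\le\beta\|\boldsymbol{x}\|_{\boldsymbol{X}}\|\boldsymbol{y}\|_{\boldsymbol{X}}\quad\text{for all }\boldsymbol{x},\boldsymbol{y}\in\boldsymbol{X},\qquad\text{and}\qquad \inf_{0\ne\boldsymbol{x}\in\boldsymbol{X}}\ \sup_{0\ne\boldsymbol{y}\in\boldsymbol{X}}\frac{\mathcal{L}(\boldsymbol{x},\boldsymbol{y})}{\|\boldsymbol{x}\|_{\boldsymbol{X}}\|\boldsymbol{y}\|_{\boldsymbol{X}}}\ge\gamma,$$ and the operator $\mathcal{A}=\begin{pmatrix}A_{\boldsymbol{u}}&\alpha B^T\\ \alpha B&-\tau A_p-\eta h^2L_p\end{pmatrix}$ is an isomorphism from $\boldsymbol{X}$ to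 $\boldsymbol{X}'$.
   Context: Setting. $\Omega\subset\mathbb{R}^d$, $d\in\{2,3\}$, is a bounded open set with regular boundary. Physical parameters: Lamé coefficients $\lambda\ge 0$, $\mu>0$; Biot–Willis constant $\alpha>0$; hydraulic conductivity $K>0$. Discretization parameters: mesh size $h>0$, time step size $\tau>0$. $(\cdot,\cdot)$ and $\|\cdot\|$ are the $L^2(\Omega)$ inner product and norm (also used for the duality pairing between a finite-dimensional space and its dual), $\|\cdot\|_1$ is the $H^1(\Omega)$ norm, and $\varepsilon(\boldsymbol{u})=\frac12(\nabla\boldsymbol{u}+\nabla\boldsymbol{u}^t)$. Let $\zeta=\sqrt{\lambda+2\mu/d}$. Bilinear forms: $a(\boldsymbol{u},\boldsymbol{v})=2\mu\int_\Omega\varepsilon(\boldsymbol{u}):\varepsilon(\boldsymbol{v})+\lambda\int_\Omega\operatorname{div}\boldsymbol{u}\,\operatorname{div}\boldsymbol{v}$ and $a_p(p,q)=\int_\Omega K\nabla p\cdot\nabla q$. Finite-element spaces: $\boldsymbol{V}_h\subset\boldsymbol{H}^1_0(\Omega)=H_0^1(\Omega)^d$ and $Q_h\subset H^1_0(\Omega)$ are the finite-element spaces for displacement and pressure given by the $\mathbb{P}_1$-$\mathbb{P}_1$ pair or the Mini element on a mesh of size $h$. The pair is taken to satisfy the weak inf-sup condition $$\sup_{0\ne\boldsymbol{v}\in\boldsymbol{V}_h}\frac{(\operatorname{div}\boldsymbol{v},q)}{\|\boldsymbol{v}\|_1}\ge\gamma_B^0\|q\|-\xi^0h\|\nabla q\|\qquad\text{for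 all }q\in Q_h,$$ with constants $\gamma_B^0>0$, $\xi^0\ge0$ that do not depend on $h$ ($\xi^0=0$ for the Mini element). Discrete operators: $A_{\boldsymbol{u}}:\boldsymbol{V}_h\to\boldsymbol{V}_h'$, $B:\boldsymbol{V}_h\to Q_h'$, $A_p,L_p:Q_h\to Q_h'$ are defined by $(A_{\boldsymbol{u}}\boldsymbol{u},\boldsymbol{v})=a(\boldsymbol{u},\boldsymbol{v})$, $(B\boldsymbol{u},q)=-(\operatorname{div}\boldsymbol{u},q)$, $(A_pp,q)=a_p(p,q)$, $(L_pp,q)=(\nabla p,\nabla q)$; $B^T:Q_h\to\boldsymbol{V}_h'$ is the adjoint of $B$. $\eta$ denotes the stabilization parameter. One has $\langle\mathcal{A}\boldsymbol{x},\boldsymbol{y}\rangle=\mathcal{L}(\boldsymbol{x},\boldsymbol{y})$. Norm on $\boldsymbol{X}=\boldsymbol{V}_h\times Q_h$: for $\boldsymbol{x}=(\boldsymbol{u},p)^T$, $$\|\boldsymbol{x}\|_{\boldsymbol{X}}^2=\|\boldsymbol{u}\|_{A_{\boldsymbol{u}}}^2+\tau\|p\|_{A_p}^2+\eta h^2\|p\|_{L_p}^2+\frac{\alpha^2}{\zeta^2}\|p\|^2,$$ where $\|\boldsymbol{u}\|_{A_{\boldsymbol{u}}}^2=a(\boldsymbol{u},\boldsymbol{u})$, $\|p\|_{A_p}^2=a_p(p,p)$, $\|p\|_{L_p}^2=(\nabla p,\nabla p)$. "Independent of the physical and discretization parameters" means independent of $\lambda,\mu,K,\alpha,h,\tau$;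 the constants may depend on $d,\gamma_B^0,\xi^0,\delta$. *)

theory Defs
  imports "HOL-Analysis.Analysis" "HOL-Library.Function_Algebras"
begin

text \<open>Pointwise vector space structure on functions; addition and zero come from
  \<^theory>\<open>HOL-Library.Function_Algebras\<close>.\<close>

instantiation "fun" :: (type, real_vector) real_vector
begin

definition scaleR_fun :: "real \<Rightarrow> ('a \<Rightarrow> 'b) \<Rightarrow> 'a \<Rightarrow> 'b"
  where "scaleR_fun c f = (\<lambda>x. c *\<^sub>R f x)"

instance
  by standard (auto simp: scaleR_fun_def fun_eq_iff scaleR_add_right scaleR_add_left)

end

definition square_integrable :: "(real^'n) set \<Rightarrow> (real^'n \<Rightarrow> 'b::euclidean_space) \<Rightarrow> bool"
  where "square_integrable \<Omega> f \<longleftrightarrow>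
    f \<in> borel_measurable (lebesgue_on \<Omega>) \<and> integrable (lebesgue_on \<Omega>) (\<lambda>x. f x \<bullet> f x)"

definition L2_inner :: "(real^'n) set \<Rightarrow> (real^'n \<Rightarrow> 'b::euclidean_space) \<Rightarrow> (real^'n \<Rightarrow> 'b) \<Rightarrow> real"
  where "L2_inner \<Omega> f g = integral\<^sup>L (lebesgue_on \<Omega>) (\<lambda>x. f x \<bullet> g x)"

definition L2_norm :: "(real^'n) set \<Rightarrow> (real^'n \<Rightarrow> 'b::euclidean_space) \<Rightarrow> real"
  where "L2_norm \<Omega> f = sqrt (L2_inner \<Omega> f f)"

definition pderiv_at :: "'n::finite \<Rightarrow> (real^'n \<Rightarrow> real) \<Rightarrow> real^'n \<Rightarrow> real"
  where "pderiv_at i f x = frechet_derivative f (at x) (axis i 1)"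

primrec iter_pderiv :: "'n::finite list \<Rightarrow> (real^'n \<Rightarrow> real) \<Rightarrow> real^'n \<Rightarrow> real"
  where
    "iter_pderiv [] f = f"
  | "iter_pderiv (i # is) f = pderiv_at i (iter_pderiv is f)"

text \<open>If all iterated partial derivatives are Frechet differentiable, they are in
  particular continuous, so this is the usual notion of a smooth function.\<close>

definition smooth :: "(real^'n::finite \<Rightarrow> real) \<Rightarrow> bool"
  where "smooth f \<longleftrightarrow> (\<forall>is x. iter_pderiv is f differentiable (at x))"

definition test_functions :: "(real^'n::finite) set \<Rightarrow> (real^'n \<Rightarrow> real) set"
  where "test_functions \<Omega> =
    {\<phi>. smooth \<phi> \<and> compact (closure {x. \<phi> x \<noteq> 0}) \<and> closure {x. \<phi> x \<noteq> 0} \<subseteq> \<Omega>}"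

definition is_weak_grad :: "(real^'n::finite) set \<Rightarrow> (real^'n \<Rightarrow> real) \<Rightarrow> (real^'n \<Rightarrow> real^'n) \<Rightarrow> bool"
  where "is_weak_grad \<Omega> u g \<longleftrightarrow> square_integrable \<Omega> g \<and>
    (\<forall>\<phi>\<in>test_functions \<Omega>. \<forall>i. L2_inner \<Omega> u (pderiv_at i \<phi>) = - L2_inner \<Omega> (\<lambda>x. g x $ i) \<phi>)"

text \<open>The weak gradient is unique only almost everywhere on \<open>\<Omega>\<close>; \<open>weak_grad\<close> picks a
  representative, and it is used only under integrals over \<open>\<Omega>\<close>.\<close>

definition weak_grad :: "(real^'n::finite) set \<Rightarrow> (real^'n \<Rightarrow> real) \<Rightarrow> real^'n \<Rightarrow> real^'n"
  where "weak_grad \<Omega> u = (SOME g. is_weak_grad \<Omega> u g)"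

definition H1 :: "(real^'n::finite) set \<Rightarrow> (real^'n \<Rightarrow> real) set"
  where "H1 \<Omega> = {u. square_integrable \<Omega> u \<and> (\<exists>g. is_weak_grad \<Omega> u g)}"

definition H1_norm :: "(real^'n::finite) set \<Rightarrow> (real^'n \<Rightarrow> real) \<Rightarrow> real"
  where "H1_norm \<Omega> u = sqrt ((L2_norm \<Omega> u)\<^sup>2 + (L2_norm \<Omega> (weak_grad \<Omega> u))\<^sup>2)"

definition H1_0 :: "(real^'n::finite) set \<Rightarrow> (real^'n \<Rightarrow> real) set"
  where "H1_0 \<Omega> = {u \<in> H1 \<Omega>. \<exists>\<phi>::nat \<Rightarrow> real^'n \<Rightarrow> real.
    (\<forall>n. \<phi> n \<in> test_functions \<Omega>) \<and> (\<lambda>n. H1_norm \<Omega> (\<phi> n - u)) \<longlonglongrightarrow> 0}"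

text \<open>Row \<open>i\<close> of the Jacobian is the gradient of the \<open>i\<close>-th component. The inner product on
  \<^typ>\<open>real^'n^'n\<close> is the Frobenius product.\<close>

definition weak_jacobian :: "(real^'n::finite) set \<Rightarrow> (real^'n \<Rightarrow> real^'n) \<Rightarrow> real^'n \<Rightarrow> real^'n^'n"
  where "weak_jacobian \<Omega> u x = (\<chi> i. weak_grad \<Omega> (\<lambda>y. u y $ i) x)"

definition weak_div :: "(real^'n::finite) set \<Rightarrow> (real^'n \<Rightarrow> real^'n) \<Rightarrow> real^'n \<Rightarrow> real"
  where "weak_div \<Omega> u x = trace (weak_jacobian \<Omega> u x)"

definition strain :: "(real^'n::finite) set \<Rightarrow> (real^'n \<Rightarrow> real^'n) \<Rightarrow> real^'n \<Rightarrow> real^'n^'n"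
  where "strain \<Omega> u x = (1/2) *\<^sub>R (weak_jacobian \<Omega> u x + transpose (weak_jacobian \<Omega> u x))"

definition H1_norm_vec :: "(real^'n::finite) set \<Rightarrow> (real^'n \<Rightarrow> real^'n) \<Rightarrow> real"
  where "H1_norm_vec \<Omega> u = sqrt ((L2_norm \<Omega> u)\<^sup>2 + (L2_norm \<Omega> (weak_jacobian \<Omega> u))\<^sup>2)"

text \<open>Near each boundary point, \<open>\<Omega>\<close> lies strictly above the graph of a Lipschitz function
  defined on a hyperplane with unit normal \<open>e\<close>.\<close>

definition lipschitz_boundary :: "(real^'n::finite) set \<Rightarrow> bool"
  where "lipschitz_boundary \<Omega> \<longleftrightarrow> (\<forall>x\<in>frontier \<Omega>. \<exists>e r L (g::real^'n \<Rightarrow> real).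
    norm e = 1 \<and> r > 0 \<and> L-lipschitz_on {z. z \<bullet> e = 0} g \<and>
    \<Omega> \<inter> ball x r = {y \<in> ball x r. g (y - (y \<bullet> e) *\<^sub>R e) < y \<bullet> e})"

text \<open>A conforming simplicial mesh of size \<open>h\<close>. Its union is \<open>closure \<Omega>\<close> for polyhedral \<open>\<Omega>\<close>;
  for curved domains it may be the closure of an inner polyhedral approximation, on the
  complement of which the finite-element functions are extended by zero.\<close>

definition is_mesh :: "(real^'n::finite) set \<Rightarrow> real \<Rightarrow> (real^'n) set set \<Rightarrow> bool"
  where "is_mesh \<Omega> h T \<longleftrightarrow> triangulation T \<and> T \<noteq> {} \<and> (\<forall>S\<in>T. int CARD('n) simplex S) \<and>
    \<Union>T \<subseteq> closure \<Omega> \<and> h = Max (diameter ` T)"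

definition P1_space :: "(real^'n::finite) set \<Rightarrow> (real^'n) set set \<Rightarrow> (real^'n \<Rightarrow> real) set"
  where "P1_space \<Omega> T = {v \<in> H1_0 \<Omega>. continuous_on UNIV v \<and> (\<forall>x. x \<notin> \<Omega> \<inter> \<Union>T \<longrightarrow> v x = 0) \<and>
    (\<forall>S\<in>T. \<exists>a b. \<forall>x\<in>S. v x = a \<bullet> x + b)}"

definition vertices :: "(real^'n::finite) set \<Rightarrow> (real^'n) set"
  where "vertices S = {c. c extreme_point_of S}"

text \<open>The weights are unique because the vertices of a simplex are affinely independent;
  \<open>barycentric S x c\<close> is meaningful only for \<open>c \<in> vertices S\<close>.\<close>

definition barycentric :: "(real^'n::finite) set \<Rightarrow> real^'n \<Rightarrow> real^'n \<Rightarrow> real"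
  where "barycentric S x =
    (SOME w. sum w (vertices S) = 1 \<and> (\<Sum>c\<in>vertices S. w c *\<^sub>R c) = x)"

definition bubble :: "(real^'n::finite) set \<Rightarrow> real^'n \<Rightarrow> real"
  where "bubble S x = (if x \<in> S then \<Prod>c\<in>vertices S. barycentric S x c else 0)"

definition P1_bubble_space :: "(real^'n::finite) set \<Rightarrow> (real^'n) set set \<Rightarrow> (real^'n \<Rightarrow> real) set"
  where "P1_bubble_space \<Omega> T = {w \<in> H1_0 \<Omega>. \<exists>v\<in>P1_space \<Omega> T. \<exists>c. w = v + (\<Sum>S\<in>T. c S *\<^sub>R bubble S)}"

definition vector_space_of :: "(real^'n::finite \<Rightarrow> real) set \<Rightarrow> (real^'n \<Rightarrow> real^'n) set"
  where "vector_space_of W = {u. \<forall>i. (\<lambda>x. u x $ i) \<in> W}"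

definition P1_P1_pair where
  "P1_P1_pair \<Omega> T V Q \<longleftrightarrow> V = vector_space_of (P1_space \<Omega> T) \<and> Q = P1_space \<Omega> T"

definition Mini_pair where
  "Mini_pair \<Omega> T V Q \<longleftrightarrow> V = vector_space_of (P1_bubble_space \<Omega> T) \<and> Q = P1_space \<Omega> T"

text \<open>Suprema and infima of quotients are taken in the extended reals, so that no boundedness
  has to be known in advance.\<close>

definition weak_inf_sup ::
  "(real^'n::finite) set \<Rightarrow> real \<Rightarrow> (real^'n \<Rightarrow> real^'n) set \<Rightarrow> (real^'n \<Rightarrow> real) set \<Rightarrow> real \<Rightarrow> real \<Rightarrow> bool"
  where "weak_inf_sup \<Omega> h V Q \<gamma>B \<xi> \<longleftrightarrow> (\<forall>q\<in>Q.
    (SUP v\<in>V - {0}. ereal (L2_inner \<Omega> (weak_div \<Omega> v) q / H1_norm_vec \<Omega> v))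
      \<ge> ereal (\<gamma>B * L2_norm \<Omega> q - \<xi> * h * L2_norm \<Omega> (weak_grad \<Omega> q)))"

definition linear_map_on :: "'a::real_vector set \<Rightarrow> ('a \<Rightarrow> 'b::real_vector) \<Rightarrow> bool"
  where "linear_map_on W f \<longleftrightarrow>
    (\<forall>u\<in>W. \<forall>v\<in>W. f (u + v) = f u + f v) \<and> (\<forall>c. \<forall>u\<in>W. f (c *\<^sub>R u) = c *\<^sub>R f u)"

text \<open>Functionals on \<open>W\<close> are represented by functions vanishing off \<open>W\<close>, so that equality of
  functionals is equality of functions. Only finite-dimensional \<open>W\<close> occur, hence no
  continuity requirement.\<close>

definition dual :: "'a::real_vector set \<Rightarrow> ('a \<Rightarrow> real) set"
  where "dual W = {f. linear_map_on W f \<and> (\<forall>u. u \<notin> W \<longrightarrow> f u = 0)}"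

definition isomorphism_on :: "'a::real_vector set \<Rightarrow> 'b::real_vector set \<Rightarrow> ('a \<Rightarrow> 'b) \<Rightarrow> bool"
  where "isomorphism_on W Z f \<longleftrightarrow> linear_map_on W f \<and> bij_betw f W Z"

text \<open>\<open>form_op W b\<close> is the operator into the dual of \<open>W\<close> induced by the bilinear form \<open>b\<close>.\<close>

definition form_op :: "'b set \<Rightarrow> ('a \<Rightarrow> 'b \<Rightarrow> real) \<Rightarrow> 'a \<Rightarrow> 'b \<Rightarrow> real"
  where "form_op W b u = (\<lambda>v. if v \<in> W then b u v else 0)"

definition adjoint_op :: "'a set \<Rightarrow> ('a \<Rightarrow> 'b \<Rightarrow> real) \<Rightarrow> 'b \<Rightarrow> 'a \<Rightarrow> real"
  where "adjoint_op V B p = (\<lambda>v. if v \<in> V then B v p else 0)"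

definition elastic_form ::
  "real \<Rightarrow> real \<Rightarrow> (real^'n::finite) set \<Rightarrow> (real^'n \<Rightarrow> real^'n) \<Rightarrow> (real^'n \<Rightarrow> real^'n) \<Rightarrow> real"
  where "elastic_form lam \<mu> \<Omega> u v =
    2 * \<mu> * L2_inner \<Omega> (strain \<Omega> u) (strain \<Omega> v) + lam * L2_inner \<Omega> (weak_div \<Omega> u) (weak_div \<Omega> v)"

definition grad_form ::
  "(real^'n::finite) set \<Rightarrow> (real^'n \<Rightarrow> real) \<Rightarrow> (real^'n \<Rightarrow> real) \<Rightarrow> real"
  where "grad_form \<Omega> p q = L2_inner \<Omega> (weak_grad \<Omega> p) (weak_grad \<Omega> q)"

definition darcy_form ::
  "real \<Rightarrow> (real^'n::finite) set \<Rightarrow> (real^'n \<Rightarrow> real) \<Rightarrow> (real^'n \<Rightarrow> real) \<Rightarrow> real"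
  where "darcy_form K \<Omega> p q = L2_inner \<Omega> (\<lambda>x. K *\<^sub>R weak_grad \<Omega> p x) (weak_grad \<Omega> q)"

definition A_u where "A_u lam \<mu> \<Omega> V = form_op V (elastic_form lam \<mu> \<Omega>)"

definition B_op where "B_op \<Omega> Q = form_op Q (\<lambda>u q. - L2_inner \<Omega> (weak_div \<Omega> u) q)"

definition A_p where "A_p K \<Omega> Q = form_op Q (darcy_form K \<Omega>)"

definition L_p where "L_p \<Omega> Q = form_op Q (grad_form \<Omega>)"

definition zeta :: "'n::finite itself \<Rightarrow> real \<Rightarrow> real \<Rightarrow> real"
  where "zeta _ lam \<mu> = sqrt (lam + 2 * \<mu> / real CARD('n))"

definition X_norm ::
  "real \<Rightarrow> real \<Rightarrow> real \<Rightarrow> real \<Rightarrow> real \<Rightarrow> real \<Rightarrow> real \<Rightarrow> (real^'n::finite) set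
    \<Rightarrow> (real^'n \<Rightarrow> real^'n) \<times> (real^'n \<Rightarrow> real) \<Rightarrow> real"
  where "X_norm lam \<mu> \<alpha> K h \<tau> \<eta> \<Omega> x = (case x of (u, p) \<Rightarrow>
    sqrt (elastic_form lam \<mu> \<Omega> u u + \<tau> * darcy_form K \<Omega> p p + \<eta> * h\<^sup>2 * grad_form \<Omega> p p
      + \<alpha>\<^sup>2 / (zeta TYPE('n) lam \<mu>)\<^sup>2 * (L2_norm \<Omega> p)\<^sup>2))"

definition Biot_form ::
  "real \<Rightarrow> real \<Rightarrow> real \<Rightarrow> real \<Rightarrow> real \<Rightarrow> real \<Rightarrow> real \<Rightarrow> (real^'n::finite) set
    \<Rightarrow> (real^'n \<Rightarrow> real^'n) set \<Rightarrow> (real^'n \<Rightarrow> real) set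
    \<Rightarrow> (real^'n \<Rightarrow> real^'n) \<times> (real^'n \<Rightarrow> real) \<Rightarrow> (real^'n \<Rightarrow> real^'n) \<times> (real^'n \<Rightarrow> real) \<Rightarrow> real"
  where "Biot_form lam \<mu> \<alpha> K h \<tau> \<eta> \<Omega> V Q x y = (case x of (u, p) \<Rightarrow> case y of (v, q) \<Rightarrow>
    A_u lam \<mu> \<Omega> V u v + \<alpha> * B_op \<Omega> Q v p + \<alpha> * B_op \<Omega> Q u q
      - \<tau> * L2_inner \<Omega> (\<lambda>z. K *\<^sub>R weak_grad \<Omega> p z) (weak_grad \<Omega> q)
      - \<eta> * h\<^sup>2 * L2_inner \<Omega> (weak_grad \<Omega> p) (weak_grad \<Omega> q))"

text \<open>The block operator, with the dual of \<open>V \<times> Q\<close> identified with \<open>dual V \<times> dual Q\<close>.\<close>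

definition Biot_op ::
  "real \<Rightarrow> real \<Rightarrow> real \<Rightarrow> real \<Rightarrow> real \<Rightarrow> real \<Rightarrow> real \<Rightarrow> (real^'n::finite) set
    \<Rightarrow> (real^'n \<Rightarrow> real^'n) set \<Rightarrow> (real^'n \<Rightarrow> real) set
    \<Rightarrow> (real^'n \<Rightarrow> real^'n) \<times> (real^'n \<Rightarrow> real)
    \<Rightarrow> ((real^'n \<Rightarrow> real^'n) \<Rightarrow> real) \<times> ((real^'n \<Rightarrow> real) \<Rightarrow> real)"
  where "Biot_op lam \<mu> \<alpha> K h \<tau> \<eta> \<Omega> V Q x = (case x of (u, p) \<Rightarrow>
    (A_u lam \<mu> \<Omega> V u + \<alpha> *\<^sub>R adjoint_op V (B_op \<Omega> Q) p,
     \<alpha> *\<^sub>R B_op \<Omega> Q u - \<tau> *\<^sub>R A_p K \<Omega> Q p - (\<eta> * h\<^sup>2) *\<^sub>R L_p \<Omega> Q p))"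

lemma Biot_op_pairing:
  assumes "v \<in> V" "q \<in> Q"
  shows "fst (Biot_op lam \<mu> \<alpha> K h \<tau> \<eta> \<Omega> V Q x) v + snd (Biot_op lam \<mu> \<alpha> K h \<tau> \<eta> \<Omega> V Q x) q
    = Biot_form lam \<mu> \<alpha> K h \<tau> \<eta> \<Omega> V Q x (v, q)"
  using assms
  by (simp add: Biot_op_def Biot_form_def adjoint_op_def A_p_def L_p_def form_op_def
      darcy_form_def grad_form_def scaleR_fun_def split: prod.split)

end

(* The proof is the usual one for stabilised saddle point problems: with w provided by the weak
   inf-sup condition for p, testing with y = (u - theta w, -p) gives coercivity, because a multiple
   of the pressure mass norm is gained from w and the loss xi h |grad p| is absorbed by the
   stabilisation term. All constants are explicit, hence independent of the parameters, since
   zeta |div u| <= |u|_A and |u|_A <= sqrt d zeta |u|_1.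

   Two points need analysis. Weak gradients are chosen representatives, so the forms are bilinear
   only thanks to uniqueness up to null sets, that is, the fundamental lemma of the calculus of
   variations. And the energy norm is definite: strain zero forces d_i u_i = 0, hence u_i = 0 by
   the Poincare inequality in direction i. *)
theory Submission
  imports Defs
begin

section \<open>Square-integrable functions\<close>

text \<open>The weights of the norm fit together. Dividing the weak inf-sup condition by sqrt d
  \<zeta> replaces |v|_1 by the energy norm, and multiplying it by \<alpha> turns |p| into the mass
  norm (\<alpha> / \<zeta>) |p|. The defect \<xi> h |grad p| then carries the factor \<alpha> /
  \<zeta> as well, which is the weight of the stabilisation seminorm for \<eta> = \<delta>
  \<alpha>^2 / \<zeta>^2; it becomes \<xi> / sqrt (d \<delta>) times that seminorm. Control of p is
  thus gained without the Darcy term, whose factor \<tau> K may be arbitrarily small.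

  Two features of the setting shape the rest. Elements of the spaces are functions, not classes
  modulo null sets, so a vanishing norm gives the zero function only because finite-element
  functions are continuous and vanish outside the closure of the domain. And the spaces are subsets
  of a function type, of finite dimension only in the sense that a finite set spans a space
  containing them; surjectivity of the operator therefore follows from injectivity by counting
  independent vectors.\<close>

lemma discriminant_nonpos:
  fixes a b c :: real
  assumes "\<And>t. 0 \<le> a + 2 * t * b + t\<^sup>2 * c"
  shows "b\<^sup>2 \<le> a * c"
proof (cases "c = 0")
  case True
  have "b = 0"
  proof (rule ccontr)
    assume "b \<noteq> 0"
    \<comment> \<open>With \<open>c = 0\<close> this \<open>t\<close> gives the value a - (a + 1) =
      -1.\<close>
    then show False using assms[of "- (a + 1) / (2 * b)"] True by (simp add: field_simps)
  qed
  then show ?thesis by (simp add: True)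
next
  case False
  have "c \<ge> 0"
  proof (rule ccontr)
    assume c: "\<not> c \<ge> 0"
    \<comment> \<open>For \<open>c < 0\<close> the quadratic term has to win: \<open>t\<close> is at
      least 1 and large enough that t (-c) exceeds 1 + |a| + 2 |b|, so t^2 (-c) exceeds a + 2 t
      b.\<close>
    define t where "t = (1 + \<bar>a\<bar> + 2 * \<bar>b\<bar>) / (- c) + 1"
    have t1: "t \<ge> 1" using c divide_nonneg_pos[of "1 + \<bar>a\<bar> + 2 * \<bar>b\<bar>" "- c"] by (simp add: t_def)
    have "t * (- c) = (1 + \<bar>a\<bar> + 2 * \<bar>b\<bar>) + (- c)"
      using c by (simp add: t_def field_simps)
    then have tc: "t * (- c) > 1 + \<bar>a\<bar> + 2 * \<bar>b\<bar>" using c by linarith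
    have "t * (t * (- c)) \<ge> t * (1 + \<bar>a\<bar> + 2 * \<bar>b\<bar>)"
      using tc t1 by (intro mult_left_mono) auto
    moreover have "t * (1 + \<bar>a\<bar>) \<ge> 1 * (1 + \<bar>a\<bar>)" using t1 by (intro mult_right_mono) auto
    moreover have "t * b \<le> t * \<bar>b\<bar>" using t1 by (intro mult_left_mono) auto
    ultimately have "a + 2 * t * b + t\<^sup>2 * c < 0"
      by (simp add: power2_eq_square algebra_simps)
    then show False using assms[of t] by simp
  qed
  then have c: "c > 0" using False by simp
  \<comment> \<open>The parabola is evaluated at its minimiser -b / c.\<close>
  have "0 \<le> (a + 2 * (- b / c) * b + (- b / c)\<^sup>2 * c) * c"
    using assms[of "- b / c"] c by (intro mult_nonneg_nonneg) auto
  also have "\<dots> = a * c - b\<^sup>2" using c by (simp add: field_simps power2_eq_square)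
  finally show ?thesis by simp
qed

lemma square_integrable_measurable [measurable_dest]:
  "square_integrable \<Omega> f \<Longrightarrow> f \<in> borel_measurable (lebesgue_on \<Omega>)"
  by (simp add: square_integrable_def)

lemma square_integrable_bound:
  fixes f :: "real^'n \<Rightarrow> 'b::euclidean_space"
  assumes "f \<in> borel_measurable (lebesgue_on \<Omega>)" "integrable (lebesgue_on \<Omega>) g"
    "\<And>x. f x \<bullet> f x \<le> g x"
  shows "square_integrable \<Omega> f"
  unfolding square_integrable_def
proof
  show "integrable (lebesgue_on \<Omega>) (\<lambda>x. f x \<bullet> f x)"
    using assms by (intro Bochner_Integration.integrable_bound[OF assms(2)] borel_measurable_inner AE_I2)
      (auto intro: order_trans[OF assms(3)])
qed (fact assms)

lemma square_integrable_inner: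
  fixes f g :: "real^'n \<Rightarrow> 'b::euclidean_space"
  assumes f: "square_integrable \<Omega> f" and g: "square_integrable \<Omega> g"
  shows "integrable (lebesgue_on \<Omega>) (\<lambda>x. f x \<bullet> g x)"
proof (rule Bochner_Integration.integrable_bound)
  show "integrable (lebesgue_on \<Omega>) (\<lambda>x. f x \<bullet> f x + g x \<bullet> g x)"
    using f g by (auto simp: square_integrable_def)
  show "(\<lambda>x. f x \<bullet> g x) \<in> borel_measurable (lebesgue_on \<Omega>)"
    using f g by (auto simp: square_integrable_def)
  have "\<bar>f x \<bullet> g x\<bar> \<le> f x \<bullet> f x + g x \<bullet> g x" for x
  proof -
    have "0 \<le> (f x + g x) \<bullet> (f x + g x)" "0 \<le> (f x - g x) \<bullet> (f x - g x)"
      "0 \<le> f x \<bullet> f x" "0 \<le> g x \<bullet> g x" by auto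
    then show ?thesis by (auto simp: inner_add inner_diff inner_commute)
  qed
  then show "AE x in lebesgue_on \<Omega>. norm (f x \<bullet> g x) \<le> norm (f x \<bullet> f x + g x \<bullet> g x)"
    by (intro AE_I2) (auto intro: order_trans)
qed

lemma square_integrable_bounded_linear:
  fixes f :: "real^'n \<Rightarrow> 'b::euclidean_space" and A :: "'b \<Rightarrow> 'c::euclidean_space"
  assumes A: "bounded_linear A" and f: "square_integrable \<Omega> f"
  shows "square_integrable \<Omega> (\<lambda>x. A (f x))"
proof -
  obtain K where K: "norm (A y) \<le> norm y * K" for y
    using bounded_linear.bounded[OF A] by blast
  have A_le: "A y \<bullet> A y \<le> K\<^sup>2 * (y \<bullet> y)" for y
  proof -
    have "(norm (A y))\<^sup>2 \<le> (norm y * K)\<^sup>2" by (intro power_mono K) auto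
    then show ?thesis by (simp add: dot_square_norm power_mult_distrib mult.commute)
  qed
  show ?thesis
  proof (rule square_integrable_bound)
    show "(\<lambda>x. A (f x)) \<in> borel_measurable (lebesgue_on \<Omega>)"
      using f borel_measurable_continuous_onI[OF linear_continuous_on[OF A]]
      by (auto simp: square_integrable_def intro: measurable_compose)
    show "integrable (lebesgue_on \<Omega>) (\<lambda>x. K\<^sup>2 * (f x \<bullet> f x))"
      using f by (auto simp: square_integrable_def)
  qed (rule A_le)
qed

lemma square_integrable_zero [simp]: "square_integrable \<Omega> (\<lambda>x. 0)"
  by (simp add: square_integrable_def)

lemma square_integrable_add:
  assumes f: "square_integrable \<Omega> f" and g: "square_integrable \<Omega> g"
  shows "square_integrable \<Omega> (\<lambda>x. f x + g x)"
  using assms square_integrable_inner[OF f g] square_integrable_inner[OF g f]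
  unfolding square_integrable_def inner_add by auto

lemma square_integrable_scaleR:
  "square_integrable \<Omega> f \<Longrightarrow> square_integrable \<Omega> (\<lambda>x. c *\<^sub>R f x)"
  by (rule square_integrable_bounded_linear[OF bounded_linear_scaleR_right])

lemma square_integrable_diff:
  assumes "square_integrable \<Omega> f" "square_integrable \<Omega> g"
  shows "square_integrable \<Omega> (\<lambda>x. f x - g x)"
  using square_integrable_add[OF assms(1) square_integrable_scaleR[OF assms(2), of "-1"]] by simp

lemma square_integrable_component:
  fixes f :: "real^'n \<Rightarrow> real^'m"
  assumes "square_integrable \<Omega> f"
  shows "square_integrable \<Omega> (\<lambda>x. f x $ i)"
  by (rule square_integrable_bounded_linear[OF bounded_linear_vec_nth assms])

lemma square_integrable_vec_lambda:
  fixes f :: "'m::finite \<Rightarrow> real^'n \<Rightarrow> 'b::euclidean_space"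
  assumes "\<And>i. square_integrable \<Omega> (f i)"
  shows "square_integrable \<Omega> (\<lambda>x. \<chi> i. f i x)"
proof -
  have "(\<lambda>x. \<chi> i. f i x) \<in> borel_measurable (lebesgue_on \<Omega>)"
  proof (rule borel_measurable_euclidean_space[THEN iffD2], rule ballI)
    fix e :: "'b^'m" assume "e \<in> Basis"
    then obtain k u where "e = axis k u" by (auto simp: Basis_vec_def)
    then have "(\<chi> i. f i x) \<bullet> e = f k x \<bullet> u" for x by (simp add: inner_axis)
    then show "(\<lambda>x. (\<chi> i. f i x) \<bullet> e) \<in> borel_measurable (lebesgue_on \<Omega>)"
      using assms[of k] by (auto simp: square_integrable_def intro: borel_measurable_inner)
  qed
  then show ?thesis
    using assms by (auto simp: square_integrable_def inner_vec_def)
qed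

section \<open>The L2 inner product and norm\<close>

lemma L2_inner_commute: "L2_inner \<Omega> f g = L2_inner \<Omega> g f"
  by (simp add: L2_inner_def inner_commute)

lemma L2_inner_add_left:
  assumes "square_integrable \<Omega> f" "square_integrable \<Omega> f'" "square_integrable \<Omega> g"
  shows "L2_inner \<Omega> (\<lambda>x. f x + f' x) g = L2_inner \<Omega> f g + L2_inner \<Omega> f' g"
  by (simp add: L2_inner_def inner_add_left square_integrable_inner assms)

lemma L2_inner_scaleR_left: "L2_inner \<Omega> (\<lambda>x. c *\<^sub>R f x) g = c * L2_inner \<Omega> f g"
  by (simp add: L2_inner_def)

lemma L2_inner_add_right:
  assumes "square_integrable \<Omega> f" "square_integrable \<Omega> f'" "square_integrable \<Omega> g"
  shows "L2_inner \<Omega> g (\<lambda>x. f x + f' x) = L2_inner \<Omega> g f + L2_inner \<Omega> g f'"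
  by (simp add: L2_inner_def inner_add_right square_integrable_inner assms)

lemma L2_inner_scaleR_right: "L2_inner \<Omega> g (\<lambda>x. c *\<^sub>R f x) = c * L2_inner \<Omega> g f"
  by (simp add: L2_inner_def)

lemma L2_inner_diff_left:
  assumes "square_integrable \<Omega> f" "square_integrable \<Omega> f'" "square_integrable \<Omega> g"
  shows "L2_inner \<Omega> (\<lambda>x. f x - f' x) g = L2_inner \<Omega> f g - L2_inner \<Omega> f' g"
  by (simp add: L2_inner_def inner_diff_left square_integrable_inner assms)

lemma L2_inner_cong_AE:
  assumes "AE x in lebesgue_on \<Omega>. f x = f' x" "AE x in lebesgue_on \<Omega>. g x = g' x"
    and "square_integrable \<Omega> f" "square_integrable \<Omega> f'"
    and "square_integrable \<Omega> g" "square_integrable \<Omega> g'"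
  shows "L2_inner \<Omega> f g = L2_inner \<Omega> f' g'"
  unfolding L2_inner_def using assms by (intro integral_cong_AE) auto

lemma L2_inner_self_nonneg [simp]: "0 \<le> L2_inner \<Omega> f f"
  by (simp add: L2_inner_def)

lemma L2_norm_nonneg [simp]: "0 \<le> L2_norm \<Omega> f"
  by (simp add: L2_norm_def)

lemma L2_norm_power2: "(L2_norm \<Omega> f)\<^sup>2 = L2_inner \<Omega> f f"
  by (simp add: L2_norm_def)

lemma L2_inner_zero [simp]: "L2_inner \<Omega> (\<lambda>x. 0) g = 0" "L2_inner \<Omega> g (\<lambda>x. 0) = 0"
  by (simp_all add: L2_inner_def)

lemma L2_Cauchy_Schwarz_power2:
  assumes f: "square_integrable \<Omega> f" and g: "square_integrable \<Omega> g"
  shows "(L2_inner \<Omega> f g)\<^sup>2 \<le> L2_inner \<Omega> f f * L2_inner \<Omega> g g"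
proof (rule discriminant_nonpos)
  fix t :: real
  let ?h = "\<lambda>x. f x + t *\<^sub>R g x"
  have tg: "square_integrable \<Omega> (\<lambda>x. t *\<^sub>R g x)" by (rule square_integrable_scaleR[OF g])
  have h: "square_integrable \<Omega> ?h" by (rule square_integrable_add[OF f tg])
  have "0 \<le> L2_inner \<Omega> ?h ?h" by simp
  also have "\<dots> = L2_inner \<Omega> f f + 2 * t * L2_inner \<Omega> f g + t\<^sup>2 * L2_inner \<Omega> g g"
    by (simp add: L2_inner_add_left L2_inner_add_right L2_inner_scaleR_left
        L2_inner_scaleR_right f g tg h L2_inner_commute[of _ g f] algebra_simps power2_eq_square
        del: real_scaleR_def)
  finally show "0 \<le> L2_inner \<Omega> f f + 2 * t * L2_inner \<Omega> f g + t\<^sup>2 * L2_inner \<Omega> g g" .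
qed

lemma L2_Cauchy_Schwarz:
  assumes "square_integrable \<Omega> f" "square_integrable \<Omega> g"
  shows "\<bar>L2_inner \<Omega> f g\<bar> \<le> L2_norm \<Omega> f * L2_norm \<Omega> g"
  using real_sqrt_le_mono[OF L2_Cauchy_Schwarz_power2[OF assms]]
  by (simp add: L2_norm_def real_sqrt_mult)

lemma L2_norm_scaleR: "L2_norm \<Omega> (\<lambda>x. c *\<^sub>R f x) = \<bar>c\<bar> * L2_norm \<Omega> f"
  by (simp add: L2_norm_def L2_inner_scaleR_left L2_inner_scaleR_right real_sqrt_mult
      flip: mult.assoc)

lemma L2_norm_triangle:
  assumes f: "square_integrable \<Omega> f" and g: "square_integrable \<Omega> g"
  shows "L2_norm \<Omega> (\<lambda>x. f x + g x) \<le> L2_norm \<Omega> f + L2_norm \<Omega> g"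
proof (rule power2_le_imp_le)
  let ?h = "\<lambda>x. f x + g x"
  have h: "square_integrable \<Omega> ?h" by (rule square_integrable_add[OF f g])
  have "(L2_norm \<Omega> ?h)\<^sup>2 = (L2_norm \<Omega> f)\<^sup>2 + 2 * L2_inner \<Omega> f g + (L2_norm \<Omega> g)\<^sup>2"
    by (simp add: L2_norm_power2 L2_inner_add_left L2_inner_add_right f g h
        L2_inner_commute[of _ g f])
  also have "\<dots> \<le> (L2_norm \<Omega> f + L2_norm \<Omega> g)\<^sup>2"
    using L2_Cauchy_Schwarz[OF f g] by (simp add: power2_sum)
  finally show "(L2_norm \<Omega> ?h)\<^sup>2 \<le> (L2_norm \<Omega> f + L2_norm \<Omega> g)\<^sup>2" .
qed auto

lemma L2_norm_cong_AE:
  assumes "AE x in lebesgue_on \<Omega>. f x = g x" "square_integrable \<Omega> f" "square_integrable \<Omega> g"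
  shows "L2_norm \<Omega> f = L2_norm \<Omega> g"
  by (simp add: L2_norm_def L2_inner_cong_AE[OF assms(1,1) assms(2,3,2,3)])

lemma L2_norm_mono:
  assumes "square_integrable \<Omega> f" "square_integrable \<Omega> g" "\<And>x. norm (f x) \<le> norm (g x)"
  shows "L2_norm \<Omega> f \<le> L2_norm \<Omega> g"
  unfolding L2_norm_def L2_inner_def
  using assms by (intro real_sqrt_le_mono integral_mono square_integrable_inner)
    (auto simp: dot_square_norm power_mono)

lemma L2_inner_self_eq_0_imp_AE:
  assumes "square_integrable \<Omega> f" "L2_inner \<Omega> f f = 0"
  shows "AE x in lebesgue_on \<Omega>. f x = 0"
proof -
  have "AE x in lebesgue_on \<Omega>. f x \<bullet> f x = 0"
    using assms by (subst integral_nonneg_eq_0_iff_AE[symmetric])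
      (auto simp: L2_inner_def square_integrable_inner)
  then show ?thesis by simp
qed

section \<open>Bilinear forms on subspaces\<close>

text \<open>The carriers are explicit subsets because the forms are integrals of chosen weak
  derivatives, which behave linearly only on the Sobolev spaces.\<close>

definition bilinear_on :: "'a::real_vector set \<Rightarrow> 'b::real_vector set \<Rightarrow> ('a \<Rightarrow> 'b \<Rightarrow> real) \<Rightarrow> bool"
  where "bilinear_on V Q b \<longleftrightarrow>
    (\<forall>q\<in>Q. linear_map_on V (\<lambda>v. b v q)) \<and> (\<forall>v\<in>V. linear_map_on Q (b v))"

lemma bilinear_on_simps:
  assumes "bilinear_on V Q b"
  shows "v \<in> V \<Longrightarrow> v' \<in> V \<Longrightarrow> q \<in> Q \<Longrightarrow> b (v + v') q = b v q + b v' q"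
    and "v \<in> V \<Longrightarrow> q \<in> Q \<Longrightarrow> b (c *\<^sub>R v) q = c * b v q"
    and "v \<in> V \<Longrightarrow> q \<in> Q \<Longrightarrow> q' \<in> Q \<Longrightarrow> b v (q + q') = b v q + b v q'"
    and "v \<in> V \<Longrightarrow> q \<in> Q \<Longrightarrow> b v (c *\<^sub>R q) = c * b v q"
  using assms by (auto simp: bilinear_on_def linear_map_on_def)

lemma bilinear_on_zero_left:
  assumes "bilinear_on V Q b" "v \<in> V" "q \<in> Q"
  shows "b 0 q = 0"
  using bilinear_on_simps(2)[OF assms, of 0] by simp

text \<open>Only semidefiniteness is assumed, so the discriminant criterion has to cover a vanishing
  leading coefficient. It serves the elastic, Darcy and stabilisation forms alike.\<close>

lemma semi_inner_Cauchy_Schwarz: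
  assumes V: "subspace V" and bil: "bilinear_on V V b"
    and sym: "\<And>u v. u \<in> V \<Longrightarrow> v \<in> V \<Longrightarrow> b u v = b v u"
    and pos: "\<And>u. u \<in> V \<Longrightarrow> 0 \<le> b u u"
    and uv: "u \<in> V" "v \<in> V"
  shows "\<bar>b u v\<bar> \<le> sqrt (b u u) * sqrt (b v v)"
proof -
  have "(b u v)\<^sup>2 \<le> b u u * b v v"
  proof (rule discriminant_nonpos)
    fix t :: real
    have tv: "t *\<^sub>R v \<in> V" "u + t *\<^sub>R v \<in> V"
      using V uv by (auto intro: subspace_add subspace_mul)
    have "0 \<le> b (u + t *\<^sub>R v) (u + t *\<^sub>R v)" by (rule pos[OF tv(2)])
    also have "\<dots> = b u u + 2 * t * b u v + t\<^sup>2 * b v v"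
      using uv tv sym[OF uv] by (simp add: bilinear_on_simps[OF bil] power2_eq_square algebra_simps)
    finally show "0 \<le> b u u + 2 * t * b u v + t\<^sup>2 * b v v" .
  qed
  from real_sqrt_le_mono[OF this] show ?thesis by (simp add: real_sqrt_mult)
qed

text \<open>In finite dimension the injective map x to b x is onto the dual. As \<open>X\<close> is
  a set rather than a type, dimension is handled by a basis \<open>B\<close>: a functional is
  encoded by its values on \<open>B\<close>, a function supported on \<open>B\<close>, and these
  functions lie in the span of card B indicators.\<close>

lemma nondegenerate_form_represents:
  fixes X :: "'a::real_vector set"
  assumes X: "subspace X" "X \<subseteq> span S" "finite S"
    and bil: "bilinear_on X X b"
    and nondeg: "\<And>x. x \<in> X \<Longrightarrow> (\<And>y. y \<in> X \<Longrightarrow> b x y = 0) \<Longrightarrow> x = 0"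
    and f: "linear_map_on X f"
  shows "\<exists>x\<in>X. \<forall>y\<in>X. b x y = f y"
proof -
  obtain B where B: "B \<subseteq> X" "independent B" "X \<subseteq> span B"
    using maximal_independent_subset by blast
  have finB: "finite B"
    using independent_span_bound[OF X(3) B(2)] B(1) X(2) by auto
  have spanB: "span B = X"
    using B X(1) by (metis span_minimal subset_antisym)
  \<comment> \<open>Two linear functionals on \<open>X\<close> that agree on the basis agree
    everywhere.\<close>
  have agree: "b x y = g y" if x: "x \<in> X" and g: "linear_map_on X g" and y: "y \<in> X"
    and eq: "\<And>z. z \<in> B \<Longrightarrow> b x z = g z" for x y g
  proof -
    let ?Y = "{y \<in> X. b x y = g y}"
    have g0: "g 0 = 0" and b0: "b x 0 = 0"
      using g y bilinear_on_simps(4)[OF bil x y, of 0] unfolding linear_map_on_def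
      by (metis mult_zero_left real_scaleR_def scale_zero_left, simp)
    have "subspace ?Y"
      unfolding subspace_def using X(1) g x g0 b0
      by (auto simp: subspace_0 subspace_add subspace_mul bilinear_on_simps[OF bil]
          linear_map_on_def)
    moreover have "B \<subseteq> ?Y" using B(1) eq by auto
    ultimately have "span B \<subseteq> ?Y" by (rule span_minimal[rotated])
    then show ?thesis using y spanB by auto
  qed
  \<comment> \<open>\<open>e z\<close> are the unit vectors of the coordinate space;
    \<open>J x\<close> is the coordinate vector of the functional \<open>b x\<close>.\<close>
  define e :: "'a \<Rightarrow> 'a \<Rightarrow> real" where "e z = (\<lambda>y. if y = z then 1 else 0)" for z
  define J where "J x = (\<lambda>y. if y \<in> B then b x y else 0)" for x
  \<comment> \<open>\<open>J\<close> is linear only on \<open>X\<close>; the results on images of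
    spans and of independent sets want a globally linear map, so \<open>J\<close> is replaced by a
    linear extension of its values on \<open>B\<close>.\<close>
  obtain g where g: "linear g" "\<And>x. x \<in> B \<Longrightarrow> g x = J x"
    using linear_independent_extend[OF B(2), of J] by blast
  have gJ: "g x = J x" if "x \<in> X" for x
  proof -
    have "subspace {x \<in> X. g x = J x}"
      unfolding subspace_def
    proof (intro conjI allI ballI)
      show "0 \<in> {x \<in> X. g x = J x}"
        using X(1) linear_0[OF g(1)] B(1) bilinear_on_zero_left[OF bil]
        by (auto simp: subspace_0 J_def fun_eq_iff)
    next
      fix x y assume "x \<in> {x \<in> X. g x = J x}" "y \<in> {x \<in> X. g x = J x}"
      then show "x + y \<in> {x \<in> X. g x = J x}"
        using X(1) B(1) by (auto simp: subspace_add linear_add[OF g(1)] J_def fun_eq_iff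
            bilinear_on_simps[OF bil])
    next
      fix c x assume "x \<in> {x \<in> X. g x = J x}"
      then show "c *\<^sub>R x \<in> {x \<in> X. g x = J x}"
        using X(1) B(1) by (auto simp: subspace_mul linear_scale[OF g(1)] J_def fun_eq_iff
            scaleR_fun_def bilinear_on_simps[OF bil])
    qed
    moreover have "B \<subseteq> {x \<in> X. g x = J x}" using B(1) g(2) by auto
    ultimately show ?thesis using that spanB span_minimal by blast
  qed
  have "inj_on g (span B)"
  proof (subst linear_inj_on_iff_eq_0[OF g(1) subspace_span])
    show "\<forall>x\<in>span B. g x = 0 \<longrightarrow> x = 0"
    proof (intro ballI impI)
      fix x assume x: "x \<in> span B" and "g x = 0"
      then have "b x z = 0" if "z \<in> B" for z
        using that gJ[of x] spanB by (auto simp: J_def fun_eq_iff split: if_splits)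
      then have "b x y = 0" if "y \<in> X" for y
        using agree[of x "\<lambda>_. 0" y] x spanB that by (auto simp: linear_map_on_def)
      then show "x = 0" using nondeg x spanB by auto
    qed
  qed
  then have ind: "independent (g ` B)" and card: "card (g ` B) = card B"
    using linear_independent_injective_image[OF g(1) B(2)] inj_on_subset[OF _ span_superset]
    by (auto intro: card_image)
  have J_span: "(\<lambda>y. if y \<in> B then h y else 0) \<in> span (e ` B)" for h
  proof -
    have "(\<lambda>y. if y \<in> B then h y else 0) = (\<Sum>z\<in>B. h z *\<^sub>R e z)"
    proof
      fix y
      have "(\<Sum>z\<in>B. h z *\<^sub>R e z) y = (\<Sum>z\<in>B. if z = y then h z else 0)"
        using finB by (induction rule: finite_induct) (auto simp: scaleR_fun_def e_def)
      then show "(if y \<in> B then h y else 0) = (\<Sum>z\<in>B. h z *\<^sub>R e z) y"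
        using finB by (simp add: sum.delta')
    qed
    then show ?thesis by (auto intro: span_sum span_scale span_base)
  qed
  have "g ` B \<subseteq> span (e ` B)" using J_span g(2) unfolding J_def by auto
  moreover have "(\<lambda>y. if y \<in> B then f y else 0) \<in> span (e ` B)" (is "?F \<in> _") by (rule J_span)
  ultimately have sub: "insert ?F (g ` B) \<subseteq> span (e ` B)" by blast
  have "?F \<in> span (g ` B)"
  proof (rule ccontr)
    assume F: "?F \<notin> span (g ` B)"
    then have "independent (insert ?F (g ` B))" using ind by (simp add: independent_insert)
    from independent_span_bound[OF finite_imageI[OF finB] this sub]
    have "card (insert ?F (g ` B)) \<le> card B"
      using card_image_le[OF finB, of e] by linarith
    moreover have "?F \<notin> g ` B" using F span_base[of ?F "g ` B"] by argo
    ultimately show False using card finB by simp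
  qed
  then have "?F \<in> g ` span B" using linear_span_image[OF g(1)] by blast
  then obtain x where x: "x \<in> X" "J x = (\<lambda>y. if y \<in> B then f y else 0)"
    using gJ spanB by auto
  have "b x z = f z" if "z \<in> B" for z
    using fun_cong[OF x(2), of z] that by (simp add: J_def)
  then show ?thesis using agree[OF x(1) f] x(1) by blast
qed

section \<open>Stabilised saddle point problems\<close>

text \<open>Intended reading: \<open>a\<close> is the elastic energy, \<open>b\<close> is \<alpha>
  times the divergence pairing, \<open>t\<close> the Darcy term, \<open>s\<close> the stabilisation
  and \<open>m\<close> the weighted pressure mass. All physical parameters are hidden in the forms,
  so a bound in terms of \<open>c1\<close> and \<open>c2\<close> is automatically uniform. The
  inf-sup condition asks for a witness whose energy is already normalised by
  \<open>m p p\<close>.\<close>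

locale stabilized_saddle_point =
  fixes V :: "'a::real_vector set" and Q :: "'b::real_vector set"
    and a :: "'a \<Rightarrow> 'a \<Rightarrow> real" and b :: "'a \<Rightarrow> 'b \<Rightarrow> real"
    and t s m :: "'b \<Rightarrow> 'b \<Rightarrow> real" and c1 c2 :: real
  assumes V: "subspace V" and Q: "subspace Q"
    and a: "bilinear_on V V a" and b: "bilinear_on V Q b"
    and t: "bilinear_on Q Q t" and s: "bilinear_on Q Q s" and m: "bilinear_on Q Q m"
    and a_sym: "\<And>u v. u \<in> V \<Longrightarrow> v \<in> V \<Longrightarrow> a u v = a v u"
    and t_sym: "\<And>p q. p \<in> Q \<Longrightarrow> q \<in> Q \<Longrightarrow> t p q = t q p"
    and s_sym: "\<And>p q. p \<in> Q \<Longrightarrow> q \<in> Q \<Longrightarrow> s p q = s q p"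
    and m_sym: "\<And>p q. p \<in> Q \<Longrightarrow> q \<in> Q \<Longrightarrow> m p q = m q p"
    and a_pos: "\<And>u. u \<in> V \<Longrightarrow> 0 \<le> a u u"
    and t_pos: "\<And>p. p \<in> Q \<Longrightarrow> 0 \<le> t p p"
    and s_pos: "\<And>p. p \<in> Q \<Longrightarrow> 0 \<le> s p p"
    and m_pos: "\<And>p. p \<in> Q \<Longrightarrow> 0 \<le> m p p"
    and a_definite: "\<And>u. u \<in> V \<Longrightarrow> a u u = 0 \<Longrightarrow> u = 0"
    and m_definite: "\<And>p. p \<in> Q \<Longrightarrow> m p p = 0 \<Longrightarrow> p = 0"
    and b_bound: "\<And>v p. v \<in> V \<Longrightarrow> p \<in> Q \<Longrightarrow> \<bar>b v p\<bar> \<le> sqrt (a v v) * sqrt (m p p)"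
    and inf_sup: "\<And>p. p \<in> Q \<Longrightarrow>
      \<exists>w\<in>V. a w w \<le> m p p \<and> c1 * m p p - c2 * (sqrt (s p p) * sqrt (m p p)) \<le> b w p"
    and c1: "c1 > 0"
begin

text \<open>The operator B is minus the divergence, hence the minus signs in front of both
  \<open>b\<close> terms.\<close>

definition L :: "'a \<times> 'b \<Rightarrow> 'a \<times> 'b \<Rightarrow> real"
  where "L x y = a (fst x) (fst y) - b (fst y) (snd x) - b (fst x) (snd y)
    - t (snd x) (snd y) - s (snd x) (snd y)"

definition N :: "'a \<times> 'b \<Rightarrow> real"
  where "N x = sqrt (a (fst x) (fst x) + t (snd x) (snd x) + s (snd x) (snd x) + m (snd x) (snd x))"

text \<open>The maximiser of \<theta> c1 - \<theta>^2 (1 + c2^2) / 2, the coefficient of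
  \<open>m p p\<close> that is left after Young's inequality.\<close>

definition \<theta> :: real where "\<theta> = c1 / (1 + c2\<^sup>2)"

text \<open>1/2 is what remains of \<open>a u u\<close> and \<open>s p p\<close> after the cross
  terms are absorbed; the other entry is the maximum attained at \<open>\<theta>\<close>.\<close>

definition \<kappa> :: real where "\<kappa> = min (1/2) (c1\<^sup>2 / (2 * (1 + c2\<^sup>2)))"

lemma \<theta>_pos: "\<theta> > 0" and \<kappa>_pos: "\<kappa> > 0"
  using c1 by (auto simp: \<theta>_def \<kappa>_def add_pos_nonneg)

lemma N_nonneg: "x \<in> V \<times> Q \<Longrightarrow> 0 \<le> N x"
  by (auto simp: N_def a_pos t_pos s_pos m_pos)

lemma N_power2:
  "x \<in> V \<times> Q \<Longrightarrow>
    (N x)\<^sup>2 = a (fst x) (fst x) + t (snd x) (snd x) + s (snd x) (snd x) + m (snd x) (snd x)"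
  by (auto simp: N_def a_pos t_pos s_pos m_pos)

lemma sqrt_le_N:
  assumes "x \<in> V \<times> Q"
  shows "sqrt (a (fst x) (fst x)) \<le> N x" "sqrt (t (snd x) (snd x)) \<le> N x"
    "sqrt (s (snd x) (snd x)) \<le> N x" "sqrt (m (snd x) (snd x)) \<le> N x"
  using assms by (auto simp: N_def a_pos t_pos s_pos m_pos)

lemma N_pos:
  assumes "x \<in> V \<times> Q" "x \<noteq> 0"
  shows "N x > 0"
proof (rule ccontr)
  assume "\<not> N x > 0"
  then have "(N x)\<^sup>2 = 0" using N_nonneg[OF assms(1)] by simp
  then have "a (fst x) (fst x) = 0" "m (snd x) (snd x) = 0"
    using assms(1) a_pos[of "fst x"] t_pos[of "snd x"] s_pos[of "snd x"] m_pos[of "snd x"]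
    unfolding N_power2[OF assms(1)] by (auto simp: add_nonneg_eq_0_iff)
  then have "x = 0" using a_definite m_definite assms(1) by (auto simp: prod_eq_iff)
  with assms(2) show False by simp
qed

text \<open>The constant 5 counts the terms of \<open>L\<close>; each is at most a product of two
  seminorms that \<open>N\<close> dominates.\<close>

lemma L_bounded:
  assumes x: "x \<in> V \<times> Q" and y: "y \<in> V \<times> Q"
  shows "\<bar>L x y\<bar> \<le> 5 * N x * N y"
proof -
  have mult: "r \<le> N x * N y" if "r \<le> r1 * r2" "r1 \<le> N x" "r2 \<le> N y" "0 \<le> r1" "0 \<le> r2" for r r1 r2
    using that mult_mono[of r1 "N x" r2 "N y"] N_nonneg[OF x] by linarith
  note N = sqrt_le_N[OF x] sqrt_le_N[OF y]
  have mem: "fst x \<in> V" "snd x \<in> Q" "fst y \<in> V" "snd y \<in> Q" using x y by auto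
  have "\<bar>a (fst x) (fst y)\<bar> \<le> N x * N y"
    by (rule mult[OF semi_inner_Cauchy_Schwarz[OF V a a_sym a_pos]]) (use mem N a_pos in auto)
  moreover have "\<bar>t (snd x) (snd y)\<bar> \<le> N x * N y"
    by (rule mult[OF semi_inner_Cauchy_Schwarz[OF Q t t_sym t_pos]]) (use mem N t_pos in auto)
  moreover have "\<bar>s (snd x) (snd y)\<bar> \<le> N x * N y"
    by (rule mult[OF semi_inner_Cauchy_Schwarz[OF Q s s_sym s_pos]]) (use mem N s_pos in auto)
  moreover have "\<bar>b (fst x) (snd y)\<bar> \<le> N x * N y"
    by (rule mult[OF b_bound]) (use mem N a_pos m_pos in auto)
  moreover have "\<bar>b (fst y) (snd x)\<bar> \<le> N x * N y"
    using b_bound[of "fst y" "snd x"] mem N a_pos m_pos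
    by (intro mult[of _ "sqrt (m (snd x) (snd x))" "sqrt (a (fst y) (fst y))"])
      (auto simp: mult.commute)
  ultimately show ?thesis unfolding L_def by linarith
qed

text \<open>The test function is \<open>(u - \<theta> w, - p)\<close>, where \<open>w\<close> is the displacement that the inf-sup
  condition provides for \<open>p\<close>: the first part controls \<open>u\<close> and the stabilisation terms, the
  perturbation by \<open>w\<close> adds control of \<open>m p p\<close>, and Young's inequality absorbs the cross terms.\<close>

lemma L_stable:
  assumes x: "x \<in> V \<times> Q"
  shows "\<exists>y\<in>V \<times> Q. \<kappa> * (N x)\<^sup>2 \<le> L x y \<and> N y \<le> (1 + \<theta>) * N x"
proof -
  obtain u p where xup: "x = (u, p)" and u: "u \<in> V" and p: "p \<in> Q" using x by auto
  obtain w where w: "w \<in> V" and w_le: "a w w \<le> m p p"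
    and bw: "c1 * m p p - c2 * (sqrt (s p p) * sqrt (m p p)) \<le> b w p"
    using inf_sup[OF p] by blast
  define y where "y = (u + (- \<theta>) *\<^sub>R w, (-1) *\<^sub>R p)"
  have \<theta>w: "(- \<theta>) *\<^sub>R w \<in> V" and p': "(-1) *\<^sub>R p \<in> Q" and uw: "u + (- \<theta>) *\<^sub>R w \<in> V"
    using V Q u p w by (auto intro!: subspace_add subspace_diff subspace_mul subspace_neg)
  have y: "y \<in> V \<times> Q" using uw p' by (simp add: y_def)
  define U S P where "U = sqrt (a u u)" "S = sqrt (s p p)" "P = sqrt (m p p)"
  have sq: "a u u = U\<^sup>2" "s p p = S\<^sup>2" "m p p = P\<^sup>2" and nn: "0 \<le> U" "0 \<le> S" "0 \<le> P"
    using a_pos s_pos m_pos u p by (auto simp: U_S_P_def)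
  have "a u w \<le> U * sqrt (a w w)"
    using semi_inner_Cauchy_Schwarz[OF V a a_sym a_pos u w] by (simp add: U_S_P_def)
  also have "\<dots> \<le> U * P"
    using w_le nn by (intro mult_left_mono) (auto simp: U_S_P_def)
  finally have auw: "\<theta> * a u w \<le> \<theta> * (U * P)" using \<theta>_pos by simp
  \<comment> \<open>The second component -p makes the two terms with \<open>b u p\<close> cancel and
    turns the negative pressure forms into positive ones.\<close>
  have Lxy: "L x y = U\<^sup>2 - \<theta> * a u w + \<theta> * b w p + t p p + S\<^sup>2"
    unfolding L_def xup y_def sq[symmetric] fst_conv snd_conv
    using u p w \<theta>w p' by (simp only: bilinear_on_simps[OF a] bilinear_on_simps[OF b]
        bilinear_on_simps[OF t] bilinear_on_simps[OF s])
  have "\<theta> * (c1 * P\<^sup>2 - c2 * (S * P)) \<le> \<theta> * b w p"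
    using bw \<theta>_pos by (simp add: U_S_P_def m_pos p)
  \<comment> \<open>Young's inequality twice: half of U^2 pays for the cross term of
    \<open>u\<close> and \<open>w\<close>, half of S^2 for the defect of the inf-sup
    condition.\<close>
  moreover have "2 * (\<theta> * (U * P)) \<le> U\<^sup>2 + \<theta>\<^sup>2 * P\<^sup>2"
    using zero_le_power2[of "U - \<theta> * P"] by (simp add: power2_eq_square algebra_simps)
  moreover have "2 * (\<theta> * (c2 * (S * P))) \<le> S\<^sup>2 + \<theta>\<^sup>2 * c2\<^sup>2 * P\<^sup>2"
    using zero_le_power2[of "S - \<theta> * c2 * P"] by (simp add: power2_eq_square algebra_simps)
  ultimately have "U\<^sup>2 / 2 + t p p + S\<^sup>2 / 2 + (\<theta> * c1 - \<theta>\<^sup>2 * (1 + c2\<^sup>2) / 2) * P\<^sup>2 \<le> L x y"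
    using auw unfolding Lxy by (simp add: algebra_simps add_divide_distrib)
  moreover have "\<theta> * c1 - \<theta>\<^sup>2 * (1 + c2\<^sup>2) / 2 = c1\<^sup>2 / (2 * (1 + c2\<^sup>2))"
  proof -
    have "1 + c2\<^sup>2 \<noteq> 0" by (metis add_pos_nonneg less_irrefl zero_le_power2 zero_less_one)
    then have "\<theta>\<^sup>2 * (1 + c2\<^sup>2) = \<theta> * c1" by (simp add: \<theta>_def power2_eq_square)
    then have "\<theta> * c1 - \<theta>\<^sup>2 * (1 + c2\<^sup>2) / 2 = \<theta> * c1 / 2" by simp
    also have "\<dots> = c1\<^sup>2 / (2 * (1 + c2\<^sup>2))"
      unfolding \<theta>_def by (simp add: power2_eq_square mult.commute)
    finally show ?thesis .
  qed
  ultimately have "U\<^sup>2 / 2 + t p p + S\<^sup>2 / 2 + c1\<^sup>2 / (2 * (1 + c2\<^sup>2)) * P\<^sup>2 \<le> L x y" by simp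
  moreover have "\<kappa> * (N x)\<^sup>2 \<le> U\<^sup>2 / 2 + t p p + S\<^sup>2 / 2 + c1\<^sup>2 / (2 * (1 + c2\<^sup>2)) * P\<^sup>2"
  proof -
    have "\<kappa> \<le> 1/2" "\<kappa> \<le> c1\<^sup>2 / (2 * (1 + c2\<^sup>2))"
      by (simp_all only: \<kappa>_def min.cobounded1 min.cobounded2)
    then have "\<kappa> * U\<^sup>2 \<le> 1/2 * U\<^sup>2" "\<kappa> * S\<^sup>2 \<le> 1/2 * S\<^sup>2" "\<kappa> * t p p \<le> 1 * t p p"
      "\<kappa> * P\<^sup>2 \<le> c1\<^sup>2 / (2 * (1 + c2\<^sup>2)) * P\<^sup>2"
      using t_pos[OF p] by (intro mult_right_mono; simp)+
    then show ?thesis using x unfolding N_power2[OF x] by (simp add: xup sq algebra_simps)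
  qed
  \<comment> \<open>The pressure parts of \<open>x\<close> and \<open>y\<close> have equal norm.
    Since \<open>w\<close> has energy at most \<open>m p p\<close>, replacing \<open>u\<close> by u
    - \<theta> w costs at most 2 \<theta> + \<theta>^2 times the square of
    \<open>N x\<close>.\<close>
  moreover have "N y \<le> (1 + \<theta>) * N x"
  proof (rule power2_le_imp_le)
    have aw: "sqrt (a w w) \<le> P" using w_le by (simp add: U_S_P_def)
    have P_N: "P \<le> N x" "U \<le> N x" using sqrt_le_N[OF x] by (auto simp: xup U_S_P_def)
    have "- a u w \<le> U * sqrt (a w w)"
      using semi_inner_Cauchy_Schwarz[OF V a a_sym a_pos u w] by (simp add: U_S_P_def)
    from mult_left_mono[OF this, of "2 * \<theta>"]
    have "- (2 * \<theta>) * a u w \<le> 2 * \<theta> * (U * sqrt (a w w))"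
      using \<theta>_pos by simp
    also have "\<dots> \<le> 2 * \<theta> * (N x * N x)"
      using \<theta>_pos aw P_N nn a_pos[OF w] by (intro mult_left_mono mult_mono) auto
    finally have 1: "- (2 * \<theta>) * a u w \<le> 2 * \<theta> * (N x)\<^sup>2" by (simp add: power2_eq_square)
    have "a w w \<le> (N x)\<^sup>2"
      using w_le power_mono[OF P_N(1) nn(3), of 2] by (simp add: sq)
    then have 2: "\<theta>\<^sup>2 * a w w \<le> \<theta>\<^sup>2 * (N x)\<^sup>2" by (intro mult_left_mono) auto
    have "(N y)\<^sup>2 = (N x)\<^sup>2 + - (2 * \<theta>) * a u w + \<theta>\<^sup>2 * a w w"
      unfolding N_power2[OF x] N_power2[OF y] unfolding xup y_def fst_conv snd_conv
      using u p w \<theta>w p' uw a_sym[OF u w]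
      by (simp only: bilinear_on_simps[OF a] bilinear_on_simps[OF m]
        bilinear_on_simps[OF t] bilinear_on_simps[OF s]) (simp add: power2_eq_square algebra_simps)
    also have "\<dots> \<le> ((1 + \<theta>) * N x)\<^sup>2"
      using 1 2 by (simp add: power2_eq_square algebra_simps)
    finally show "(N y)\<^sup>2 \<le> ((1 + \<theta>) * N x)\<^sup>2" .
  qed (use N_nonneg[OF x] \<theta>_pos in auto)
  ultimately show ?thesis using y by force
qed

lemma bilinear_on_L: "bilinear_on (V \<times> Q) (V \<times> Q) L"
proof -
  have "L (x + x') y = L x y + L x' y" "L (r *\<^sub>R x) y = r * L x y"
    "L y (x + x') = L y x + L y x'" "L y (r *\<^sub>R x) = r * L y x"
    if "x \<in> V \<times> Q" "x' \<in> V \<times> Q" "y \<in> V \<times> Q" for x x' y r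
    using that by (auto simp: L_def bilinear_on_simps[OF a] bilinear_on_simps[OF b]
      bilinear_on_simps[OF s] bilinear_on_simps[OF t] right_diff_distrib)
  then show ?thesis by (simp add: bilinear_on_def linear_map_on_def)
qed

text \<open>Coercivity divided by the bound on \<open>N y\<close>. The test vector is nonzero
  because \<open>L x y\<close> is positive, so the quotient is meaningful.\<close>

lemma inf_sup_L:
  assumes x: "x \<in> V \<times> Q" "x \<noteq> 0"
  shows "\<exists>y\<in>V \<times> Q - {0}. \<kappa> / (1 + \<theta>) \<le> L x y / (N x * N y)"
proof -
  obtain y where y: "y \<in> V \<times> Q" and Ly: "\<kappa> * (N x)\<^sup>2 \<le> L x y" and Ny: "N y \<le> (1 + \<theta>) * N x"
    using L_stable[OF x(1)] by blast
  have Nx: "N x > 0" by (rule N_pos[OF x])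
  then have Lpos: "L x y > 0" using Ly \<kappa>_pos by (meson less_le_trans mult_pos_pos zero_less_power)
  have "y \<noteq> 0"
    using Lpos bilinear_on_simps(4)[OF bilinear_on_L x(1) y, of 0] by auto
  moreover have "\<kappa> / (1 + \<theta>) \<le> L x y / (N x * N y)"
  proof -
    have Npos: "N y > 0" by (rule N_pos[OF y \<open>y \<noteq> 0\<close>])
    have "\<kappa> * (N x * N y) \<le> \<kappa> * (N x * ((1 + \<theta>) * N x))"
      using \<kappa>_pos Nx Ny by (intro mult_left_mono) auto
    also have "\<dots> = (1 + \<theta>) * (\<kappa> * (N x)\<^sup>2)" by (simp add: power2_eq_square algebra_simps)
    also have "\<dots> \<le> (1 + \<theta>) * L x y" using Ly \<theta>_pos by (intro mult_left_mono) auto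
    finally show ?thesis using Nx Npos \<theta>_pos by (simp add: field_simps)
  qed
  ultimately show ?thesis using y by blast
qed

text \<open>The inf-sup bound excludes a nonzero \<open>x\<close> with L x y = 0 for all
  \<open>y\<close>; nondegeneracy then gives solvability for every right-hand side.\<close>

lemma L_represents:
  assumes fin: "V \<subseteq> span SV" "finite SV" "Q \<subseteq> span SQ" "finite SQ"
    and f: "linear_map_on V f" and g: "linear_map_on Q g"
  shows "\<exists>x\<in>V \<times> Q. \<forall>v\<in>V. \<forall>q\<in>Q. L x (v, q) = f v + g q"
proof -
  let ?S = "(\<lambda>v. (v, 0)) ` SV \<union> (\<lambda>q. (0, q)) ` SQ"
  have "V \<times> Q \<subseteq> span ?S"
  proof
    fix x assume "x \<in> V \<times> Q"
    then have "fst x \<in> span SV" "snd x \<in> span SQ" using fin by auto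
    moreover have "span ((\<lambda>v::'a. (v, 0::'b)) ` SV) = (\<lambda>v. (v, 0)) ` span SV"
      "span ((\<lambda>q::'b. (0::'a, q)) ` SQ) = (\<lambda>q. (0, q)) ` span SQ"
      by (rule linear_span_image, simp add: linear_iff)+
    ultimately have "(fst x, 0) \<in> span ((\<lambda>v::'a. (v, 0::'b)) ` SV)"
      "(0, snd x) \<in> span ((\<lambda>q::'b. (0::'a, q)) ` SQ)"
      by simp_all
    then have "(fst x, 0) + (0, snd x) \<in> span ?S"
      by (intro span_add) (auto intro: span_mono[THEN subsetD, rotated])
    then show "x \<in> span ?S" by simp
  qed
  moreover have "subspace (V \<times> Q)" using V Q by (rule subspace_Times)
  moreover have "x = 0" if x: "x \<in> V \<times> Q" and 0: "\<And>y. y \<in> V \<times> Q \<Longrightarrow> L x y = 0" for x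
  proof (rule ccontr)
    assume "x \<noteq> 0"
    from inf_sup_L[OF x this] obtain y where "y \<in> V \<times> Q" "\<kappa> / (1 + \<theta>) \<le> L x y / (N x * N y)"
      by blast
    then show False using 0 divide_pos_pos[OF \<kappa>_pos, of "1 + \<theta>"] \<theta>_pos by simp
  qed
  moreover have "linear_map_on (V \<times> Q) (\<lambda>y. f (fst y) + g (snd y))"
    using f g by (auto simp: linear_map_on_def algebra_simps)
  ultimately obtain x where "x \<in> V \<times> Q" "\<forall>y\<in>V \<times> Q. L x y = f (fst y) + g (snd y)"
    using nondegenerate_form_represents[OF _ _ _ bilinear_on_L, of ?S "\<lambda>y. f (fst y) + g (snd y)"]
      fin(2,4) by auto
  then show ?thesis by auto
qed

end

section \<open>Smooth bump functions and the fundamental lemma of the calculus of variations\<close>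

text \<open>The exponential beats the pole of order k with two powers of \<open>d\<close> to spare,
  which makes the bump functions flat at the edge of their support. It comes from (1 + x / n)^n <=
  exp x with n = k + 2 and x = c / d.\<close>

lemma exp_neg_inverse_le:
  fixes c d :: real
  assumes "c > 0" "d > 0"
  shows "exp (- c / d) / d ^ k \<le> (real (k + 2) / c) ^ (k + 2) * d\<^sup>2"
proof -
  let ?n = "k + 2"
  have cd: "c / d > 0" using assms by simp
  then have "(c / d / real ?n) ^ ?n \<le> (1 + c / d / real ?n) ^ ?n"
    using assms by (intro power_mono divide_nonneg_nonneg) auto
  also have "\<dots> \<le> exp (c / d)"
    using exp_ge_one_plus_x_over_n_power_n[of ?n "c / d"] cd by (simp del: power_Suc)
  finally have le: "(c / d / real ?n) ^ ?n \<le> exp (c / d)" .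
  have pos: "(c / d / real ?n) ^ ?n > 0" using assms by (intro zero_less_power divide_pos_pos) auto
  have "exp (- c / d) = 1 / exp (c / d)" by (simp add: exp_minus inverse_eq_divide)
  also have "\<dots> \<le> 1 / (c / d / real ?n) ^ ?n" by (rule frac_le[OF _ order_refl pos le]) simp
  also have "\<dots> = (real ?n / c * d) ^ ?n"
  proof -
    have "1 / (c / d / real ?n) = real ?n / c * d" by simp
    then show ?thesis by (metis power_one_over)
  qed
  also have "\<dots> = (real ?n / c) ^ ?n * d\<^sup>2 * d ^ k"
    by (simp only: power_mult_distrib power_add ac_simps)
  finally show ?thesis using assms(2) by (simp add: pos_divide_le_eq)
qed

text \<open>A family P / D^k exp (-c / D), cut off to zero where D is not positive. General
  \<open>P\<close> and \<open>k\<close> are carried along so that the family is closed under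
  differentiation.\<close>

definition bump :: "real poly \<Rightarrow> real \<Rightarrow> real poly \<Rightarrow> nat \<Rightarrow> real \<Rightarrow> real"
  where "bump D c P k t =
    (if poly D t > 0 then poly P t / poly D t ^ k * exp (- c / poly D t) else 0)"

text \<open>The numerator of the derivative of P / D^k exp (-c / D) over the common denominator D^(k
  + 2).\<close>

definition bump_deriv :: "real poly \<Rightarrow> real \<Rightarrow> real poly \<Rightarrow> nat \<Rightarrow> real poly"
  where "bump_deriv D c P k =
    pderiv P * D\<^sup>2 - smult (real k) (P * pderiv D * D) + smult c (P * pderiv D)"

lemma DERIV_squeeze_zero:
  fixes f g :: "real \<Rightarrow> real"
  assumes g: "(g has_real_derivative 0) (at x)" "g x = 0" and le: "\<And>t. \<bar>f t\<bar> \<le> \<bar>g t\<bar>"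
  shows "(f has_real_derivative 0) (at x)"
proof -
  have f0: "f x = 0" using le[of x] g(2) by simp
  have "((\<lambda>y. \<bar>(g y - g x) / (y - x)\<bar>) \<longlongrightarrow> 0) (at x)"
    using g(1) unfolding has_field_derivative_iff by (intro tendsto_rabs_zero)
  then have "((\<lambda>y. (f y - f x) / (y - x)) \<longlongrightarrow> 0) (at x)"
    by (rule Lim_null_comparison[rotated])
      (auto simp: f0 g(2) le divide_right_mono intro!: always_eventually)
  then show ?thesis by (simp add: has_field_derivative_iff)
qed

lemma bump_has_derivative:
  assumes c: "c > 0"
  shows "(bump D c P k has_real_derivative bump D c (bump_deriv D c P k) (k + 2) t) (at t)"
proof -
  consider "poly D t > 0" | "poly D t < 0" | "poly D t = 0" by linarith
  then show ?thesis
  proof cases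
    case 1
    define p p' d d' where "p = poly P t" and "p' = poly (pderiv P) t"
      and "d = poly D t" and "d' = poly (pderiv D) t"
    have d: "d > 0" using 1 by (simp add: d_def)
    \<comment> \<open>For k = 0 the truncated exponent k - 1 is harmless because of the factor
      k.\<close>
    have dk: "real k * d ^ (k - 1) = real k * d ^ k / d" using d by (cases k) auto
    have "((\<lambda>t. poly P t / poly D t ^ k * exp (- c / poly D t)) has_real_derivative
        (p' * d ^ k - p * (real k * d ^ (k - 1) * d')) / (d ^ k * d ^ k) * exp (- c / d)
        + exp (- c / d) * (c * d' / (d * d)) * (p / d ^ k)) (at t)"
      using d by (auto intro!: derivative_eq_intros simp: p_def p'_def d_def d'_def field_simps)
    also have "(p' * d ^ k - p * (real k * d ^ (k - 1) * d')) / (d ^ k * d ^ k) * exp (- c / d)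
        + exp (- c / d) * (c * d' / (d * d)) * (p / d ^ k)
      = bump D c (bump_deriv D c P k) (k + 2) t"
      using d unfolding dk
      by (simp add: bump_def bump_deriv_def p_def p'_def d_def d'_def field_simps power2_eq_square)
    finally have "((\<lambda>t. poly P t / poly D t ^ k * exp (- c / poly D t)) has_real_derivative
        bump D c (bump_deriv D c P k) (k + 2) t) (at t)" .
    moreover have "\<forall>\<^sub>F s in nhds t. poly D s > 0"
    proof -
      have "open {s. 0 < poly D s}" by (intro open_Collect_less) (auto intro: continuous_intros)
      then show ?thesis using 1 eventually_nhds by blast
    qed
    then have "\<forall>\<^sub>F s in nhds t. bump D c P k s = poly P s / poly D s ^ k * exp (- c / poly D s)"
      by eventually_elim (simp add: bump_def)
    ultimately show ?thesis by (subst DERIV_cong_ev[OF refl _ refl])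
  next
    case 2
    have "\<forall>\<^sub>F s in nhds t. poly D s < 0"
    proof -
      have "open {s. poly D s < 0}" by (intro open_Collect_less) (auto intro: continuous_intros)
      then show ?thesis using 2 eventually_nhds by blast
    qed
    then have "\<forall>\<^sub>F s in nhds t. bump D c P k s = 0"
      by eventually_elim (simp add: bump_def)
    then have "(bump D c P k has_real_derivative 0) (at t)"
      by (subst DERIV_cong_ev[OF refl _ refl]) auto
    then show ?thesis using 2 by (simp add: bump_def)
  next
    case 3
    define C where "C = (real (k + 2) / c) ^ (k + 2)"
    have C: "C \<ge> 0" using c by (simp add: C_def)
    have "(bump D c P k has_real_derivative 0) (at t)"
    \<comment> \<open>At a zero of \<open>D\<close> the bump is squeezed by a multiple of P D^2,
      which has at least a double zero there.\<close>
    proof (rule DERIV_squeeze_zero)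
      show "((\<lambda>s. C * poly P s * (poly D s)\<^sup>2) has_real_derivative 0) (at t)"
        using 3 by (auto intro!: derivative_eq_intros)
      show "C * poly P t * (poly D t)\<^sup>2 = 0" using 3 by simp
      show "\<bar>bump D c P k s\<bar> \<le> \<bar>C * poly P s * (poly D s)\<^sup>2\<bar>" for s
      proof (cases "poly D s > 0")
        case True
        have "\<bar>bump D c P k s\<bar> = \<bar>poly P s\<bar> * (exp (- c / poly D s) / poly D s ^ k)"
          using True by (simp add: bump_def abs_mult)
        also have "\<dots> \<le> \<bar>poly P s\<bar> * (C * (poly D s)\<^sup>2)"
          unfolding C_def by (intro mult_left_mono exp_neg_inverse_le c True) auto
        finally show ?thesis using C by (simp add: abs_mult ac_simps)
      qed (simp add: bump_def)
    qed
    then show ?thesis using 3 by (simp add: bump_def)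
  qed
qed

text \<open>Products over the coordinates: a partial derivative in direction i changes only the data
  of the i-th factor, so all iterated derivatives remain of this form.\<close>

definition prod_bump :: "('n::finite \<Rightarrow> real poly) \<Rightarrow> real \<Rightarrow> ('n \<Rightarrow> real poly) \<Rightarrow> ('n \<Rightarrow> nat) \<Rightarrow> real^'n \<Rightarrow> real"
  where "prod_bump D c P k x = (\<Prod>i\<in>UNIV. bump (D i) c (P i) (k i) (x $ i))"

lemma prod_bump_has_derivative:
  assumes c: "c > 0"
  shows "(prod_bump D c P k has_derivative (\<lambda>y. \<Sum>i\<in>UNIV.
    y $ i * bump (D i) c (bump_deriv (D i) c (P i) (k i)) (k i + 2) (x $ i)
      * (\<Prod>j\<in>UNIV - {i}. bump (D j) c (P j) (k j) (x $ j)))) (at x)"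
proof -
  have "((\<lambda>x. bump (D i) c (P i) (k i) (x $ i)) has_derivative
      (\<lambda>y. y $ i * bump (D i) c (bump_deriv (D i) c (P i) (k i)) (k i + 2) (x $ i))) (at x)" for i
  proof -
    have "((\<lambda>x. x $ i) has_derivative (\<lambda>y. y $ i)) (at x)"
      by (rule bounded_linear_imp_has_derivative[OF bounded_linear_vec_nth])
    from has_derivative_compose[OF this bump_has_derivative[OF c, unfolded has_field_derivative_def]]
    show ?thesis by (simp add: mult.commute)
  qed
  then show ?thesis
    unfolding prod_bump_def[abs_def] by (intro has_derivative_prod)
qed

lemma pderiv_at_prod_bump:
  fixes D P :: "'n::finite \<Rightarrow> real poly"
  assumes c: "c > 0"
  shows "pderiv_at i (prod_bump D c P k) =
    prod_bump D c (P(i := bump_deriv (D i) c (P i) (k i))) (k(i := k i + 2))"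
proof
  fix x :: "real^'n"
  let ?g = "\<lambda>i. bump (D i) c (bump_deriv (D i) c (P i) (k i)) (k i + 2) (x $ i)"
  have "pderiv_at i (prod_bump D c P k) x = (\<Sum>l\<in>UNIV. axis i 1 $ l * ?g l
      * (\<Prod>j\<in>UNIV - {l}. bump (D j) c (P j) (k j) (x $ j)))"
    unfolding pderiv_at_def frechet_derivative_at[OF prod_bump_has_derivative[OF c], symmetric] ..
  also have "\<dots> = (\<Sum>l\<in>UNIV. if l = i then ?g l * (\<Prod>j\<in>UNIV - {l}. bump (D j) c (P j) (k j) (x $ j)) else 0)"
    by (intro sum.cong) (auto simp: axis_def)
  also have "\<dots> = ?g i * (\<Prod>j\<in>UNIV - {i}. bump (D j) c (P j) (k j) (x $ j))" by simp
  also have "\<dots> = prod_bump D c (P(i := bump_deriv (D i) c (P i) (k i))) (k(i := k i + 2)) x"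
    unfolding prod_bump_def by (subst prod.remove[of _ i]) (auto intro!: prod.cong)
  finally show "pderiv_at i (prod_bump D c P k) x =
    prod_bump D c (P(i := bump_deriv (D i) c (P i) (k i))) (k(i := k i + 2)) x" .
qed

lemma smooth_prod_bump:
  assumes "c > 0"
  shows "smooth (prod_bump D c P k)"
proof -
  have "\<exists>P' k'. iter_pderiv is (prod_bump D c P k) = prod_bump D c P' k'" for "is"
  proof (induction "is")
    case (Cons i "is")
    then show ?case using pderiv_at_prod_bump[OF assms] by fastforce
  qed auto
  moreover have "prod_bump D c P' k' differentiable at x" for P' k' x
    using prod_bump_has_derivative[OF assms] by (rule differentiableI)
  ultimately show ?thesis unfolding smooth_def by metis
qed

text \<open>In coordinate i the polynomial is (x_i - a_i) (b_i - x_i), positive exactly inside the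
  interval when a_i < b_i. As \<open>c\<close> tends to 0 the function tends to the indicator of the
  box.\<close>

definition box_bump :: "real^'n::finite \<Rightarrow> real^'n \<Rightarrow> real \<Rightarrow> real^'n \<Rightarrow> real"
  where "box_bump a b c = prod_bump (\<lambda>i. [:- a $ i, 1:] * [:b $ i, -1:]) c (\<lambda>_. 1) (\<lambda>_. 0)"

lemma box_bump_eq:
  assumes "box a b \<noteq> {}"
  shows "box_bump a b c x =
    (if x \<in> box a b then \<Prod>i\<in>UNIV. exp (- c / ((x $ i - a $ i) * (b $ i - x $ i))) else 0)"
proof -
  have ab: "a $ i < b $ i" for i
    using assms unfolding box_ne_empty(2) by (auto simp: Basis_vec_def inner_axis)
  \<comment> \<open>\<open>ab\<close> rules out that both factors are negative.\<close>
  have pos: "0 < (x $ i - a $ i) * (b $ i - x $ i) \<longleftrightarrow> a $ i < x $ i \<and> x $ i < b $ i" for i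
    using ab[of i] by (auto simp: zero_less_mult_iff)
  show ?thesis
  proof (cases "x \<in> box a b")
    case True
    then show ?thesis
      using pos by (auto simp: box_bump_def prod_bump_def bump_def mem_box_cart algebra_simps intro!: prod.cong)
  next
    case False
    then obtain i where "\<not> (a $ i < x $ i \<and> x $ i < b $ i)" by (auto simp: mem_box_cart)
    then have "bump ([:- a $ i, 1:] * [:b $ i, -1:]) c 1 0 (x $ i) = 0"
      using pos[of i] by (simp add: bump_def algebra_simps)
    then show ?thesis using False by (auto simp: box_bump_def prod_bump_def)
  qed
qed

lemma box_bump_test_function:
  assumes "box a b \<noteq> {}" "c > 0" "cbox a b \<subseteq> \<Omega>"
  shows "box_bump a b c \<in> test_functions \<Omega>"
proof -
  have "closure {x. box_bump a b c x \<noteq> 0} \<subseteq> cbox a b"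
    by (rule closure_minimal) (auto simp: box_bump_eq[OF assms(1)] mem_box less_imp_le split: if_splits)
  moreover from this have "compact (closure {x. box_bump a b c x \<noteq> 0})"
    by (meson bounded_cbox bounded_subset closed_closure compact_eq_bounded_closed)
  ultimately show ?thesis
    using assms by (auto simp: test_functions_def box_bump_def smooth_prod_bump)
qed

lemma box_bump_bounds:
  assumes "box a b \<noteq> {}" "c > 0"
  shows "0 \<le> box_bump a b c x" "box_bump a b c x \<le> indicat_real (box a b) x"
  using assms by (auto simp: box_bump_eq mem_box_cart less_imp_le intro!: prod_nonneg prod_le_1)

lemma box_bump_tendsto:
  assumes "box a b \<noteq> {}"
  shows "(\<lambda>n. box_bump a b (1 / real (Suc n)) x) \<longlonglongrightarrow> indicat_real (box a b) x"
proof (cases "x \<in> box a b")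
  case True
  have "(\<lambda>n. exp (- (1 / real (Suc n)) / r)) \<longlonglongrightarrow> 1" for r :: real
  proof -
    have "(\<lambda>n. exp (- (1 / real (Suc n)) / r)) \<longlonglongrightarrow> exp (- 0 / r)"
      unfolding divide_inverse[of _ r]
      by (intro tendsto_intros LIMSEQ_Suc[OF lim_1_over_n])
    then show ?thesis by simp
  qed
  then have "(\<lambda>n. \<Prod>i\<in>UNIV. exp (- (1 / real (Suc n)) / ((x $ i - a $ i) * (b $ i - x $ i))))
      \<longlonglongrightarrow> (\<Prod>i\<in>(UNIV::'a set). 1)"
    by (intro tendsto_prod)
  then show ?thesis using True by (simp add: box_bump_eq[OF assms])
qed (simp add: box_bump_eq[OF assms])

text \<open>Boxes form an intersection-stable generator of the Borel sets, so the sets on which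
  \<open>f\<close> has integral zero, a Dynkin system thanks to \<open>whole\<close>, comprise all
  Borel sets. Uniqueness of densities then compares \<open>f\<close> with 0.\<close>

lemma AE_eq_0_if_integral_box_eq_0:
  fixes f :: "'a::euclidean_space \<Rightarrow> real"
  assumes f: "integrable lborel f" and whole: "(\<integral>x. f x \<partial>lborel) = 0"
    and box: "\<And>a b. (LINT x:box a b|lborel. f x) = 0"
  shows "AE x in lborel. f x = 0"
proof -
  have f_on: "set_integrable lborel A f" if "A \<in> sets borel" for A
    unfolding set_integrable_def using that by (intro integrable_mult_indicator f) auto
  have "(LINT x:A|lborel. f x) = 0" if A: "A \<in> sets borel" for A
  proof -
    have "Int_stable (range (\<lambda>(a::'a, b). box a b))"
      by (auto simp: Int_stable_def box_Int_box)
    moreover have "range (\<lambda>(a::'a, b). box a b) \<subseteq> Pow UNIV" by auto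
    moreover have "A \<in> sigma_sets UNIV (range (\<lambda>(a, b). box a b))"
      using A unfolding borel_eq_box by simp
    ultimately show ?thesis
    proof (induction rule: sigma_sets_induct_disjoint)
      case (basic A)
      then show ?case using box by auto
    next
      case empty
      then show ?case by (simp add: set_lebesgue_integral_def)
    next
      case (compl A)
      then have [measurable]: "A \<in> sets borel" by (simp add: borel_eq_box)
      have "(LINT x:A \<union> (UNIV - A)|lborel. f x) = (LINT x:A|lborel. f x) + (LINT x:UNIV - A|lborel. f x)"
        by (rule set_integral_Un) (auto intro: f_on)
      moreover have "(LINT x:A \<union> (UNIV - A)|lborel. f x) = 0"
        using whole by (simp add: set_lebesgue_integral_def)
      ultimately show ?case using compl.IH by simp
    next
      case (union F)
      then have F: "\<And>i. F i \<in> sets borel" by (simp add: borel_eq_box subset_eq)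
      have "(LINT x:(\<Union>i. F i)|lborel. f x) = (\<Sum>i. LINT x:F i|lborel. f x)"
        by (rule lebesgue_integral_countable_add)
          (use F union.hyps in \<open>auto simp: disjoint_family_on_def intro!: f_on\<close>)
      then show ?case using union by simp
    qed
  qed
  then show ?thesis
    using density_unique_real[OF f, of "\<lambda>_. 0"] by (simp add: set_lebesgue_integral_def)
qed

lemma square_integrable_indicator_box:
  assumes "\<Omega> \<in> sets lebesgue"
  shows "square_integrable \<Omega> (indicat_real (box a b))"
proof -
  have "emeasure (lebesgue_on \<Omega>) (box a b \<inter> \<Omega>) < \<infinity>"
  proof -
    have "emeasure lebesgue (box a b \<inter> \<Omega>) \<le> emeasure lebesgue (box a b)"
      by (intro emeasure_mono) auto
    also have "\<dots> < \<infinity>" by (simp add: emeasure_lborel_box_eq)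
    finally show ?thesis using assms by (simp add: emeasure_restrict_space)
  qed
  then have "integrable (lebesgue_on \<Omega>) (indicat_real (box a b \<inter> \<Omega>))"
    using assms by (intro integrable_real_indicator) (auto simp: sets_restrict_space)
  then have int: "integrable (lebesgue_on \<Omega>) (indicat_real (box a b))"
    by (rule Bochner_Integration.integrable_cong[THEN iffD1, OF refl, rotated])
      (auto simp: indicator_def)
  then show ?thesis
    unfolding square_integrable_def
    by (auto intro: Bochner_Integration.integrable_cong[THEN iffD1, OF refl _ int] simp: indicator_def)
qed

lemma continuous_measurable_lebesgue_on:
  fixes f :: "real^'n \<Rightarrow> 'b::euclidean_space"
  assumes "continuous_on UNIV f"
  shows "f \<in> borel_measurable (lebesgue_on \<Omega>)"
  using borel_measurable_continuous_onI[OF assms]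
  by (intro measurable_restrict_space1 measurable_completion) simp

lemma smooth_continuous: "smooth \<phi> \<Longrightarrow> continuous_on UNIV \<phi>"
  unfolding smooth_def by (metis differentiable_imp_continuous_on differentiable_on_def
      differentiable_at_withinI iter_pderiv.simps(1))

text \<open>Bump functions increase to indicators of boxes under the dominating function |g| on the
  box, so \<open>g\<close> has integral zero over every open box whose closure lies in \<Omega>. The
  rest localises to one such box and covers \<Omega> by countably many.\<close>

lemma fundamental_lemma_calculus_of_variations:
  fixes g :: "real^'n \<Rightarrow> real"
  assumes \<Omega>: "open \<Omega>" and g: "square_integrable \<Omega> g"
    and 0: "\<And>\<phi>. \<phi> \<in> test_functions \<Omega> \<Longrightarrow> L2_inner \<Omega> g \<phi> = 0"
  shows "AE x in lebesgue_on \<Omega>. g x = 0"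
proof -
  have \<Omega>_sets [measurable]: "\<Omega> \<in> sets lebesgue" using \<Omega> by auto
  have int_box: "integrable (lebesgue_on \<Omega>) (\<lambda>x. g x * indicat_real (box a b) x)" for a b
    using square_integrable_inner[OF g square_integrable_indicator_box[OF \<Omega>_sets]] by simp
  have zero: "(\<integral>x. g x * indicat_real (box a b) x \<partial>lebesgue_on \<Omega>) = 0" if ab: "cbox a b \<subseteq> \<Omega>" for a b
  proof (cases "box a b = {}")
    case False
    have "(\<lambda>n. \<integral>x. g x * box_bump a b (1 / real (Suc n)) x \<partial>lebesgue_on \<Omega>)
        \<longlonglongrightarrow> (\<integral>x. g x * indicat_real (box a b) x \<partial>lebesgue_on \<Omega>)"
    proof (rule integral_dominated_convergence)
      show "integrable (lebesgue_on \<Omega>) (\<lambda>x. \<bar>g x * indicat_real (box a b) x\<bar>)"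
        by (rule integrable_abs[OF int_box])
      show "(\<lambda>x. g x * indicat_real (box a b) x) \<in> borel_measurable (lebesgue_on \<Omega>)"
        by (rule borel_measurable_integrable[OF int_box])
      have "box_bump a b (1 / real (Suc n)) \<in> borel_measurable (lebesgue_on \<Omega>)" for n
        using box_bump_test_function[OF False _ ab, of "1 / real (Suc n)"]
        by (auto simp: test_functions_def intro: continuous_measurable_lebesgue_on smooth_continuous)
      then show "(\<lambda>x. g x * box_bump a b (1 / real (Suc n)) x) \<in> borel_measurable (lebesgue_on \<Omega>)" for n
        using g by (auto simp: square_integrable_def)
      show "AE x in lebesgue_on \<Omega>. (\<lambda>n. g x * box_bump a b (1 / real (Suc n)) x)
          \<longlonglongrightarrow> g x * indicat_real (box a b) x"
        by (intro AE_I2 tendsto_mult tendsto_const box_bump_tendsto[OF False])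
      show "AE x in lebesgue_on \<Omega>. norm (g x * box_bump a b (1 / real (Suc n)) x)
          \<le> \<bar>g x * indicat_real (box a b) x\<bar>" for n
        using box_bump_bounds[OF False, of "1 / real (Suc n)"]
        by (intro AE_I2) (auto simp: abs_mult intro!: mult_left_mono)
    qed
    moreover have "(\<integral>x. g x * box_bump a b (1 / real (Suc n)) x \<partial>lebesgue_on \<Omega>) = 0" for n
      using 0[OF box_bump_test_function[OF False _ ab, of "1 / real (Suc n)"]]
      by (simp add: L2_inner_def)
    ultimately show ?thesis by (simp add: LIMSEQ_const_iff)
  qed simp
  have AE_box: "AE x in lebesgue. x \<in> box u v \<longrightarrow> g x = 0" if uv: "cbox u v \<subseteq> \<Omega>" for u v
  proof -
    \<comment> \<open>Cutting \<open>g\<close> off to a box gives an integrable function on the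
      whole space.\<close>
    define h where "h x = (if x \<in> box u v then g x else 0)" for x
    have h_eq: "h = (\<lambda>x. indicator \<Omega> x *\<^sub>R (g x * indicat_real (box u v) x))"
      using uv box_subset_cbox[of u v] by (auto simp: h_def fun_eq_iff indicator_def)
    have h: "integrable lebesgue h"
      using int_box[of u v] unfolding h_eq by (subst (asm) integrable_restrict_space) auto
    \<comment> \<open>The Dynkin argument lives on Borel sets, whereas \<open>h\<close> is only
      Lebesgue measurable; hence a Borel representative.\<close>
    then obtain h' where h': "h' \<in> borel_measurable lborel" "AE x in lborel. h x = h' x"
      using completion_ex_borel_measurable_real[of h lborel] by auto
    have h'_AE: "AE x in lebesgue. h x = h' x" using h'(2) by (rule AE_completion)
    have "integrable lebesgue h'"
      by (rule integrable_cong_AE_imp[OF h]) (use h'(1) h'_AE in \<open>auto intro: measurable_completion\<close>)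
    then have h'_int: "integrable lborel h'" using integrable_completion[OF h'(1)] by simp
    have box0: "(LINT x:box a b|lborel. h' x) = 0" for a b
    proof -
      \<comment> \<open>The cut-off preserves the vanishing of box integrals because the
        intersection of two boxes is a box, with closure still in \<Omega> when nonempty.\<close>
      obtain c d where cd: "box u v \<inter> box a b = box c d"
        using box_Int_box[of u v a b] by blast
      have "(LINT x:box a b|lborel. h' x) = (\<integral>x. indicat_real (box a b) x *\<^sub>R h' x \<partial>lebesgue)"
        unfolding set_lebesgue_integral_def using h'(1)
        by (intro integral_completion[symmetric]) auto
      also have "\<dots> = (\<integral>x. indicat_real (box a b) x *\<^sub>R h x \<partial>lebesgue)"
      proof (rule integral_cong_AE)
        have "h \<in> borel_measurable lebesgue" "h' \<in> borel_measurable lebesgue"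
          using h h'(1) by (auto intro: measurable_completion)
        then show "(\<lambda>x. indicat_real (box a b) x *\<^sub>R h' x) \<in> borel_measurable lebesgue"
          "(\<lambda>x. indicat_real (box a b) x *\<^sub>R h x) \<in> borel_measurable lebesgue"
          by (intro borel_measurable_scaleR borel_measurable_indicator; simp)+
        show "AE x in lebesgue. indicat_real (box a b) x *\<^sub>R h' x = indicat_real (box a b) x *\<^sub>R h x"
          using h'_AE by eventually_elim simp
      qed
      also have "\<dots> = (\<integral>x. indicator \<Omega> x *\<^sub>R (g x * indicat_real (box c d) x) \<partial>lebesgue)"
        unfolding cd[symmetric] h_eq
        by (intro Bochner_Integration.integral_cong) (auto simp: indicator_def)
      also have "\<dots> = (\<integral>x. g x * indicat_real (box c d) x \<partial>lebesgue_on \<Omega>)"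
        by (subst integral_restrict_space) auto
      also have "\<dots> = 0"
      proof (cases "box c d = {}")
        case False
        have "box c d \<subseteq> cbox u v" using cd box_subset_cbox[of u v] by blast
        then have "closure (box c d) \<subseteq> cbox u v" by (intro closure_minimal) auto
        then have "cbox c d \<subseteq> cbox u v" using closure_box[OF False] by simp
        then show ?thesis using zero uv by blast
      qed simp
      finally show ?thesis .
    qed
    \<comment> \<open>\<open>h'\<close> vanishes almost everywhere outside the box, so its total
      integral is itself a box integral.\<close>
    have "(\<integral>x. h' x \<partial>lborel) = (LINT x:box u v|lborel. h' x)"
      unfolding set_lebesgue_integral_def
      using h'(1,2) by (intro integral_cong_AE) (auto simp: h_def elim: eventually_mono)
    then have "AE x in lborel. h' x = 0"
      using AE_eq_0_if_integral_box_eq_0[OF h'_int _ box0] box0 by simp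
    then have "AE x in lebesgue. h' x = 0" by (rule AE_completion)
    with h'_AE show ?thesis by eventually_elim (auto simp: h_def split: if_splits)
  qed
  \<comment> \<open>The countable cover consists of closed boxes; their boundaries are null
    sets.\<close>
  have AE_cbox: "AE x in lebesgue. x \<in> cbox u v \<longrightarrow> g x = 0" if uv: "cbox u v \<subseteq> \<Omega>" for u v
  proof -
    have "AE x in lebesgue. x \<notin> cbox u v - box u v"
      using negligible_frontier_interval[of u v]
      by (intro AE_not_in) (simp add: negligible_iff_null_sets)
    with AE_box[OF uv] show ?thesis by eventually_elim auto
  qed
  obtain \<D> where \<D>: "countable \<D>" "\<D> \<subseteq> Pow \<Omega>" "\<And>X. X \<in> \<D> \<Longrightarrow> \<exists>a b. X = cbox a b" "\<Union>\<D> = \<Omega>"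
    using open_countable_Union_open_cbox[OF \<Omega>] by blast
  have "AE x in lebesgue. x \<in> X \<longrightarrow> g x = 0" if "X \<in> \<D>" for X
    using \<D>(2,3) AE_cbox that by blast
  then have "AE x in lebesgue. \<forall>X\<in>\<D>. x \<in> X \<longrightarrow> g x = 0"
    by (subst AE_ball_countable[OF \<D>(1)]) blast
  then have "AE x in lebesgue. x \<in> \<Omega> \<longrightarrow> g x = 0"
    by eventually_elim (use \<D>(4) in auto)
  then show ?thesis by (subst AE_restrict_space_iff) auto
qed

section \<open>Test functions\<close>

lemma smooth_differentiable: "smooth \<phi> \<Longrightarrow> \<phi> differentiable (at x)"
  unfolding smooth_def by (metis iter_pderiv.simps(1))

lemma iter_pderiv_append: "iter_pderiv (is @ js) f = iter_pderiv is (iter_pderiv js f)"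
  by (induction "is") auto

lemma smooth_pderiv: "smooth \<phi> \<Longrightarrow> smooth (pderiv_at i \<phi>)"
  unfolding smooth_def using iter_pderiv_append[of _ "[i]" \<phi>] by (metis iter_pderiv.simps)

lemma pderiv_at_has_derivative:
  assumes "(f has_derivative f') (at x)"
  shows "pderiv_at i f x = f' (axis i 1)"
  unfolding pderiv_at_def using frechet_derivative_at[OF assms] by simp

lemma differentiable_has_derivative:
  "f differentiable (at x) \<Longrightarrow> (f has_derivative frechet_derivative f (at x)) (at x)"
  by (simp add: frechet_derivative_works)

lemma pderiv_at_add:
  assumes "f differentiable (at x)" "g differentiable (at x)"
  shows "pderiv_at i (\<lambda>x. f x + g x) x = pderiv_at i f x + pderiv_at i g x"
  by (subst pderiv_at_has_derivative[OF has_derivative_add[OF assms[THEN differentiable_has_derivative]]])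
    (simp add: pderiv_at_def)

lemma pderiv_at_mult:
  assumes "f differentiable (at x)" "g differentiable (at x)"
  shows "pderiv_at i (\<lambda>x. f x * g x) x = f x * pderiv_at i g x + pderiv_at i f x * g x"
  by (subst pderiv_at_has_derivative[OF has_derivative_mult[OF assms[THEN differentiable_has_derivative]]])
    (simp add: pderiv_at_def)

lemma pderiv_at_cmult:
  assumes "f differentiable (at x)"
  shows "pderiv_at i (\<lambda>x. c * f x) x = c * pderiv_at i f x"
  by (subst pderiv_at_has_derivative[OF has_derivative_mult_right[OF assms[THEN differentiable_has_derivative]]])
    (simp add: pderiv_at_def)

lemma smooth_add:
  assumes "smooth \<phi>" "smooth \<psi>"
  shows "smooth (\<phi> + \<psi>)"
proof -
  have *: "iter_pderiv is (\<phi> + \<psi>) = (\<lambda>x. iter_pderiv is \<phi> x + iter_pderiv is \<psi> x)" for "is"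
  proof (induction "is")
    case (Cons i "is")
    show ?case
      unfolding iter_pderiv.simps Cons.IH using assms by (auto simp: smooth_def pderiv_at_add)
  qed (simp add: plus_fun_def)
  show ?thesis
    unfolding smooth_def * using assms by (auto simp: smooth_def intro: differentiable_add)
qed

lemma smooth_scaleR:
  assumes "smooth \<phi>"
  shows "smooth (c *\<^sub>R \<phi>)"
proof -
  have *: "iter_pderiv is (c *\<^sub>R \<phi>) = (\<lambda>x. c * iter_pderiv is \<phi> x)" for "is"
  proof (induction "is")
    case (Cons i "is")
    show ?case
      unfolding iter_pderiv.simps Cons.IH using assms by (auto simp: smooth_def pderiv_at_cmult)
  qed (simp add: scaleR_fun_def)
  show ?thesis
    unfolding smooth_def * using assms
    by (auto simp: smooth_def intro: differentiable_mult differentiable_const)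
qed

lemma compact_closure_subset:
  fixes A :: "'a::heine_borel set"
  assumes "compact (closure B)" "closure B \<subseteq> \<Omega>" "A \<subseteq> closure B"
  shows "compact (closure A) \<and> closure A \<subseteq> \<Omega>"
proof -
  have "closure A \<subseteq> closure B" using assms(3) by (simp add: closure_minimal)
  then show ?thesis using assms by (meson bounded_subset closed_closure compact_eq_bounded_closed subset_trans)
qed

lemma test_functions_add:
  assumes "\<phi> \<in> test_functions \<Omega>" "\<psi> \<in> test_functions \<Omega>"
  shows "\<phi> + \<psi> \<in> test_functions \<Omega>"
proof -
  have "{x. (\<phi> + \<psi>) x \<noteq> 0} \<subseteq> closure ({x. \<phi> x \<noteq> 0} \<union> {x. \<psi> x \<noteq> 0})"
    by (rule order_trans[OF _ closure_subset]) auto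
  then show ?thesis
    using assms compact_closure_subset[of "{x. \<phi> x \<noteq> 0} \<union> {x. \<psi> x \<noteq> 0}" \<Omega> "{x. (\<phi> + \<psi>) x \<noteq> 0}"]
    by (auto simp: test_functions_def smooth_add compact_Un)
qed

lemma test_functions_scaleR:
  assumes "\<phi> \<in> test_functions \<Omega>"
  shows "c *\<^sub>R \<phi> \<in> test_functions \<Omega>"
proof -
  have "{x. (c *\<^sub>R \<phi>) x \<noteq> 0} \<subseteq> closure {x. \<phi> x \<noteq> 0}"
    by (rule order_trans[OF _ closure_subset]) (auto simp: scaleR_fun_def)
  then show ?thesis
    using assms compact_closure_subset[of "{x. \<phi> x \<noteq> 0}" \<Omega> "{x. (c *\<^sub>R \<phi>) x \<noteq> 0}"]
    by (auto simp: test_functions_def smooth_scaleR)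
qed

lemma eq_0_outside_support:
  "x \<notin> closure {x. f x \<noteq> 0} \<Longrightarrow> f x = 0"
  using closure_subset[of "{x. f x \<noteq> 0}"] by blast

text \<open>The complement of the support is open, so the function vanishes near the point.\<close>

lemma pderiv_at_eq_0_outside_support:
  assumes "x \<notin> closure {x. f x \<noteq> 0}"
  shows "pderiv_at i f x = 0"
proof -
  have "(f has_derivative (\<lambda>_. 0)) (at x)"
  proof (rule has_derivative_transform_within_open[OF has_derivative_const])
    show "open (- closure {x. f x \<noteq> 0})" "x \<in> - closure {x. f x \<noteq> 0}" using assms by auto
    show "0 = f y" if "y \<in> - closure {x. f x \<noteq> 0}" for y
      using eq_0_outside_support[of y f] that by simp
  qed
  then show ?thesis by (simp add: pderiv_at_has_derivative)
qed

lemma test_functions_pderiv: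
  assumes "\<phi> \<in> test_functions \<Omega>"
  shows "pderiv_at i \<phi> \<in> test_functions \<Omega>"
proof -
  have "{x. pderiv_at i \<phi> x \<noteq> 0} \<subseteq> closure {x. \<phi> x \<noteq> 0}"
    using pderiv_at_eq_0_outside_support by blast
  then show ?thesis
    using assms compact_closure_subset[of "{x. \<phi> x \<noteq> 0}" \<Omega> "{x. pderiv_at i \<phi> x \<noteq> 0}"]
    by (auto simp: test_functions_def smooth_pderiv)
qed

lemma test_functions_eq_0_outside:
  "\<phi> \<in> test_functions \<Omega> \<Longrightarrow> x \<notin> \<Omega> \<Longrightarrow> \<phi> x = 0"
  using eq_0_outside_support[of x \<phi>] unfolding test_functions_def by blast

section \<open>Integration of test functions\<close>

lemma continuous_compact_support_integrable:
  fixes f :: "'a::euclidean_space \<Rightarrow> real"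
  assumes "continuous_on UNIV f" "compact K" "\<And>x. x \<notin> K \<Longrightarrow> f x = 0"
  shows "integrable lborel f"
proof -
  have "(\<lambda>x. indicator K x *\<^sub>R f x) = f" using assms(3) by (auto simp: fun_eq_iff indicator_def)
  then show ?thesis
    using borel_integrable_compact[OF assms(2) continuous_on_subset[OF assms(1)]] by simp
qed

lemma lebesgue_on_integrable_integral:
  fixes f :: "real^'n \<Rightarrow> real"
  assumes \<Omega>: "\<Omega> \<in> sets lebesgue" and f: "integrable lborel f" "\<And>x. x \<notin> \<Omega> \<Longrightarrow> f x = 0"
  shows "integrable (lebesgue_on \<Omega>) f" "integral\<^sup>L (lebesgue_on \<Omega>) f = integral\<^sup>L lborel f"
proof -
  have eq: "(\<lambda>x. indicator \<Omega> x *\<^sub>R f x) = f" using f(2) by (auto simp: fun_eq_iff indicator_def)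
  have meas: "f \<in> borel_measurable lborel" using f(1) by simp
  show "integrable (lebesgue_on \<Omega>) f"
    using \<Omega> f(1) integrable_completion[OF meas] by (subst integrable_restrict_space) (auto simp: eq simp del: real_scaleR_def)
  show "integral\<^sup>L (lebesgue_on \<Omega>) f = integral\<^sup>L lborel f"
    using \<Omega> integral_completion[OF meas] by (subst integral_restrict_space) (auto simp: eq simp del: real_scaleR_def)
qed

lemma test_functions_square_integrable:
  assumes \<Omega>: "open \<Omega>" and \<phi>: "\<phi> \<in> test_functions \<Omega>"
  shows "square_integrable \<Omega> \<phi>"
proof -
  have cont: "continuous_on UNIV \<phi>" using \<phi> by (simp add: test_functions_def smooth_continuous)
  have "integrable lborel (\<lambda>x. \<phi> x * \<phi> x)"
    by (rule continuous_compact_support_integrable[of _ "closure {x. \<phi> x \<noteq> 0}"])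
      (use \<phi> in \<open>auto simp: test_functions_def intro!: continuous_intros cont dest: eq_0_outside_support[of _ \<phi>]\<close>)
  moreover have "\<Omega> \<in> sets lebesgue" using \<Omega> by auto
  ultimately have "integrable (lebesgue_on \<Omega>) (\<lambda>x. \<phi> x * \<phi> x)"
    using lebesgue_on_integrable_integral(1)[of \<Omega> "\<lambda>x. \<phi> x * \<phi> x"]
      test_functions_eq_0_outside[OF \<phi>] by auto
  then show ?thesis
    using continuous_measurable_lebesgue_on[OF cont] by (simp add: square_integrable_def)
qed

text \<open>The integral of the difference quotients vanishes by translation invariance, and they
  converge boundedly.\<close>

lemma integral_pderiv_eq_0:
  fixes f :: "real^'n \<Rightarrow> real"
  assumes diff: "\<And>x. f differentiable (at x)" and cont: "continuous_on UNIV (pderiv_at i f)"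
    and K: "compact K" "\<And>x. x \<notin> K \<Longrightarrow> f x = 0"
  shows "(\<integral>x. pderiv_at i f x \<partial>lborel) = 0"
proof -
  define e :: "real^'n" where "e = axis i 1"
  have e: "norm e = 1" by (simp add: e_def)
  have f_cont: "continuous_on UNIV f"
    using diff by (simp add: differentiable_imp_continuous_on differentiable_on_def differentiable_at_withinI)
  have f_int: "integrable lborel f" by (rule continuous_compact_support_integrable[OF f_cont K])
  have line: "((\<lambda>t. f (x + t *\<^sub>R e)) has_real_derivative pderiv_at i f (x + t *\<^sub>R e)) (at t)" for x t
  proof -
    have "((\<lambda>t. x + t *\<^sub>R e) has_derivative (\<lambda>h. h *\<^sub>R e)) (at t)"
      by (auto intro!: derivative_eq_intros)
    from has_derivative_compose[OF this differentiable_has_derivative[OF diff]]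
    have "((\<lambda>t. f (x + t *\<^sub>R e)) has_derivative
        (\<lambda>h. frechet_derivative f (at (x + t *\<^sub>R e)) (h *\<^sub>R e))) (at t)" .
    moreover have "frechet_derivative f (at (x + t *\<^sub>R e)) (h *\<^sub>R e) = pderiv_at i f (x + t *\<^sub>R e) * h" for h
      using linear_frechet_derivative[OF diff[of "x + t *\<^sub>R e"]]
      by (simp add: linear_scale pderiv_at_def e_def)
    ultimately show ?thesis by (simp add: has_field_derivative_def)
  qed
  obtain R where R: "\<And>x. x \<in> K \<Longrightarrow> norm x \<le> R"
    using compact_imp_bounded[OF K(1)] by (auto simp: bounded_iff)
  have supp: "pderiv_at i f x = 0" if "x \<notin> K" for x
  proof -
    have "{x. f x \<noteq> 0} \<subseteq> K" using K(2) by auto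
    then have "closure {x. f x \<noteq> 0} \<subseteq> K" using K(1) by (simp add: closure_minimal compact_imp_closed)
    then show ?thesis using that by (intro pderiv_at_eq_0_outside_support) auto
  qed
  obtain M where M: "\<And>x. x \<in> K \<Longrightarrow> norm (pderiv_at i f x) \<le> M"
    using compact_imp_bounded[OF compact_continuous_image[OF continuous_on_subset[OF cont] K(1)]]
    by (auto simp: bounded_iff)
  have M': "\<bar>pderiv_at i f x\<bar> \<le> max M 0" for x
    using M[of x] supp[of x] by (cases "x \<in> K") (auto simp: max_def)
  define s where "s n x = (f (x + (1 / real (Suc n)) *\<^sub>R e) - f x) * real (Suc n)" for n x
  have "(\<lambda>n. \<integral>x. s n x \<partial>lborel) \<longlonglongrightarrow> (\<integral>x. pderiv_at i f x \<partial>lborel)"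
  proof (rule integral_dominated_convergence)
    \<comment> \<open>The radius R + 1 leaves room for the shifts, whose length 1 / (n + 1) is at
      most 1; \<open>max M 0\<close> is a bound also when \<open>K\<close> is empty.\<close>
    show "integrable lborel (\<lambda>x. max M 0 * indicat_real (cball 0 (R + 1)) x)"
      by (intro integrable_mult_right integrable_real_indicator emeasure_lborel_cball_finite) auto
    show "pderiv_at i f \<in> borel_measurable lborel"
      using borel_measurable_continuous_onI[OF cont] by simp
    have "continuous_on UNIV (s n)" for n
      unfolding s_def by (intro continuous_intros continuous_on_compose2[OF f_cont]) auto
    then show "s n \<in> borel_measurable lborel" for n
      using borel_measurable_continuous_onI by auto
    have "(\<lambda>n. s n x) \<longlonglongrightarrow> pderiv_at i f x" for x
    proof -
      have "((\<lambda>t. (f (x + t *\<^sub>R e) - f x) / t) \<longlongrightarrow> pderiv_at i f x) (at 0)"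
        using line[of x 0] by (simp add: DERIV_def)
      moreover have "filterlim (\<lambda>n. 1 / real (Suc n)) (at 0) sequentially"
        using LIMSEQ_Suc[OF lim_1_over_n[where 'a = real]] by (simp del: of_nat_Suc add: filterlim_at)
      ultimately have "(\<lambda>n. (f (x + (1 / real (Suc n)) *\<^sub>R e) - f x) / (1 / real (Suc n)))
          \<longlonglongrightarrow> pderiv_at i f x" by (rule filterlim_compose)
      then show ?thesis by (simp add: s_def)
    qed
    then show "AE x in lborel. (\<lambda>n. s n x) \<longlonglongrightarrow> pderiv_at i f x" by simp
    have "\<bar>s n x\<bar> \<le> max M 0 * indicat_real (cball 0 (R + 1)) x" for n x
    proof (cases "x \<in> cball 0 (R + 1)")
      case True
      let ?t = "1 / real (Suc n)"
      \<comment> \<open>By the mean value theorem a difference quotient is a value of the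
        derivative, which gives a bound independent of n.\<close>
      obtain z where "f (x + ?t *\<^sub>R e) - f (x + 0 *\<^sub>R e) = (?t - 0) * pderiv_at i f (x + z *\<^sub>R e)"
        using MVT2[of 0 ?t "\<lambda>t. f (x + t *\<^sub>R e)" "\<lambda>t. pderiv_at i f (x + t *\<^sub>R e)"] line by auto
      then have "s n x = pderiv_at i f (x + z *\<^sub>R e)" by (simp add: s_def)
      then show ?thesis using M' True by simp
    next
      case False
      then have nx: "norm x > R + 1" by simp
      have "norm x \<le> norm (x + (1 / real (Suc n)) *\<^sub>R e) + norm ((1 / real (Suc n)) *\<^sub>R e)"
        using norm_triangle_ineq4[of "x + (1 / real (Suc n)) *\<^sub>R e" "(1 / real (Suc n)) *\<^sub>R e"] by simp
      moreover have "norm ((1 / real (Suc n)) *\<^sub>R e) \<le> 1" using e by simp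
      ultimately have "norm (x + (1 / real (Suc n)) *\<^sub>R e) > R" using nx by linarith
      then have "x + (1 / real (Suc n)) *\<^sub>R e \<notin> K" "x \<notin> K"
        using R[of x] R[of "x + (1 / real (Suc n)) *\<^sub>R e"] nx by auto
      then show ?thesis using K(2) by (simp add: s_def)
    qed
    then show "AE x in lborel. norm (s n x) \<le> max M 0 * indicat_real (cball 0 (R + 1)) x" for n
      by simp
  qed
  moreover have "(\<integral>x. s n x \<partial>lborel) = 0" for n
  proof -
    let ?d = "(1 / real (Suc n)) *\<^sub>R e"
    have meas: "f \<in> borel_measurable borel" by (rule borel_measurable_continuous_onI[OF f_cont])
    have "integrable (distr lborel borel ((+) ?d)) f" using f_int by (simp only: lborel_distr_plus)
    then have "integrable lborel (\<lambda>x. f (?d + x))"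
      using meas by (subst (asm) integrable_distr_eq) auto
    moreover have "(\<integral>x. f (?d + x) \<partial>lborel) = (\<integral>x. f x \<partial>distr lborel borel ((+) ?d))"
      using meas by (subst integral_distr) auto
    ultimately show ?thesis
      using f_int by (simp add: s_def lborel_distr_plus add.commute)
  qed
  ultimately show ?thesis by (simp add: LIMSEQ_const_iff)
qed

text \<open>The derivative of the product has integral zero over the whole space; as the supports
  lie in \<Omega>, this is the integral over \<Omega>.\<close>

lemma integration_by_parts:
  assumes \<Omega>: "open \<Omega>" and \<phi>: "\<phi> \<in> test_functions \<Omega>" and \<psi>: "\<psi> \<in> test_functions \<Omega>"
  shows "L2_inner \<Omega> \<phi> (pderiv_at i \<psi>) = - L2_inner \<Omega> (pderiv_at i \<phi>) \<psi>"
proof -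
  let ?f = "\<lambda>x. \<phi> x * \<psi> x"
  note test = \<phi> \<psi> \<phi>[THEN test_functions_pderiv, of i] \<psi>[THEN test_functions_pderiv, of i]
  have sm: "smooth \<phi>" "smooth \<psi>" using \<phi> \<psi> by (auto simp: test_functions_def)
  have pd: "pderiv_at i ?f = (\<lambda>x. \<phi> x * pderiv_at i \<psi> x + pderiv_at i \<phi> x * \<psi> x)"
    using sm by (auto simp: pderiv_at_mult smooth_differentiable)
  have cont: "continuous_on UNIV (pderiv_at i ?f)"
    unfolding pd using test by (intro continuous_intros smooth_continuous) (auto simp: test_functions_def)
  have diff: "?f differentiable (at x)" for x
    using sm by (intro differentiable_mult smooth_differentiable)
  have K: "compact (closure {x. \<phi> x \<noteq> 0})" using \<phi> by (simp add: test_functions_def)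
  have pd_int: "integrable lborel (pderiv_at i ?f)"
  proof (rule continuous_compact_support_integrable[OF cont K])
    fix x assume "x \<notin> closure {x. \<phi> x \<noteq> 0}"
    then have "\<phi> x = 0" "pderiv_at i \<phi> x = 0"
      by (rule eq_0_outside_support, rule pderiv_at_eq_0_outside_support)
    then show "pderiv_at i ?f x = 0" by (simp add: pd)
  qed
  have "L2_inner \<Omega> \<phi> (pderiv_at i \<psi>) + L2_inner \<Omega> (pderiv_at i \<phi>) \<psi> = (\<integral>x. pderiv_at i ?f x \<partial>lebesgue_on \<Omega>)"
    unfolding pd L2_inner_def
    using square_integrable_inner[of \<Omega>, OF test(1,4)[THEN test_functions_square_integrable[OF \<Omega>]]]
      square_integrable_inner[of \<Omega>, OF test(3,2)[THEN test_functions_square_integrable[OF \<Omega>]]] by simp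
  also have "\<dots> = (\<integral>x. pderiv_at i ?f x \<partial>lborel)"
    using \<Omega> test by (intro lebesgue_on_integrable_integral(2) pd_int)
      (auto simp: pd test_functions_eq_0_outside[of _ \<Omega>])
  also have "\<dots> = 0"
    by (rule integral_pderiv_eq_0[OF diff cont K]) (drule eq_0_outside_support[of _ \<phi>], simp)
  finally show ?thesis by simp
qed

lemma is_weak_grad_test_function:
  assumes \<Omega>: "open \<Omega>" and \<phi>: "\<phi> \<in> test_functions \<Omega>"
  shows "is_weak_grad \<Omega> \<phi> (\<lambda>x. \<chi> i. pderiv_at i \<phi> x)"
  unfolding is_weak_grad_def
  using integration_by_parts[OF assms]
  by (auto intro!: square_integrable_vec_lambda test_functions_square_integrable assms test_functions_pderiv)

text \<open>Integrate \<open>\<partial>\<^sub>i (x\<^sub>i \<phi>\<^sup>2) = \<phi>\<^sup>2 + 2 x\<^sub>i \<phi> \<partial>\<^sub>i \<phi>\<close>.\<close>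

lemma Poincare_test_function:
  fixes \<Omega> :: "(real^'n) set"
  assumes \<Omega>: "open \<Omega>" and R: "\<And>x. x \<in> \<Omega> \<Longrightarrow> norm x \<le> R" and \<phi>: "\<phi> \<in> test_functions \<Omega>"
  shows "L2_norm \<Omega> \<phi> \<le> 2 * R * L2_norm \<Omega> (pderiv_at i \<phi>)"
\<comment> \<open>On the empty set \<open>R\<close> may be negative, but both norms are 0
  there.\<close>
proof (cases "\<Omega> = {}")
  case False
  then have R0: "R \<ge> 0" using R norm_ge_zero order_trans by blast
  let ?g = "\<lambda>x. (x $ i) * \<phi> x"
  let ?f = "\<lambda>x. ?g x * \<phi> x"
  have sm: "smooth \<phi>" "smooth (pderiv_at i \<phi>)" using \<phi> by (auto simp: test_functions_def smooth_pderiv)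
  note cont_\<phi> = sm[THEN smooth_continuous]
  have "((\<lambda>x::real^'n. x $ i) has_derivative (\<lambda>x. x $ i)) (at x)" for x
    by (rule bounded_linear_imp_has_derivative[OF bounded_linear_vec_nth])
  then have x_diff: "(\<lambda>x::real^'n. x $ i) differentiable (at x)" "pderiv_at i (\<lambda>x. x $ i) x = 1" for x
    using pderiv_at_has_derivative[of _ "\<lambda>x. x $ i" x i] by (auto simp: differentiable_def)
  note diff = smooth_differentiable[OF sm(1)] differentiable_mult[OF x_diff(1) smooth_differentiable[OF sm(1)]]
  have pd: "pderiv_at i ?f = (\<lambda>x. \<phi> x * \<phi> x + 2 * (?g x * pderiv_at i \<phi> x))"
    unfolding fun_eq_iff pderiv_at_mult[OF diff(2,1)] pderiv_at_mult[OF x_diff(1) diff(1)] x_diff(2)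
    by (simp add: algebra_simps)
  have cont: "continuous_on UNIV (pderiv_at i ?f)"
    unfolding pd by (intro continuous_intros cont_\<phi>)
  have compact: "compact (closure {x. \<phi> x \<noteq> 0})" using \<phi> by (simp add: test_functions_def)
  have pd_int: "integrable lborel (pderiv_at i ?f)"
    by (rule continuous_compact_support_integrable[OF cont compact]) (drule eq_0_outside_support[of _ \<phi>], simp add: pd)
  have sq: "square_integrable \<Omega> \<phi>" "square_integrable \<Omega> (pderiv_at i \<phi>)"
    using \<phi> \<Omega> by (auto intro: test_functions_square_integrable test_functions_pderiv)
  have "continuous_on UNIV ?g" by (intro continuous_intros cont_\<phi>)
  then have g_meas: "?g \<in> borel_measurable (lebesgue_on \<Omega>)" by (rule continuous_measurable_lebesgue_on)
  \<comment> \<open>The weight x_i is unbounded on the whole space, but on \<Omega> it is at most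
    \<open>R\<close> and elsewhere \<open>\<phi>\<close> vanishes.\<close>
  have g_le: "\<bar>?g x\<bar> \<le> R * \<bar>\<phi> x\<bar>" for x
  proof (cases "x \<in> \<Omega>")
    case True
    then have "\<bar>x $ i\<bar> \<le> R" using R component_le_norm_cart order_trans by blast
    then show ?thesis by (simp add: abs_mult mult_right_mono)
  qed (simp add: test_functions_eq_0_outside[OF \<phi>])
  have R\<phi>: "square_integrable \<Omega> (\<lambda>x. R *\<^sub>R \<phi> x)" by (rule square_integrable_scaleR[OF sq(1)])
  have g: "square_integrable \<Omega> ?g"
  proof (rule square_integrable_bound[OF g_meas square_integrable_inner[OF R\<phi> R\<phi>]])
    show "?g x \<bullet> ?g x \<le> (R *\<^sub>R \<phi> x) \<bullet> (R *\<^sub>R \<phi> x)" for x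
      using power_mono[OF g_le[of x], of 2] by (simp add: power_mult_distrib power2_eq_square abs_mult)
  qed
  have g_norm: "L2_norm \<Omega> ?g \<le> R * L2_norm \<Omega> \<phi>"
  proof -
    have "L2_norm \<Omega> ?g \<le> L2_norm \<Omega> (\<lambda>x. R *\<^sub>R \<phi> x)"
      using g_le R0 by (intro L2_norm_mono g R\<phi>) (auto simp: abs_mult)
    then show ?thesis using R0 by (simp add: L2_norm_scaleR del: real_scaleR_def)
  qed
  have "L2_inner \<Omega> \<phi> \<phi> + 2 * L2_inner \<Omega> ?g (pderiv_at i \<phi>) = (\<integral>x. pderiv_at i ?f x \<partial>lebesgue_on \<Omega>)"
    unfolding pd L2_inner_def
    using square_integrable_inner[OF sq(1,1)] square_integrable_inner[OF g sq(2)] by simp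
  also have "\<dots> = (\<integral>x. pderiv_at i ?f x \<partial>lborel)"
    using \<Omega> by (intro lebesgue_on_integrable_integral(2) pd_int)
      (auto simp: pd test_functions_eq_0_outside[OF \<phi>])
  also have "\<dots> = 0"
    by (rule integral_pderiv_eq_0[OF differentiable_mult[OF diff(2,1)] cont compact]) (drule eq_0_outside_support[of _ \<phi>], simp)
  finally have "(L2_norm \<Omega> \<phi>)\<^sup>2 = - 2 * L2_inner \<Omega> ?g (pderiv_at i \<phi>)"
    by (simp add: L2_norm_power2)
  also have "\<dots> \<le> 2 * (L2_norm \<Omega> ?g * L2_norm \<Omega> (pderiv_at i \<phi>))"
    using L2_Cauchy_Schwarz[OF g sq(2)] by linarith
  also have "\<dots> \<le> 2 * (R * L2_norm \<Omega> \<phi> * L2_norm \<Omega> (pderiv_at i \<phi>))"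
    using g_norm by (intro mult_left_mono mult_right_mono) auto
  finally have "L2_norm \<Omega> \<phi> * L2_norm \<Omega> \<phi> \<le> L2_norm \<Omega> \<phi> * (2 * R * L2_norm \<Omega> (pderiv_at i \<phi>))"
    by (simp add: power2_eq_square algebra_simps)
  then show ?thesis
    using R0 by (cases "L2_norm \<Omega> \<phi> = 0") (auto simp: less_le)
qed (simp add: L2_norm_def L2_inner_def integral_restrict_space)

section \<open>Sobolev spaces\<close>

lemma is_weak_grad_weak_grad: "u \<in> H1 \<Omega> \<Longrightarrow> is_weak_grad \<Omega> u (weak_grad \<Omega> u)"
  unfolding H1_def weak_grad_def by (auto intro: someI[of "is_weak_grad \<Omega> u"])

lemma is_weak_grad_square_integrable: "is_weak_grad \<Omega> u g \<Longrightarrow> square_integrable \<Omega> g"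
  by (simp add: is_weak_grad_def)

lemma H1_square_integrable:
  assumes "u \<in> H1 \<Omega>"
  shows "square_integrable \<Omega> u" "square_integrable \<Omega> (weak_grad \<Omega> u)"
  using assms is_weak_grad_square_integrable[OF is_weak_grad_weak_grad[OF assms]]
  by (simp_all add: H1_def)

lemma H1_I: "square_integrable \<Omega> u \<Longrightarrow> is_weak_grad \<Omega> u g \<Longrightarrow> u \<in> H1 \<Omega>"
  by (auto simp: H1_def)

text \<open>The fundamental lemma applied to each component of the difference.\<close>

lemma is_weak_grad_unique:
  assumes \<Omega>: "open \<Omega>" and g: "is_weak_grad \<Omega> u g" and g': "is_weak_grad \<Omega> u g'"
  shows "AE x in lebesgue_on \<Omega>. g x = g' x"
proof -
  have "AE x in lebesgue_on \<Omega>. g x $ i - g' x $ i = 0" for i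
  proof (rule fundamental_lemma_calculus_of_variations[OF \<Omega>])
    have sq: "square_integrable \<Omega> (\<lambda>x. g x $ i)" "square_integrable \<Omega> (\<lambda>x. g' x $ i)"
      using g g' by (auto simp: is_weak_grad_def intro: square_integrable_component)
    then show "square_integrable \<Omega> (\<lambda>x. g x $ i - g' x $ i)" by (rule square_integrable_diff)
    fix \<phi> assume \<phi>: "\<phi> \<in> test_functions \<Omega>"
    have *: "L2_inner \<Omega> (\<lambda>x. g x $ i - g' x $ i) \<phi>
        = L2_inner \<Omega> (\<lambda>x. g x $ i) \<phi> - L2_inner \<Omega> (\<lambda>x. g' x $ i) \<phi>"
      by (rule L2_inner_diff_left[OF sq test_functions_square_integrable[OF \<Omega> \<phi>]])
    show "L2_inner \<Omega> (\<lambda>x. g x $ i - g' x $ i) \<phi> = 0"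
    proof -
      have "L2_inner \<Omega> u (pderiv_at i \<phi>) = - L2_inner \<Omega> (\<lambda>x. g x $ i) \<phi>"
        "L2_inner \<Omega> u (pderiv_at i \<phi>) = - L2_inner \<Omega> (\<lambda>x. g' x $ i) \<phi>"
        using g g' \<phi> by (simp_all add: is_weak_grad_def)
      then show ?thesis using * by linarith
    qed
  qed
  then have "AE x in lebesgue_on \<Omega>. \<forall>i. g x $ i - g' x $ i = 0" by (simp add: AE_all_countable)
  then show ?thesis by eventually_elim (simp add: vec_eq_iff)
qed

lemma weak_grad_AE_eq:
  assumes "open \<Omega>" "square_integrable \<Omega> u" "is_weak_grad \<Omega> u g"
  shows "AE x in lebesgue_on \<Omega>. weak_grad \<Omega> u x = g x"
  using assms is_weak_grad_unique is_weak_grad_weak_grad H1_I by metis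

lemma is_weak_grad_add:
  assumes \<Omega>: "open \<Omega>" and u: "u \<in> H1 \<Omega>" and v: "v \<in> H1 \<Omega>"
  shows "is_weak_grad \<Omega> (u + v) (\<lambda>x. weak_grad \<Omega> u x + weak_grad \<Omega> v x)"
  unfolding is_weak_grad_def plus_fun_def
proof (intro conjI ballI allI)
  note gu = is_weak_grad_weak_grad[OF u] and gv = is_weak_grad_weak_grad[OF v]
  show "square_integrable \<Omega> (\<lambda>x. weak_grad \<Omega> u x + weak_grad \<Omega> v x)"
    using u v by (intro square_integrable_add H1_square_integrable)
  fix \<phi> i assume \<phi>: "\<phi> \<in> test_functions \<Omega>"
  note sq = test_functions_square_integrable[OF \<Omega> \<phi>]
    test_functions_square_integrable[OF \<Omega> test_functions_pderiv[OF \<phi>], of i]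
    H1_square_integrable(1)[OF u] H1_square_integrable(1)[OF v]
    square_integrable_component[OF H1_square_integrable(2)[OF u], of i]
    square_integrable_component[OF H1_square_integrable(2)[OF v], of i]
  show "L2_inner \<Omega> (\<lambda>x. u x + v x) (pderiv_at i \<phi>)
      = - L2_inner \<Omega> (\<lambda>x. (weak_grad \<Omega> u x + weak_grad \<Omega> v x) $ i) \<phi>"
    using gu gv \<phi> by (simp add: is_weak_grad_def L2_inner_add_left sq)
qed

lemma is_weak_grad_scaleR:
  assumes u: "u \<in> H1 \<Omega>"
  shows "is_weak_grad \<Omega> (c *\<^sub>R u) (\<lambda>x. c *\<^sub>R weak_grad \<Omega> u x)"
  unfolding is_weak_grad_def scaleR_fun_def
proof (intro conjI ballI allI)
  show "square_integrable \<Omega> (\<lambda>x. c *\<^sub>R weak_grad \<Omega> u x)"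
    using u by (intro square_integrable_scaleR H1_square_integrable)
  fix \<phi> i assume \<phi>: "\<phi> \<in> test_functions \<Omega>"
  have "L2_inner \<Omega> (\<lambda>x. c *\<^sub>R u x) (pderiv_at i \<phi>) = c * L2_inner \<Omega> u (pderiv_at i \<phi>)"
    by (rule L2_inner_scaleR_left)
  also have "\<dots> = - L2_inner \<Omega> (\<lambda>x. c *\<^sub>R (weak_grad \<Omega> u x $ i)) \<phi>"
    using is_weak_grad_weak_grad[OF u] \<phi> unfolding L2_inner_scaleR_left by (simp add: is_weak_grad_def)
  finally show "L2_inner \<Omega> (\<lambda>x. c *\<^sub>R u x) (pderiv_at i \<phi>)
      = - L2_inner \<Omega> (\<lambda>x. (c *\<^sub>R weak_grad \<Omega> u x) $ i) \<phi>" by simp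
qed

lemma subspace_H1:
  assumes \<Omega>: "open \<Omega>"
  shows "subspace (H1 \<Omega>)"
  unfolding subspace_def
proof (intro conjI ballI allI)
  show "0 \<in> H1 \<Omega>"
    by (rule H1_I[of _ _ "\<lambda>_. 0"]) (auto simp: is_weak_grad_def zero_fun_def)
  fix u assume u: "u \<in> H1 \<Omega>"
  show "c *\<^sub>R u \<in> H1 \<Omega>" for c
    by (rule H1_I[OF _ is_weak_grad_scaleR[OF u]])
      (use square_integrable_scaleR[OF H1_square_integrable(1)[OF u], of c] in \<open>simp add: scaleR_fun_def\<close>)
  fix v assume v: "v \<in> H1 \<Omega>"
  show "u + v \<in> H1 \<Omega>"
    by (rule H1_I[OF _ is_weak_grad_add[OF \<Omega> u v]])
      (use square_integrable_add[OF H1_square_integrable(1)[OF u] H1_square_integrable(1)[OF v]]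
        in \<open>simp add: plus_fun_def\<close>)
qed

text \<open>Operators such as \<^const>\<open>weak_grad\<close> are linear only up to null sets; this suffices for the
  forms that they define by integration.\<close>

definition AE_linear_on ::
  "(real^'n) set \<Rightarrow> 'a::real_vector set \<Rightarrow> ('a \<Rightarrow> real^'n \<Rightarrow> 'b::euclidean_space) \<Rightarrow> bool"
  where "AE_linear_on \<Omega> W D \<longleftrightarrow>
    (\<forall>u\<in>W. square_integrable \<Omega> (D u)) \<and>
    (\<forall>u\<in>W. \<forall>v\<in>W. AE x in lebesgue_on \<Omega>. D (u + v) x = D u x + D v x) \<and>
    (\<forall>c. \<forall>u\<in>W. AE x in lebesgue_on \<Omega>. D (c *\<^sub>R u) x = c *\<^sub>R D u x)"

lemma AE_linear_on_subset: "AE_linear_on \<Omega> W D \<Longrightarrow> W' \<subseteq> W \<Longrightarrow> AE_linear_on \<Omega> W' D"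
  unfolding AE_linear_on_def by (meson subsetD)

lemma AE_linear_onD:
  assumes "AE_linear_on \<Omega> W D"
  shows "u \<in> W \<Longrightarrow> square_integrable \<Omega> (D u)"
    and "u \<in> W \<Longrightarrow> v \<in> W \<Longrightarrow> AE x in lebesgue_on \<Omega>. D (u + v) x = D u x + D v x"
    and "u \<in> W \<Longrightarrow> AE x in lebesgue_on \<Omega>. D (c *\<^sub>R u) x = c *\<^sub>R D u x"
  using assms by (simp_all add: AE_linear_on_def)

text \<open>Through this, divergence and strain inherit linearity up to null sets from the
  Jacobian.\<close>

lemma AE_linear_on_bounded_linear:
  assumes A: "bounded_linear A" and D: "AE_linear_on \<Omega> W D"
  shows "AE_linear_on \<Omega> W (\<lambda>u x. A (D u x))"
proof -
  interpret A: bounded_linear A by fact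
  show ?thesis
    unfolding AE_linear_on_def
  proof (intro conjI ballI allI)
    fix u assume u: "u \<in> W"
    then show "square_integrable \<Omega> (\<lambda>x. A (D u x))"
      using D by (auto simp: AE_linear_on_def intro: square_integrable_bounded_linear[OF A])
    show "AE x in lebesgue_on \<Omega>. A (D (c *\<^sub>R u) x) = c *\<^sub>R A (D u x)" for c
    proof -
      have "AE x in lebesgue_on \<Omega>. D (c *\<^sub>R u) x = c *\<^sub>R D u x"
        using D u by (simp add: AE_linear_on_def)
      then show ?thesis by eventually_elim (simp add: A.scaleR)
    qed
    fix v assume "v \<in> W"
    then have "AE x in lebesgue_on \<Omega>. D (u + v) x = D u x + D v x"
      using D u by (simp add: AE_linear_on_def)
    then show "AE x in lebesgue_on \<Omega>. A (D (u + v) x) = A (D u x) + A (D v x)"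
      by eventually_elim (simp add: A.add)
  qed
qed

lemma linear_map_on_L2_inner:
  assumes W: "subspace W" and D: "AE_linear_on \<Omega> W D" and f: "square_integrable \<Omega> f"
  shows "linear_map_on W (\<lambda>u. L2_inner \<Omega> (D u) f)"
  unfolding linear_map_on_def
proof (intro conjI ballI allI)
  fix u assume u: "u \<in> W"
  then have Du: "square_integrable \<Omega> (D u)" using D by (simp add: AE_linear_on_def)
  have "L2_inner \<Omega> (D (c *\<^sub>R u)) f = L2_inner \<Omega> (\<lambda>x. c *\<^sub>R D u x) f" for c
    using D u W f by (intro L2_inner_cong_AE square_integrable_scaleR)
      (auto simp: AE_linear_on_def subspace_mul)
  then show "L2_inner \<Omega> (D (c *\<^sub>R u)) f = c *\<^sub>R L2_inner \<Omega> (D u) f" for c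
    by (simp add: L2_inner_scaleR_left)
  fix v assume v: "v \<in> W"
  then have Dv: "square_integrable \<Omega> (D v)" using D by (simp add: AE_linear_on_def)
  have "L2_inner \<Omega> (D (u + v)) f = L2_inner \<Omega> (\<lambda>x. D u x + D v x) f"
    using D u v W f by (intro L2_inner_cong_AE square_integrable_add)
      (auto simp: AE_linear_on_def subspace_add)
  then show "L2_inner \<Omega> (D (u + v)) f = L2_inner \<Omega> (D u) f + L2_inner \<Omega> (D v) f"
    by (simp add: L2_inner_add_left Du Dv f)
qed

text \<open>All forms of the problem are combinations of instances, with \<open>D\<close> and
  \<open>E\<close> among strain, divergence, gradient and identity. Null sets disappear under the
  integral, so bilinearity is exact.\<close>

lemma bilinear_on_L2_inner:
  assumes W: "subspace W" and D: "AE_linear_on \<Omega> W D" and Z: "subspace Z" and E: "AE_linear_on \<Omega> Z E"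
  shows "bilinear_on W Z (\<lambda>u v. L2_inner \<Omega> (D u) (E v))"
proof -
  have sq: "u \<in> W \<Longrightarrow> square_integrable \<Omega> (D u)" "v \<in> Z \<Longrightarrow> square_integrable \<Omega> (E v)" for u v
    using D E by (auto simp: AE_linear_on_def)
  show ?thesis
    unfolding bilinear_on_def
  proof (intro conjI ballI)
    show "linear_map_on W (\<lambda>v. L2_inner \<Omega> (D v) (E q))" if "q \<in> Z" for q
      by (rule linear_map_on_L2_inner[OF W D sq(2)[OF that]])
    show "linear_map_on Z (\<lambda>q. L2_inner \<Omega> (D v) (E q))" if "v \<in> W" for v
      using linear_map_on_L2_inner[OF Z E sq(1)[OF that]] by (subst L2_inner_commute)
  qed
qed

lemma AE_linear_on_weak_grad:
  assumes \<Omega>: "open \<Omega>"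
  shows "AE_linear_on \<Omega> (H1 \<Omega>) (weak_grad \<Omega>)"
  unfolding AE_linear_on_def
proof (intro conjI ballI allI)
  note H1 = subspace_H1[OF \<Omega>]
  fix u assume u: "u \<in> H1 \<Omega>"
  then show "square_integrable \<Omega> (weak_grad \<Omega> u)" by (rule H1_square_integrable(2))
  show "AE x in lebesgue_on \<Omega>. weak_grad \<Omega> (c *\<^sub>R u) x = c *\<^sub>R weak_grad \<Omega> u x" for c
    by (rule weak_grad_AE_eq[OF \<Omega> H1_square_integrable(1)[OF subspace_mul[OF H1 u]]
        is_weak_grad_scaleR[OF u]])
  fix v assume v: "v \<in> H1 \<Omega>"
  show "AE x in lebesgue_on \<Omega>. weak_grad \<Omega> (u + v) x = weak_grad \<Omega> u x + weak_grad \<Omega> v x"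
    by (rule weak_grad_AE_eq[OF \<Omega> H1_square_integrable(1)[OF subspace_add[OF H1 u v]]
        is_weak_grad_add[OF \<Omega> u v]])
qed

lemma AE_linear_on_id: "AE_linear_on \<Omega> (H1 \<Omega>) (\<lambda>u. u)"
  by (simp add: AE_linear_on_def H1_square_integrable(1) scaleR_fun_def)

lemma L2_norm_le_H1_norm: "L2_norm \<Omega> u \<le> H1_norm \<Omega> u" "L2_norm \<Omega> (weak_grad \<Omega> u) \<le> H1_norm \<Omega> u"
  unfolding H1_norm_def by (rule real_le_rsqrt, simp)+

lemma AE_linear_on_norm_add:
  assumes "AE_linear_on \<Omega> W D" "subspace W" "u \<in> W" "v \<in> W"
  shows "L2_norm \<Omega> (D (u + v)) \<le> L2_norm \<Omega> (D u) + L2_norm \<Omega> (D v)"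
proof -
  note sq = AE_linear_onD(1)[OF assms(1)]
  have "L2_norm \<Omega> (D (u + v)) = L2_norm \<Omega> (\<lambda>x. D u x + D v x)"
    by (rule L2_norm_cong_AE[OF AE_linear_onD(2)[OF assms(1,3,4)] sq[OF subspace_add[OF assms(2-4)]]
        square_integrable_add[OF sq[OF assms(3)] sq[OF assms(4)]]])
  then show ?thesis using L2_norm_triangle[OF sq[OF assms(3)] sq[OF assms(4)]] by simp
qed

lemma AE_linear_on_norm_scaleR:
  assumes "AE_linear_on \<Omega> W D" "subspace W" "u \<in> W"
  shows "L2_norm \<Omega> (D (c *\<^sub>R u)) = \<bar>c\<bar> * L2_norm \<Omega> (D u)"
proof -
  have "L2_norm \<Omega> (D (c *\<^sub>R u)) = L2_norm \<Omega> (\<lambda>x. c *\<^sub>R D u x)"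
    by (rule L2_norm_cong_AE[OF AE_linear_onD(3)[OF assms(1,3)]
        AE_linear_onD(1)[OF assms(1) subspace_mul[OF assms(2,3)]]
        square_integrable_scaleR[OF AE_linear_onD(1)[OF assms(1,3)]]])
  then show ?thesis by (simp add: L2_norm_scaleR)
qed

lemma H1_norm_triangle:
  assumes \<Omega>: "open \<Omega>" and uv: "u \<in> H1 \<Omega>" "v \<in> H1 \<Omega>"
  shows "H1_norm \<Omega> (u + v) \<le> H1_norm \<Omega> u + H1_norm \<Omega> v"
proof -
  have "L2_norm \<Omega> (u + v) \<le> L2_norm \<Omega> u + L2_norm \<Omega> v"
    by (rule AE_linear_on_norm_add[where D = "\<lambda>u. u", OF AE_linear_on_id subspace_H1[OF \<Omega>] uv])
  moreover have "L2_norm \<Omega> (weak_grad \<Omega> (u + v)) \<le> L2_norm \<Omega> (weak_grad \<Omega> u) + L2_norm \<Omega> (weak_grad \<Omega> v)"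
    by (rule AE_linear_on_norm_add[OF AE_linear_on_weak_grad[OF \<Omega>] subspace_H1[OF \<Omega>] uv])
  ultimately have "H1_norm \<Omega> (u + v) \<le> sqrt ((L2_norm \<Omega> u + L2_norm \<Omega> v)\<^sup>2
      + (L2_norm \<Omega> (weak_grad \<Omega> u) + L2_norm \<Omega> (weak_grad \<Omega> v))\<^sup>2)"
    unfolding H1_norm_def
    by (intro real_sqrt_le_mono add_mono power_mono L2_norm_nonneg)
  also have "\<dots> \<le> H1_norm \<Omega> u + H1_norm \<Omega> v"
    unfolding H1_norm_def by (rule real_sqrt_sum_squares_triangle_ineq)
  finally show ?thesis .
qed

lemma H1_norm_scaleR:
  assumes \<Omega>: "open \<Omega>" and u: "u \<in> H1 \<Omega>"
  shows "H1_norm \<Omega> (c *\<^sub>R u) = \<bar>c\<bar> * H1_norm \<Omega> u"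
proof -
  have "L2_norm \<Omega> (c *\<^sub>R u) = \<bar>c\<bar> * L2_norm \<Omega> u"
    by (rule AE_linear_on_norm_scaleR[where D = "\<lambda>u. u", OF AE_linear_on_id subspace_H1[OF \<Omega>] u])
  moreover have "L2_norm \<Omega> (weak_grad \<Omega> (c *\<^sub>R u)) = \<bar>c\<bar> * L2_norm \<Omega> (weak_grad \<Omega> u)"
    by (rule AE_linear_on_norm_scaleR[OF AE_linear_on_weak_grad[OF \<Omega>] subspace_H1[OF \<Omega>] u])
  ultimately have "(L2_norm \<Omega> (c *\<^sub>R u))\<^sup>2 + (L2_norm \<Omega> (weak_grad \<Omega> (c *\<^sub>R u)))\<^sup>2
      = c\<^sup>2 * ((L2_norm \<Omega> u)\<^sup>2 + (L2_norm \<Omega> (weak_grad \<Omega> u))\<^sup>2)"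
    by (simp add: power_mult_distrib distrib_left)
  then show ?thesis by (simp add: H1_norm_def real_sqrt_mult)
qed

section \<open>The space \<open>H1_0\<close> and the directional Poincare inequality\<close>

lemma test_functions_H1: "open \<Omega> \<Longrightarrow> \<phi> \<in> test_functions \<Omega> \<Longrightarrow> \<phi> \<in> H1 \<Omega>"
  using H1_I test_functions_square_integrable is_weak_grad_test_function by blast

lemma zero_test_function: "0 \<in> test_functions \<Omega>"
proof -
  have "pderiv_at i 0 = 0" for i :: 'a
    using pderiv_at_has_derivative[OF has_derivative_const[of "0::real"]]
    by (auto simp: fun_eq_iff zero_fun_def)
  then have "iter_pderiv is 0 = 0" for "is" :: "'a list" by (induction "is") auto
  then show ?thesis by (simp add: test_functions_def smooth_def zero_fun_def)
qed

lemma subspace_H1_0: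
  assumes \<Omega>: "open \<Omega>"
  shows "subspace (H1_0 \<Omega>)"
  unfolding subspace_def
proof (intro conjI ballI allI)
  note H1 = subspace_H1[OF \<Omega>]
  have "H1_norm \<Omega> 0 = 0" using H1_norm_scaleR[OF \<Omega> subspace_0[OF H1], of 0] by simp
  then show "0 \<in> H1_0 \<Omega>"
    unfolding H1_0_def using subspace_0[OF H1] zero_test_function by (auto intro!: exI[of _ "\<lambda>_. 0"])
  fix u assume "u \<in> H1_0 \<Omega>"
  then obtain \<phi> where u: "u \<in> H1 \<Omega>" and \<phi>: "\<And>n::nat. \<phi> n \<in> test_functions \<Omega>"
    and lim_u: "(\<lambda>n. H1_norm \<Omega> (\<phi> n - u)) \<longlonglongrightarrow> 0"
    by (auto simp: H1_0_def)
  have \<phi>u: "\<phi> n - u \<in> H1 \<Omega>" for n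
    using subspace_diff[OF H1 test_functions_H1[OF \<Omega> \<phi>] u] .
  show "c *\<^sub>R u \<in> H1_0 \<Omega>" for c
  proof -
    have "(\<lambda>n. H1_norm \<Omega> (c *\<^sub>R \<phi> n - c *\<^sub>R u)) = (\<lambda>n. \<bar>c\<bar> * H1_norm \<Omega> (\<phi> n - u))"
      using H1_norm_scaleR[OF \<Omega> \<phi>u, of c] by (simp add: scaleR_diff_right)
    then have "(\<lambda>n. H1_norm \<Omega> (c *\<^sub>R \<phi> n - c *\<^sub>R u)) \<longlonglongrightarrow> 0"
      using tendsto_mult_right_zero[OF lim_u] by simp
    then show ?thesis
      unfolding H1_0_def using subspace_mul[OF H1 u] test_functions_scaleR[OF \<phi>]
      by (auto intro!: exI[of _ "\<lambda>n. c *\<^sub>R \<phi> n"])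
  qed
  fix v assume "v \<in> H1_0 \<Omega>"
  then obtain \<psi> where v: "v \<in> H1 \<Omega>" and \<psi>: "\<And>n::nat. \<psi> n \<in> test_functions \<Omega>"
    and lim_v: "(\<lambda>n. H1_norm \<Omega> (\<psi> n - v)) \<longlonglongrightarrow> 0"
    by (auto simp: H1_0_def)
  have \<psi>v: "\<psi> n - v \<in> H1 \<Omega>" for n
    using subspace_diff[OF H1 test_functions_H1[OF \<Omega> \<psi>] v] .
  have "(\<lambda>n. H1_norm \<Omega> ((\<phi> n + \<psi> n) - (u + v))) \<longlonglongrightarrow> 0"
  proof (rule Lim_null_comparison)
    show "(\<lambda>n. H1_norm \<Omega> (\<phi> n - u) + H1_norm \<Omega> (\<psi> n - v)) \<longlonglongrightarrow> 0"
      using tendsto_add[OF lim_u lim_v] by simp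
    have "H1_norm \<Omega> ((\<phi> n + \<psi> n) - (u + v)) \<le> H1_norm \<Omega> (\<phi> n - u) + H1_norm \<Omega> (\<psi> n - v)" for n
      using H1_norm_triangle[OF \<Omega> \<phi>u \<psi>v, of n n] by (simp add: add_diff_add)
    then show "\<forall>\<^sub>F n in sequentially. norm (H1_norm \<Omega> ((\<phi> n + \<psi> n) - (u + v)))
        \<le> H1_norm \<Omega> (\<phi> n - u) + H1_norm \<Omega> (\<psi> n - v)"
      by (auto simp: H1_norm_def)
  qed
  then show "u + v \<in> H1_0 \<Omega>"
    unfolding H1_0_def using subspace_add[OF H1 u v] test_functions_add[OF \<phi> \<psi>]
    by (auto intro!: exI[of _ "\<lambda>n. \<phi> n + \<psi> n"])
qed

text \<open>Density: both sides depend continuously on \<open>u\<close> in the H1 norm. Only the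
  i-th partial derivative is kept on the right, since the strain controls directly only the diagonal
  of the Jacobian.\<close>

lemma Poincare_H1_0:
  fixes \<Omega> :: "(real^'n) set"
  assumes \<Omega>: "open \<Omega>" and R: "\<And>x. x \<in> \<Omega> \<Longrightarrow> norm x \<le> R" "R \<ge> 0" and u: "u \<in> H1_0 \<Omega>"
  shows "L2_norm \<Omega> u \<le> 2 * R * L2_norm \<Omega> (\<lambda>x. weak_grad \<Omega> u x $ i)"
proof -
  obtain \<phi> where uH: "u \<in> H1 \<Omega>" and \<phi>: "\<And>n::nat. \<phi> n \<in> test_functions \<Omega>"
    and lim: "(\<lambda>n. H1_norm \<Omega> (\<phi> n - u)) \<longlonglongrightarrow> 0"
    using u by (auto simp: H1_0_def)
  note H1 = subspace_H1[OF \<Omega>] and \<phi>H = test_functions_H1[OF \<Omega> \<phi>]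
  let ?g = "\<lambda>u x. weak_grad \<Omega> u x $ i"
  have lin: "AE_linear_on \<Omega> (H1 \<Omega>) ?g"
    by (rule AE_linear_on_bounded_linear[OF bounded_linear_vec_nth AE_linear_on_weak_grad[OF \<Omega>]])
  have "L2_norm \<Omega> u \<le> 2 * R * L2_norm \<Omega> (?g u) + (1 + 2 * R) * H1_norm \<Omega> (\<phi> n - u)" for n
  proof -
    \<comment> \<open>The approximation error enters once in the L2 norm of \<open>u\<close> and 2 R
      times through the derivative, whence the factor 1 + 2 R.\<close>
    define e where "e = \<phi> n - u"
    have e: "e \<in> H1 \<Omega>" unfolding e_def by (rule subspace_diff[OF H1 \<phi>H uH])
    have "L2_norm \<Omega> (\<phi> n + (-1) *\<^sub>R e) \<le> L2_norm \<Omega> (\<phi> n) + L2_norm \<Omega> ((-1) *\<^sub>R e)"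
      by (rule AE_linear_on_norm_add[where D = "\<lambda>u. u", OF AE_linear_on_id H1 \<phi>H subspace_mul[OF H1 e]])
    moreover have "L2_norm \<Omega> ((-1) *\<^sub>R e) = L2_norm \<Omega> e"
      using AE_linear_on_norm_scaleR[where D = "\<lambda>u. u", OF AE_linear_on_id H1 e, of "-1"] by simp
    moreover have "\<phi> n + (-1) *\<^sub>R e = u" by (simp add: e_def)
    ultimately have 1: "L2_norm \<Omega> u \<le> L2_norm \<Omega> (\<phi> n) + H1_norm \<Omega> e"
      using L2_norm_le_H1_norm(1)[of \<Omega> e] by simp
    have "L2_norm \<Omega> (pderiv_at i (\<phi> n)) = L2_norm \<Omega> (?g (\<phi> n))"
    proof (rule L2_norm_cong_AE)
      have "AE x in lebesgue_on \<Omega>. weak_grad \<Omega> (\<phi> n) x = (\<chi> i. pderiv_at i (\<phi> n) x)"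
        using test_functions_square_integrable[OF \<Omega> \<phi>] is_weak_grad_test_function[OF \<Omega> \<phi>]
        by (rule weak_grad_AE_eq[OF \<Omega>])
      then show "AE x in lebesgue_on \<Omega>. pderiv_at i (\<phi> n) x = ?g (\<phi> n) x"
        by eventually_elim simp
      show "square_integrable \<Omega> (pderiv_at i (\<phi> n))"
        by (rule test_functions_square_integrable[OF \<Omega> test_functions_pderiv[OF \<phi>]])
      show "square_integrable \<Omega> (?g (\<phi> n))" using lin \<phi>H by (simp add: AE_linear_on_def)
    qed
    also have "\<dots> = L2_norm \<Omega> (?g (u + e))" by (simp add: e_def)
    also have "\<dots> \<le> L2_norm \<Omega> (?g u) + L2_norm \<Omega> (?g e)"
      by (rule AE_linear_on_norm_add[OF lin H1 uH e])
    also have "L2_norm \<Omega> (?g e) \<le> L2_norm \<Omega> (weak_grad \<Omega> e)"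
      using lin e H1_square_integrable(2)[OF e] component_le_norm_cart
      by (intro L2_norm_mono) (auto simp: AE_linear_on_def)
    also have "\<dots> \<le> H1_norm \<Omega> e" by (rule L2_norm_le_H1_norm(2))
    finally have "2 * R * L2_norm \<Omega> (pderiv_at i (\<phi> n)) \<le> 2 * R * (L2_norm \<Omega> (?g u) + H1_norm \<Omega> e)"
      using R(2) by (intro mult_left_mono) auto
    with Poincare_test_function[OF \<Omega> R(1) \<phi>, of n i] 1
    show ?thesis unfolding e_def[symmetric] by (simp add: algebra_simps)
  qed
  moreover have "(\<lambda>n. 2 * R * L2_norm \<Omega> (?g u) + (1 + 2 * R) * H1_norm \<Omega> (\<phi> n - u))
      \<longlonglongrightarrow> 2 * R * L2_norm \<Omega> (?g u) + (1 + 2 * R) * 0"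
    by (intro tendsto_intros lim)
  ultimately show ?thesis by (intro LIMSEQ_le_const) auto
qed

section \<open>Vector fields\<close>

lemma vector_space_of_component: "u \<in> vector_space_of W \<Longrightarrow> (\<lambda>x. u x $ i) \<in> W"
  by (simp add: vector_space_of_def)

lemma component_plus_scaleR:
  fixes u v :: "'a \<Rightarrow> real^'n"
  shows "(\<lambda>x. (u + v) x $ i) = (\<lambda>x. u x $ i) + (\<lambda>x. v x $ i)"
    and "(\<lambda>x. (c *\<^sub>R u) x $ i) = c *\<^sub>R (\<lambda>x. u x $ i)"
  by (simp_all add: fun_eq_iff scaleR_fun_def)

lemma subspace_vector_space_of:
  assumes W: "subspace W"
  shows "subspace (vector_space_of W)"
  unfolding subspace_def
proof (intro conjI ballI allI)
  show "0 \<in> vector_space_of W"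
    using subspace_0[OF W] by (simp add: vector_space_of_def zero_fun_def)
  fix u assume u: "u \<in> vector_space_of W"
  show "c *\<^sub>R u \<in> vector_space_of W" for c
    unfolding vector_space_of_def mem_Collect_eq component_plus_scaleR
    using subspace_mul[OF W vector_space_of_component[OF u]] by blast
  fix v assume v: "v \<in> vector_space_of W"
  show "u + v \<in> vector_space_of W"
    unfolding vector_space_of_def mem_Collect_eq component_plus_scaleR
    using subspace_add[OF W vector_space_of_component[OF u] vector_space_of_component[OF v]] by blast
qed

lemma AE_linear_on_vec_lambda:
  fixes D :: "'m::finite \<Rightarrow> 'a::real_vector \<Rightarrow> real^'n \<Rightarrow> 'b::euclidean_space"
  assumes D: "\<And>i. AE_linear_on \<Omega> W (D i)"
  shows "AE_linear_on \<Omega> W (\<lambda>u x. \<chi> i. D i u x)"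
  unfolding AE_linear_on_def
proof (intro conjI ballI allI)
  fix u assume u: "u \<in> W"
  then show "square_integrable \<Omega> (\<lambda>x. \<chi> i. D i u x)"
    by (intro square_integrable_vec_lambda AE_linear_onD(1)[OF D])
  show "AE x in lebesgue_on \<Omega>. (\<chi> i. D i (c *\<^sub>R u) x) = c *\<^sub>R (\<chi> i. D i u x)" for c
  proof -
    have "AE x in lebesgue_on \<Omega>. \<forall>i. D i (c *\<^sub>R u) x = c *\<^sub>R D i u x"
      unfolding AE_all_countable using AE_linear_onD(3)[OF D u] by blast
    then show ?thesis by eventually_elim (simp add: vec_eq_iff)
  qed
  fix v assume v: "v \<in> W"
  have "AE x in lebesgue_on \<Omega>. \<forall>i. D i (u + v) x = D i u x + D i v x"
    unfolding AE_all_countable using AE_linear_onD(2)[OF D u v] by blast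
  then show "AE x in lebesgue_on \<Omega>. (\<chi> i. D i (u + v) x) = (\<chi> i. D i u x) + (\<chi> i. D i v x)"
    by eventually_elim (simp add: vec_eq_iff)
qed

lemma AE_linear_on_component:
  assumes D: "AE_linear_on \<Omega> W D"
  shows "AE_linear_on \<Omega> (vector_space_of W) (\<lambda>u. D (\<lambda>x. u x $ i))"
  unfolding AE_linear_on_def component_plus_scaleR
  using AE_linear_onD[OF D] vector_space_of_component by blast

lemma AE_linear_on_weak_jacobian:
  fixes \<Omega> :: "(real^'n) set"
  assumes "open \<Omega>"
  shows "AE_linear_on \<Omega> (vector_space_of (H1 \<Omega>)) (weak_jacobian \<Omega>)"
proof -
  have "weak_jacobian \<Omega> = (\<lambda>u x. \<chi> i. weak_grad \<Omega> (\<lambda>y. u y $ i) x)"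
    by (simp add: fun_eq_iff weak_jacobian_def)
  then show ?thesis
    using AE_linear_on_vec_lambda[OF AE_linear_on_component[OF AE_linear_on_weak_grad[OF assms]]]
    by simp
qed

section \<open>Divergence, strain and definiteness of the energy\<close>

lemma bounded_linear_trace: "bounded_linear (trace :: real^'n^'n \<Rightarrow> real)"
  unfolding linear_conv_bounded_linear[symmetric]
  by (rule linearI) (simp_all add: trace_def sum.distrib sum_distrib_left)

lemma bounded_linear_symmetric_part:
  "bounded_linear (\<lambda>A::real^'n^'n. (1/2) *\<^sub>R (A + transpose A))"
  unfolding linear_conv_bounded_linear[symmetric]
  by (rule linearI) (simp_all add: transpose_def vec_eq_iff algebra_simps)

lemma AE_linear_on_weak_div:
  assumes "open \<Omega>"
  shows "AE_linear_on \<Omega> (vector_space_of (H1 \<Omega>)) (weak_div \<Omega>)"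
proof -
  have "weak_div \<Omega> = (\<lambda>u x. trace (weak_jacobian \<Omega> u x))" by (simp add: fun_eq_iff weak_div_def)
  then show ?thesis
    using AE_linear_on_bounded_linear[OF bounded_linear_trace AE_linear_on_weak_jacobian[OF assms]] by simp
qed

lemma AE_linear_on_strain:
  assumes "open \<Omega>"
  shows "AE_linear_on \<Omega> (vector_space_of (H1 \<Omega>)) (strain \<Omega>)"
proof -
  have "strain \<Omega> = (\<lambda>u x. (1/2) *\<^sub>R (weak_jacobian \<Omega> u x + transpose (weak_jacobian \<Omega> u x)))"
    by (simp add: fun_eq_iff strain_def)
  then show ?thesis
    using AE_linear_on_bounded_linear[OF bounded_linear_symmetric_part AE_linear_on_weak_jacobian[OF assms]]
    by simp
qed

text \<open>Cauchy-Schwarz for the diagonal against the all-ones vector. Applied to the strain it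
  explains the term 2 \<mu> / d in \<zeta>^2.\<close>

lemma trace_square_le: "(trace A)\<^sup>2 \<le> real CARD('n) * (A \<bullet> A)" for A :: "real^'n^'n"
proof -
  have "(trace A)\<^sup>2 \<le> (\<Sum>i\<in>UNIV. (A $ i $ i)\<^sup>2) * (\<Sum>i\<in>(UNIV::'n set). 1\<^sup>2)"
    using Cauchy_Schwarz_ineq_sum[of "\<lambda>i. A $ i $ i" "\<lambda>_. 1" "UNIV::'n set"] by (simp add: trace_def)
  also have "(\<Sum>i\<in>UNIV. (A $ i $ i)\<^sup>2) \<le> A \<bullet> A"
  proof -
    have "(A $ i $ i)\<^sup>2 \<le> (\<Sum>j\<in>UNIV. A $ i $ j * A $ i $ j)" for i
      using member_le_sum[of i UNIV "\<lambda>j. A $ i $ j * A $ i $ j"] by (simp add: power2_eq_square)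
    then show ?thesis by (simp add: inner_vec_def sum_mono)
  qed
  finally show ?thesis by (simp add: mult.commute mult_right_mono)
qed

text \<open>Taking the symmetric part is an orthogonal projection for the Frobenius product.\<close>

lemma symmetric_part_inner_le:
  fixes A :: "real^'n^'n"
  shows "((1/2) *\<^sub>R (A + transpose A)) \<bullet> ((1/2) *\<^sub>R (A + transpose A)) \<le> A \<bullet> A"
proof -
  have "transpose A \<bullet> transpose A = A \<bullet> A"
    unfolding inner_vec_def transpose_def vec_lambda_beta by (rule sum.swap)
  moreover have "0 \<le> (A - transpose A) \<bullet> (A - transpose A)" by simp
  ultimately show ?thesis by (simp add: inner_add inner_diff inner_commute)
qed

lemma trace_symmetric_part: "trace ((1/2) *\<^sub>R (A + transpose A)) = trace A" for A :: "real^'n^'n"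
  by (simp add: trace_def transpose_def)

text \<open>No Korn inequality is needed: the diagonal of the strain consists of the derivatives
  \<open>\<partial>\<^sub>i u\<^sub>i\<close>, and the directional Poincare inequality bounds \<open>u\<^sub>i\<close> by \<open>\<partial>\<^sub>i u\<^sub>i\<close>.\<close>

lemma strain_eq_0_imp_component_eq_0:
  fixes \<Omega> :: "(real^'n) set"
  assumes \<Omega>: "open \<Omega>" "bounded \<Omega>" and u: "u \<in> vector_space_of (H1_0 \<Omega>)"
    and strain0: "L2_inner \<Omega> (strain \<Omega> u) (strain \<Omega> u) = 0"
  shows "L2_norm \<Omega> (\<lambda>x. u x $ i) = 0"
proof -
  have ui: "(\<lambda>x. u x $ i) \<in> H1_0 \<Omega>" using u by (rule vector_space_of_component)
  have uH: "u \<in> vector_space_of (H1 \<Omega>)" using u by (simp add: vector_space_of_def H1_0_def)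
  let ?d = "\<lambda>x. weak_grad \<Omega> (\<lambda>y. u y $ i) x $ i"
  have d: "square_integrable \<Omega> ?d"
    using uH by (intro square_integrable_component H1_square_integrable(2)) (rule vector_space_of_component)
  have "AE x in lebesgue_on \<Omega>. strain \<Omega> u x = 0"
    using AE_linear_onD(1)[OF AE_linear_on_strain[OF \<Omega>(1)] uH] strain0
    by (rule L2_inner_self_eq_0_imp_AE)
  then have "AE x in lebesgue_on \<Omega>. ?d x = 0"
  proof eventually_elim
    case (elim x)
    then have "strain \<Omega> u x $ i $ i = 0" by simp
    then show ?case by (simp add: strain_def weak_jacobian_def transpose_def)
  qed
  then have "L2_norm \<Omega> ?d = L2_norm \<Omega> (\<lambda>x. 0::real)" by (rule L2_norm_cong_AE[OF _ d]) simp
  then have d0: "L2_norm \<Omega> ?d = 0" by (simp add: L2_norm_def)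
  obtain R where "\<And>x. x \<in> \<Omega> \<Longrightarrow> norm x \<le> R" "R \<ge> 0"
    using \<Omega>(2) by (meson bounded_pos less_imp_le)
  from Poincare_H1_0[OF \<Omega>(1) this ui, of i] show ?thesis
    using L2_norm_nonneg[of \<Omega> "\<lambda>x. u x $ i"] d0 by simp
qed

text \<open>Passes from equality almost everywhere to equality of functions: the set where
  \<open>f\<close> is nonzero in \<Omega> is open and null, hence empty; continuity extends this to
  the closure, and the last assumption covers the remaining points.\<close>

lemma continuous_L2_norm_eq_0:
  fixes f :: "real^'n \<Rightarrow> real"
  assumes \<Omega>: "open \<Omega>" and cont: "continuous_on UNIV f" and f: "square_integrable \<Omega> f"
    and norm: "L2_norm \<Omega> f = 0" and outside: "\<And>x. x \<notin> closure \<Omega> \<Longrightarrow> f x = 0"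
  shows "f = 0"
proof -
  let ?U = "\<Omega> \<inter> {x. f x \<noteq> 0}"
  have "L2_inner \<Omega> f f = 0" using norm by (simp add: L2_norm_def)
  from L2_inner_self_eq_0_imp_AE[OF f this] have "AE x in lebesgue. x \<in> \<Omega> \<longrightarrow> f x = 0"
    using \<Omega> by (subst (asm) AE_restrict_space_iff) auto
  then have "AE x in lebesgue. x \<notin> ?U" by eventually_elim auto
  moreover have "open ?U"
    using \<Omega> cont by (intro open_Int open_Collect_neq) auto
  ultimately have "negligible ?U"
    by (simp add: negligible_iff_null_sets AE_iff_null_sets)
  then have "?U = {}" using \<open>open ?U\<close> open_not_negligible by blast
  then have "closure \<Omega> \<subseteq> {x. f x = 0}"
    by (intro closure_minimal closed_Collect_eq cont) auto
  then show ?thesis using outside by (auto simp: fun_eq_iff)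
qed

section \<open>Finite-element spaces\<close>

lemma sum_fun_apply: "(\<Sum>i\<in>A. f i) x = (\<Sum>i\<in>A. f i x)"
  by (induction A rule: infinite_finite_induct) auto

section \<open>Barycentric coordinates and bubble functions\<close>

lemma simplex_vertices:
  fixes S :: "(real^'n) set"
  assumes S: "int CARD('n) simplex S"
  shows "finite (vertices S)" "\<not> affine_dependent (vertices S)" "S = convex hull (vertices S)"
    "affine hull (vertices S) = UNIV"
proof -
  obtain C where C: "\<not> affine_dependent C" "int (card C) = int CARD('n) + 1" "S = convex hull C"
    using S by (auto simp: simplex_def)
  have "vertices S = C"
    using extreme_point_of_convex_hull_affine_independent[OF C(1)] by (auto simp: vertices_def C(3))
  then show "\<not> affine_dependent (vertices S)" "S = convex hull (vertices S)" "finite (vertices S)"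
    using C aff_independent_finite by auto
  have "aff_dim C = int DIM(real^'n)"
    using aff_dim_affine_independent[OF C(1)] C(2) by simp
  then show "affine hull (vertices S) = UNIV" using aff_dim_eq_full \<open>vertices S = C\<close> by blast
qed

lemma barycentric_sums:
  fixes S :: "(real^'n) set"
  assumes S: "int CARD('n) simplex S"
  shows "sum (barycentric S x) (vertices S) = 1" "(\<Sum>c\<in>vertices S. barycentric S x c *\<^sub>R c) = x"
proof -
  have "x \<in> affine hull (vertices S)" using simplex_vertices(4)[OF S] by simp
  then have "\<exists>w. sum w (vertices S) = 1 \<and> (\<Sum>c\<in>vertices S. w c *\<^sub>R c) = x"
    unfolding affine_hull_finite[OF simplex_vertices(1)[OF S]] by simp
  from someI_ex[OF this]
  show "sum (barycentric S x) (vertices S) = 1" "(\<Sum>c\<in>vertices S. barycentric S x c *\<^sub>R c) = x"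
    by (auto simp: barycentric_def)
qed

lemma barycentric_unique:
  fixes S :: "(real^'n) set"
  assumes S: "int CARD('n) simplex S"
    and w: "sum w (vertices S) = 1" "(\<Sum>c\<in>vertices S. w c *\<^sub>R c) = x" and c: "c \<in> vertices S"
  shows "barycentric S x c = w c"
proof (rule ccontr)
  let ?U = "\<lambda>c. barycentric S x c - w c"
  assume "barycentric S x c \<noteq> w c"
  then have "\<exists>v\<in>vertices S. ?U v \<noteq> 0" using c by force
  moreover have "sum ?U (vertices S) = 0"
    using barycentric_sums(1)[OF S] w(1) by (simp add: sum_subtractf)
  moreover have "(\<Sum>v\<in>vertices S. ?U v *\<^sub>R v) = 0"
    using barycentric_sums(2)[OF S] w(2) by (simp add: sum_subtractf scaleR_diff_left)
  ultimately show False
    using simplex_vertices(2)[OF S]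
    unfolding affine_dependent_explicit_finite[OF simplex_vertices(1)[OF S]] by blast
qed

lemma continuous_on_barycentric:
  fixes S :: "(real^'n) set"
  assumes S: "int CARD('n) simplex S" and c: "c \<in> vertices S"
  shows "continuous_on UNIV (\<lambda>x. barycentric S x c)"
proof -
  \<comment> \<open>Barycentric coordinates are affine in x, so subtracting the value at 0 leaves a
    linear map. By uniqueness it suffices to exhibit weights: x + y is the affine combination x + y
    - 0, and r x is r x + (1 - r) 0.\<close>
  let ?f = "\<lambda>x. barycentric S x c - barycentric S 0 c"
  note sums = barycentric_sums[OF S]
  have "linear ?f"
  proof (rule linearI)
    fix x y :: "real^'n" and r :: real
    have "barycentric S (x + y) c = barycentric S x c + barycentric S y c - barycentric S 0 c"
      by (rule barycentric_unique[OF S _ _ c])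
        (simp_all add: sum.distrib sum_subtractf scaleR_add_left scaleR_diff_left sums)
    then show "?f (x + y) = ?f x + ?f y" by simp
    have "barycentric S (r *\<^sub>R x) c = r * barycentric S x c + (1 - r) * barycentric S 0 c"
    proof (rule barycentric_unique[OF S _ _ c])
      show "(\<Sum>c\<in>vertices S. r * barycentric S x c + (1 - r) * barycentric S 0 c) = 1"
        by (simp add: sum.distrib sum_distrib_left[symmetric] sums)
      have "(\<Sum>c\<in>vertices S. (r * barycentric S x c + (1 - r) * barycentric S 0 c) *\<^sub>R c)
          = r *\<^sub>R (\<Sum>c\<in>vertices S. barycentric S x c *\<^sub>R c)
            + (1 - r) *\<^sub>R (\<Sum>c\<in>vertices S. barycentric S 0 c *\<^sub>R c)"
        by (simp add: scaleR_add_left sum.distrib scaleR_sum_right)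
      then show "(\<Sum>c\<in>vertices S. (r * barycentric S x c + (1 - r) * barycentric S 0 c) *\<^sub>R c) = r *\<^sub>R x"
        by (simp add: sums)
    qed
    then show "?f (r *\<^sub>R x) = r *\<^sub>R ?f x" by (simp add: algebra_simps)
  qed
  then have "continuous_on UNIV ?f" by (rule linear_continuous_on[OF linear_conv_bounded_linear[THEN iffD1]])
  then have "continuous_on UNIV (\<lambda>x. ?f x + barycentric S 0 c)"
    by (rule continuous_on_add[OF _ continuous_on_const])
  then show ?thesis by simp
qed

text \<open>Outside the simplex some coordinate is negative and its truncation kills the product.
  The case distinction disappears, and continuity across the faces becomes evident.\<close>

lemma bubble_eq:
  fixes S :: "(real^'n) set"
  assumes S: "int CARD('n) simplex S"
  shows "bubble S x = (\<Prod>c\<in>vertices S. max 0 (barycentric S x c))"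
proof -
  note V = simplex_vertices[OF S]
  have mem: "x \<in> S \<longleftrightarrow> (\<forall>c\<in>vertices S. 0 \<le> barycentric S x c)"
  proof
    assume "x \<in> S"
    then obtain w where w: "\<forall>c\<in>vertices S. 0 \<le> w c" "sum w (vertices S) = 1" "(\<Sum>c\<in>vertices S. w c *\<^sub>R c) = x"
      using V(3) unfolding convex_hull_finite[OF V(1)] by blast
    then show "\<forall>c\<in>vertices S. 0 \<le> barycentric S x c"
      using barycentric_unique[OF S w(2,3)] by simp
  next
    assume "\<forall>c\<in>vertices S. 0 \<le> barycentric S x c"
    then have "x \<in> convex hull (vertices S)"
      unfolding convex_hull_finite[OF V(1)] using barycentric_sums[OF S, of x] by blast
    then show "x \<in> S" using V(3) by simp
  qed
  show ?thesis
  proof (cases "x \<in> S")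
    case True
    then show ?thesis using mem by (auto simp: bubble_def intro!: prod.cong)
  next
    case False
    then obtain c where "c \<in> vertices S" "barycentric S x c < 0" using mem by (auto simp: not_le)
    then have "(\<Prod>c\<in>vertices S. max 0 (barycentric S x c)) = 0"
      using V(1) by (intro prod_zero bexI[of _ c]) auto
    then show ?thesis using False by (simp add: bubble_def)
  qed
qed

lemma continuous_on_bubble:
  fixes S :: "(real^'n) set"
  assumes S: "int CARD('n) simplex S"
  shows "continuous_on UNIV (bubble S)"
proof -
  have "continuous_on UNIV (\<lambda>x. \<Prod>c\<in>vertices S. max 0 (barycentric S x c))"
    by (intro continuous_on_prod continuous_on_max continuous_on_const continuous_on_barycentric[OF S])
  then show ?thesis using bubble_eq[OF S] by (simp add: fun_eq_iff[symmetric])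
qed

section \<open>The finite-element spaces as finite-dimensional subspaces\<close>

lemma P1_space_affine:
  assumes "u \<in> P1_space \<Omega> T" "S \<in> T"
  shows "\<exists>a b. \<forall>x\<in>S. u x = a \<bullet> x + b"
  using assms by (simp add: P1_space_def)

lemma subspace_P1_space:
  assumes \<Omega>: "open \<Omega>"
  shows "subspace (P1_space \<Omega> T)"
  unfolding subspace_def
proof (intro conjI ballI allI)
  note H = subspace_H1_0[OF \<Omega>]
  show "0 \<in> P1_space \<Omega> T"
    using subspace_0[OF H] by (auto simp: P1_space_def zero_fun_def intro!: exI[of _ 0])
  fix u assume u: "u \<in> P1_space \<Omega> T"
  show "c *\<^sub>R u \<in> P1_space \<Omega> T" for c
  proof -
    have "\<exists>a b. \<forall>x\<in>S. (c *\<^sub>R u) x = a \<bullet> x + b" if S: "S \<in> T" for S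
    proof -
      obtain a b where "\<forall>x\<in>S. u x = a \<bullet> x + b" using P1_space_affine[OF u S] by blast
      then have "\<forall>x\<in>S. (c *\<^sub>R u) x = (c *\<^sub>R a) \<bullet> x + c * b"
        by (simp add: scaleR_fun_def distrib_left)
      then show ?thesis by blast
    qed
    moreover have "continuous_on UNIV (c *\<^sub>R u)"
      using u unfolding scaleR_fun_def P1_space_def by (auto intro: continuous_intros)
    ultimately show ?thesis
      using u subspace_mul[OF H] by (simp add: P1_space_def scaleR_fun_def)
  qed
  fix v assume v: "v \<in> P1_space \<Omega> T"
  have "\<exists>a b. \<forall>x\<in>S. (u + v) x = a \<bullet> x + b" if S: "S \<in> T" for S
  proof -
    obtain a b where "\<forall>x\<in>S. u x = a \<bullet> x + b" using P1_space_affine[OF u S] by blast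
    moreover obtain a' b' where "\<forall>x\<in>S. v x = a' \<bullet> x + b'" using P1_space_affine[OF v S] by blast
    ultimately have "\<forall>x\<in>S. (u + v) x = (a + a') \<bullet> x + (b + b')" by (simp add: inner_add_left)
    then show ?thesis by blast
  qed
  moreover have "continuous_on UNIV (u + v)"
    using u v unfolding plus_fun_def P1_space_def by (auto intro: continuous_intros)
  ultimately show "u + v \<in> P1_space \<Omega> T"
    using u v subspace_add[OF H] by (simp add: P1_space_def)
qed

text \<open>The spanning functions are cut-off affine functions, discontinuous and in general
  outside the space. Inclusion in a finite span is all that the dimension count asks for, and it
  avoids constructing a nodal basis.\<close>

lemma P1_space_finite_span:
  fixes T :: "(real^'n) set set"
  assumes T: "finite T"
  shows "\<exists>F. finite F \<and> P1_space \<Omega> T \<subseteq> span F"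
proof -
  \<comment> \<open>Simplices share faces; \<open>\<tau>\<close> assigns each point to a single
    simplex, so that the local pieces add up without double counting.\<close>
  define \<tau> where "\<tau> x = (SOME S. S \<in> T \<and> x \<in> S)" for x
  define e1 where "e1 S = (\<lambda>x. if x \<in> \<Union>T \<and> \<tau> x = S then 1 else 0 :: real)" for S
  define ex where "ex p = (\<lambda>x. if x \<in> \<Union>T \<and> \<tau> x = fst p then x $ snd p else 0)" for p
  let ?F = "e1 ` T \<union> ex ` (T \<times> UNIV)"
  have "v \<in> span ?F" if v: "v \<in> P1_space \<Omega> T" for v
  proof -
    have "\<forall>S\<in>T. \<exists>a b. \<forall>x\<in>S. v x = a \<bullet> x + b" using v by (simp add: P1_space_def)
    then obtain a b where ab: "\<And>S x. S \<in> T \<Longrightarrow> x \<in> S \<Longrightarrow> v x = a S \<bullet> x + b S" by metis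
    have "v = (\<Sum>S\<in>T. (\<Sum>i\<in>UNIV. (a S $ i) *\<^sub>R ex (S, i)) + b S *\<^sub>R e1 S)"
    proof
      fix x
      show "v x = (\<Sum>S\<in>T. (\<Sum>i\<in>UNIV. (a S $ i) *\<^sub>R ex (S, i)) + b S *\<^sub>R e1 S) x"
      proof (cases "x \<in> \<Union>T")
        case True
        then have \<tau>: "\<tau> x \<in> T" "x \<in> \<tau> x" unfolding \<tau>_def by (metis (mono_tags, lifting) UnionE someI)+
        have "(\<Sum>S\<in>T. (\<Sum>i\<in>UNIV. (a S $ i) *\<^sub>R ex (S, i)) + b S *\<^sub>R e1 S) x
            = (\<Sum>S\<in>T. if S = \<tau> x then a S \<bullet> x + b S else 0)"
          unfolding sum_fun_apply using True
          by (intro sum.cong) (auto simp: sum_fun_apply scaleR_fun_def ex_def e1_def inner_vec_def)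
        also have "\<dots> = v x" using T \<tau> ab by simp
        finally show ?thesis by simp
      next
        case False
        then show ?thesis
          using v by (simp add: sum_fun_apply scaleR_fun_def ex_def e1_def P1_space_def)
      qed
    qed
    also have "\<dots> \<in> span ?F"
      by (intro span_sum span_add span_scale span_base) auto
    finally show ?thesis .
  qed
  then show ?thesis using T by (intro exI[of _ ?F]) auto
qed

lemma subspace_P1_bubble_space:
  assumes \<Omega>: "open \<Omega>"
  shows "subspace (P1_bubble_space \<Omega> T)"
  unfolding subspace_def
proof (intro conjI ballI allI)
  note H = subspace_H1_0[OF \<Omega>] and P = subspace_P1_space[OF \<Omega>]
  have I: "w \<in> P1_bubble_space \<Omega> T"
    if "w \<in> H1_0 \<Omega>" "v \<in> P1_space \<Omega> T" "w = v + (\<Sum>S\<in>T. c S *\<^sub>R bubble S)" for w v c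
    using that by (auto simp: P1_bubble_space_def)
  show "0 \<in> P1_bubble_space \<Omega> T"
    by (rule I[OF subspace_0[OF H] subspace_0[OF P], of "\<lambda>_. 0"]) simp
  fix u assume "u \<in> P1_bubble_space \<Omega> T"
  then obtain u' c where u: "u \<in> H1_0 \<Omega>" "u' \<in> P1_space \<Omega> T" "u = u' + (\<Sum>S\<in>T. c S *\<^sub>R bubble S)"
    by (auto simp: P1_bubble_space_def)
  show "r *\<^sub>R u \<in> P1_bubble_space \<Omega> T" for r
    by (rule I[OF subspace_mul[OF H u(1)] subspace_mul[OF P u(2)], of r r "\<lambda>S. r * c S"])
      (simp add: u(3) scaleR_add_right scaleR_sum_right)
  fix v assume "v \<in> P1_bubble_space \<Omega> T"
  then obtain v' d where v: "v \<in> H1_0 \<Omega>" "v' \<in> P1_space \<Omega> T" "v = v' + (\<Sum>S\<in>T. d S *\<^sub>R bubble S)"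
    by (auto simp: P1_bubble_space_def)
  show "u + v \<in> P1_bubble_space \<Omega> T"
    by (rule I[OF subspace_add[OF H u(1) v(1)] subspace_add[OF P u(2) v(2)], of "\<lambda>S. c S + d S"])
      (simp add: u(3) v(3) scaleR_add_left sum.distrib)
qed

lemma P1_bubble_space_finite_span:
  assumes T: "finite T"
  shows "\<exists>F. finite F \<and> P1_bubble_space \<Omega> T \<subseteq> span F"
proof -
  obtain F where F: "finite F" "P1_space \<Omega> T \<subseteq> span F" using P1_space_finite_span[OF T] by blast
  have "P1_bubble_space \<Omega> T \<subseteq> span (F \<union> bubble ` T)"
  proof
    fix w assume "w \<in> P1_bubble_space \<Omega> T"
    then obtain v c where "v \<in> span F" and w: "w = v + (\<Sum>S\<in>T. c S *\<^sub>R bubble S)"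
      using F(2) by (auto simp: P1_bubble_space_def)
    then have "v \<in> span (F \<union> bubble ` T)" using span_mono[of F "F \<union> bubble ` T"] by blast
    then show "w \<in> span (F \<union> bubble ` T)"
      unfolding w by (intro span_add span_sum span_scale) (auto intro: span_base)
  qed
  then show ?thesis using F(1) T by (intro exI[of _ "F \<union> bubble ` T"]) auto
qed

lemma P1_bubble_space_continuous:
  fixes T :: "(real^'n) set set"
  assumes T: "is_mesh \<Omega> h T" and w: "w \<in> P1_bubble_space \<Omega> T"
  shows "continuous_on UNIV w" "x \<notin> closure \<Omega> \<Longrightarrow> w x = 0"
proof -
  obtain v c where v: "v \<in> P1_space \<Omega> T" and w: "w = v + (\<Sum>S\<in>T. c S *\<^sub>R bubble S)"
    using w by (auto simp: P1_bubble_space_def)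
  have w_eq: "w = (\<lambda>x. v x + (\<Sum>S\<in>T. c S * bubble S x))"
    by (simp add: w fun_eq_iff sum_fun_apply scaleR_fun_def)
  have "continuous_on UNIV (bubble S)" if "S \<in> T" for S
    using T that by (intro continuous_on_bubble) (simp add: is_mesh_def)
  then show "continuous_on UNIV w"
    unfolding w_eq using v by (intro continuous_intros) (auto simp: P1_space_def)
  assume x: "x \<notin> closure \<Omega>"
  then have "bubble S x = 0" if "S \<in> T" for S
    using T that by (auto simp: is_mesh_def bubble_def)
  moreover have "v x = 0" using v x closure_subset[of \<Omega>] by (auto simp: P1_space_def)
  ultimately show "w x = 0" by (simp add: w_eq)
qed

lemma vector_space_of_finite_span:
  fixes W :: "(real^'n \<Rightarrow> real) set"
  assumes F: "finite F" "W \<subseteq> span F"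
  shows "\<exists>G. finite G \<and> vector_space_of W \<subseteq> span G"
proof -
  \<comment> \<open>\<open>E i\<close> embeds a scalar function as the i-th component of a vector
    field.\<close>
  define E :: "'n \<Rightarrow> (real^'n \<Rightarrow> real) \<Rightarrow> real^'n \<Rightarrow> real^'n" where "E i f = (\<lambda>x. axis i (f x))" for i f
  have lin: "linear (E i)" for i
    by (rule linearI) (auto simp: E_def fun_eq_iff axis_def vec_eq_iff scaleR_fun_def)
  let ?G = "\<Union>i. E i ` F"
  have "vector_space_of W \<subseteq> span ?G"
  proof
    fix u assume u: "u \<in> vector_space_of W"
    have "E i (\<lambda>x. u x $ i) \<in> span ?G" for i
    proof -
      have "(\<lambda>x. u x $ i) \<in> span F" using u F(2) by (auto simp: vector_space_of_def)
      then have "E i (\<lambda>x. u x $ i) \<in> span (E i ` F)" using linear_span_image[OF lin] by blast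
      moreover have "span (E i ` F) \<subseteq> span ?G" by (intro span_mono) auto
      ultimately show ?thesis by blast
    qed
    then have "(\<Sum>i\<in>UNIV. E i (\<lambda>x. u x $ i)) \<in> span ?G" by (intro span_sum)
    moreover have "(\<Sum>i\<in>UNIV. E i (\<lambda>x. u x $ i)) = u"
      by (simp add: fun_eq_iff sum_fun_apply E_def vec_eq_iff axis_def if_distrib cong: if_cong)
    ultimately show "u \<in> span ?G" by simp
  qed
  then show ?thesis using F(1) by (intro exI[of _ ?G]) auto
qed

section \<open>The discrete Biot operator\<close>

text \<open>A functional on the product is identified with its restrictions to the two factors, each
  extended by zero off its space to match \<open>dual\<close>.\<close>

definition (in stabilized_saddle_point) form_operator :: "'a \<times> 'b \<Rightarrow> ('a \<Rightarrow> real) \<times> ('b \<Rightarrow> real)"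
  where "form_operator x =
    (\<lambda>v. if v \<in> V then L x (v, 0) else 0, \<lambda>q. if q \<in> Q then L x (0, q) else 0)"

text \<open>Injectivity is the inf-sup bound applied to a difference, surjectivity is
  \<open>L_represents\<close>; the splitting of \<open>L\<close> over the two factors translates
  between pairs of functionals and functionals on the product.\<close>

lemma (in stabilized_saddle_point) isomorphism_on_form_operator:
  assumes fin: "V \<subseteq> span SV" "finite SV" "Q \<subseteq> span SQ" "finite SQ"
  shows "isomorphism_on (V \<times> Q) (dual V \<times> dual Q) form_operator"
proof -
  note L = bilinear_on_simps[OF bilinear_on_L]
  have VQ: "subspace (V \<times> Q)" using V Q by (rule subspace_Times)
  have emb: "(v, 0) \<in> V \<times> Q" "(0, q) \<in> V \<times> Q" if "v \<in> V" "q \<in> Q" for v q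
    using that V Q by (auto simp: subspace_0)
  have mem0: "0 \<in> V" "0 \<in> Q" using V Q by (auto simp: subspace_0)
  have split: "L x (v, q) = L x (v, 0) + L x (0, q)" if "x \<in> V \<times> Q" "v \<in> V" "q \<in> Q" for x v q
    using L(3)[OF that(1) emb(1)[OF that(2,3)] emb(2)[OF that(2,3)]] by simp
  have add: "form_operator (x + y) = form_operator x + form_operator y"
    if "x \<in> V \<times> Q" "y \<in> V \<times> Q" for x y
    using L(1)[OF that] mem0 by (auto simp: form_operator_def fun_eq_iff)
  have scale: "form_operator (c *\<^sub>R x) = c *\<^sub>R form_operator x" if "x \<in> V \<times> Q" for x c
    using L(2)[OF that] mem0 by (auto simp: form_operator_def fun_eq_iff scaleR_fun_def)
  have L_lin: "L x (v + v', 0) = L x (v, 0) + L x (v', 0)" "L x (c *\<^sub>R v, 0) = c * L x (v, 0)"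
    if "x \<in> V \<times> Q" "v \<in> V" "v' \<in> V" for x v v' c
    using L(3)[OF that(1), of "(v, 0)" "(v', 0)"] L(4)[OF that(1), of "(v, 0)" c] that mem0 by auto
  have L_lin': "L x (0, q + q') = L x (0, q) + L x (0, q')" "L x (0, c *\<^sub>R q) = c * L x (0, q)"
    if "x \<in> V \<times> Q" "q \<in> Q" "q' \<in> Q" for x q q' c
    using L(3)[OF that(1), of "(0, q)" "(0, q')"] L(4)[OF that(1), of "(0, q)" c] that mem0 by auto
  have range: "form_operator x \<in> dual V \<times> dual Q" if x: "x \<in> V \<times> Q" for x
    using L_lin[OF x] L_lin'[OF x] V Q
    by (simp add: form_operator_def dual_def linear_map_on_def subspace_add subspace_mul)
  have inj: "inj_on form_operator (V \<times> Q)"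
  proof (rule inj_onI)
    fix x y assume x: "x \<in> V \<times> Q" and y: "y \<in> V \<times> Q" and eq: "form_operator x = form_operator y"
    let ?z = "x + (-1) *\<^sub>R y"
    have y': "(-1) *\<^sub>R y \<in> V \<times> Q" and z: "?z \<in> V \<times> Q"
      by (rule subspace_mul[OF VQ y], rule subspace_add[OF VQ x subspace_mul[OF VQ y]])
    have "form_operator ?z = form_operator x + (-1) *\<^sub>R form_operator y"
      by (simp only: add[OF x y'] scale[OF y])
    then have 0: "form_operator ?z = 0" using eq by simp
    have "L ?z w = 0" if w: "w \<in> V \<times> Q" for w
    proof -
      have "fst (form_operator ?z) (fst w) = 0" "snd (form_operator ?z) (snd w) = 0"
        using 0 by simp_all
      then show ?thesis using split[OF z, of "fst w" "snd w"] w by (auto simp: form_operator_def)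
    qed
    then have "?z = 0"
      using inf_sup_L[OF z] divide_pos_pos[OF \<kappa>_pos, of "1 + \<theta>"] \<theta>_pos by fastforce
    then show "x = y" by simp
  qed
  have "dual V \<times> dual Q \<subseteq> form_operator ` (V \<times> Q)"
  proof
    fix \<phi> assume "\<phi> \<in> dual V \<times> dual Q"
    then obtain f g where \<phi>: "\<phi> = (f, g)" and f: "linear_map_on V f" "\<And>v. v \<notin> V \<Longrightarrow> f v = 0"
      and g: "linear_map_on Q g" "\<And>q. q \<notin> Q \<Longrightarrow> g q = 0"
      by (auto simp: dual_def)
    obtain x where x: "x \<in> V \<times> Q" and Lx: "\<And>v q. v \<in> V \<Longrightarrow> q \<in> Q \<Longrightarrow> L x (v, q) = f v + g q"
      using L_represents[OF fin f(1) g(1)] by blast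
    have "f (0 *\<^sub>R 0) = 0 *\<^sub>R f 0" "g (0 *\<^sub>R 0) = 0 *\<^sub>R g 0"
      using f(1) g(1) mem0 unfolding linear_map_on_def by blast+
    then have "f 0 = 0" "g 0 = 0" by simp_all
    then have "form_operator x = \<phi>"
      using Lx mem0 f(2) g(2) by (auto simp: form_operator_def \<phi> fun_eq_iff)
    then show "\<phi> \<in> form_operator ` (V \<times> Q)" using x by blast
  qed
  then have "bij_betw form_operator (V \<times> Q) (dual V \<times> dual Q)"
    unfolding bij_betw_def using inj range by blast
  then show ?thesis
    unfolding isomorphism_on_def linear_map_on_def using add scale by blast
qed

lemma isomorphism_on_cong:
  assumes W: "subspace W" and eq: "\<And>x. x \<in> W \<Longrightarrow> f x = g x" and g: "isomorphism_on W Z g"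
  shows "isomorphism_on W Z f"
  using g bij_betw_cong[of W f g Z, OF eq] subspace_add[OF W] subspace_mul[OF W]
  by (simp add: isomorphism_on_def linear_map_on_def eq)

section \<open>Energy estimates with explicit constants\<close>

lemma L2_inner_self_mono:
  fixes f :: "real^'n \<Rightarrow> 'b::euclidean_space" and g :: "real^'n \<Rightarrow> 'c::euclidean_space"
  assumes f: "square_integrable \<Omega> f" and g: "square_integrable \<Omega> g"
    and le: "\<And>x. f x \<bullet> f x \<le> c * (g x \<bullet> g x)"
  shows "L2_inner \<Omega> f f \<le> c * L2_inner \<Omega> g g"
proof -
  have "L2_inner \<Omega> f f \<le> (\<integral>x. c * (g x \<bullet> g x) \<partial>lebesgue_on \<Omega>)"
    unfolding L2_inner_def
    by (intro integral_mono integrable_mult_right square_integrable_inner f g le)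
  then show ?thesis by (simp add: L2_inner_def)
qed

lemma zeta_power2:
  assumes "lam \<ge> 0" "\<mu> > 0"
  shows "(zeta TYPE('n::finite) lam \<mu>)\<^sup>2 = lam + 2 * \<mu> / real CARD('n)" "zeta TYPE('n) lam \<mu> > 0"
  using assms by (auto simp: zeta_def intro!: add_nonneg_pos)

text \<open>The divergence is the trace of the strain, so (2 \<mu> / d) |div u|^2 is at most 2 \<mu>
  times the squared norm of the strain; adding \<lambda> |div u|^2 produces \<zeta>^2.\<close>

lemma div_le_elastic_form:
  fixes \<Omega> :: "(real^'n) set"
  assumes \<Omega>: "open \<Omega>" and u: "u \<in> vector_space_of (H1 \<Omega>)" and par: "lam \<ge> 0" "\<mu> > 0"
  shows "(zeta TYPE('n) lam \<mu>)\<^sup>2 * L2_inner \<Omega> (weak_div \<Omega> u) (weak_div \<Omega> u) \<le> elastic_form lam \<mu> \<Omega> u u"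
proof -
  let ?D = "L2_inner \<Omega> (weak_div \<Omega> u) (weak_div \<Omega> u)" and ?S = "L2_inner \<Omega> (strain \<Omega> u) (strain \<Omega> u)"
  have "weak_div \<Omega> u x \<bullet> weak_div \<Omega> u x \<le> real CARD('n) * (strain \<Omega> u x \<bullet> strain \<Omega> u x)" for x
    using trace_square_le[of "strain \<Omega> u x"] trace_symmetric_part[of "weak_jacobian \<Omega> u x"]
    by (simp add: strain_def weak_div_def power2_eq_square)
  then have "?D \<le> real CARD('n) * ?S"
    by (rule L2_inner_self_mono[OF AE_linear_onD(1)[OF AE_linear_on_weak_div[OF \<Omega>] u]
          AE_linear_onD(1)[OF AE_linear_on_strain[OF \<Omega>] u]])
  then have "2 * \<mu> / real CARD('n) * ?D \<le> 2 * \<mu> / real CARD('n) * (real CARD('n) * ?S)"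
    using par by (intro mult_left_mono) auto
  then show ?thesis by (simp add: zeta_power2[OF par] elastic_form_def distrib_right)
qed

text \<open>Strain and divergence are bounded by the Jacobian with squared constants 1 and d, and 2
  \<mu> + d \<lambda> = d \<zeta>^2.\<close>

lemma elastic_form_le:
  fixes \<Omega> :: "(real^'n) set"
  assumes \<Omega>: "open \<Omega>" and u: "u \<in> vector_space_of (H1 \<Omega>)" and par: "lam \<ge> 0" "\<mu> > 0"
  shows "elastic_form lam \<mu> \<Omega> u u \<le> real CARD('n) * (zeta TYPE('n) lam \<mu>)\<^sup>2 * (H1_norm_vec \<Omega> u)\<^sup>2"
proof -
  let ?D = "L2_inner \<Omega> (weak_div \<Omega> u) (weak_div \<Omega> u)" and ?S = "L2_inner \<Omega> (strain \<Omega> u) (strain \<Omega> u)"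
    and ?J = "L2_inner \<Omega> (weak_jacobian \<Omega> u) (weak_jacobian \<Omega> u)"
  note J = AE_linear_onD(1)[OF AE_linear_on_weak_jacobian[OF \<Omega>] u]
  have "?S \<le> 1 * ?J"
    by (rule L2_inner_self_mono[OF AE_linear_onD(1)[OF AE_linear_on_strain[OF \<Omega>] u] J])
      (use symmetric_part_inner_le in \<open>simp add: strain_def\<close>)
  then have S: "2 * \<mu> * ?S \<le> 2 * \<mu> * ?J" using par by simp
  have "?D \<le> real CARD('n) * ?J"
    by (rule L2_inner_self_mono[OF AE_linear_onD(1)[OF AE_linear_on_weak_div[OF \<Omega>] u] J])
      (use trace_square_le in \<open>simp add: weak_div_def power2_eq_square\<close>)
  then have D: "lam * ?D \<le> lam * (real CARD('n) * ?J)" using par by (intro mult_left_mono)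
  have "elastic_form lam \<mu> \<Omega> u u \<le> real CARD('n) * (zeta TYPE('n) lam \<mu>)\<^sup>2 * ?J"
    using S D by (simp add: elastic_form_def zeta_power2[OF par] algebra_simps)
  also have "?J \<le> (H1_norm_vec \<Omega> u)\<^sup>2" by (simp add: H1_norm_vec_def L2_norm_power2)
  then have "real CARD('n) * (zeta TYPE('n) lam \<mu>)\<^sup>2 * ?J
      \<le> real CARD('n) * (zeta TYPE('n) lam \<mu>)\<^sup>2 * (H1_norm_vec \<Omega> u)\<^sup>2"
    by (intro mult_left_mono) auto
  finally show ?thesis .
qed

lemma bilinear_on_cmult:
  assumes "bilinear_on V Q b"
  shows "bilinear_on V Q (\<lambda>u v. c * b u v)"
  using assms unfolding bilinear_on_def linear_map_on_def by (simp add: distrib_left mult.left_commute)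

lemma bilinear_on_add:
  assumes "bilinear_on V Q b" "bilinear_on V Q b'"
  shows "bilinear_on V Q (\<lambda>u v. b u v + b' u v)"
  using assms unfolding bilinear_on_def linear_map_on_def by (simp add: distrib_left)

lemma darcy_form_eq: "darcy_form K \<Omega> p q = K * grad_form \<Omega> p q"
  unfolding darcy_form_def grad_form_def by (rule L2_inner_scaleR_left)

lemma form_sym:
  "elastic_form lam \<mu> \<Omega> u v = elastic_form lam \<mu> \<Omega> v u" "grad_form \<Omega> p q = grad_form \<Omega> q p"
  by (simp_all add: elastic_form_def grad_form_def L2_inner_commute)

lemma bilinear_on_elastic_form:
  assumes \<Omega>: "open \<Omega>" and V: "subspace V" "V \<subseteq> vector_space_of (H1 \<Omega>)"
  shows "bilinear_on V V (elastic_form lam \<mu> \<Omega>)"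
  unfolding elastic_form_def[abs_def]
  by (intro bilinear_on_add bilinear_on_cmult bilinear_on_L2_inner V
      AE_linear_on_subset[OF AE_linear_on_strain[OF \<Omega>] V(2)]
      AE_linear_on_subset[OF AE_linear_on_weak_div[OF \<Omega>] V(2)])

lemma bilinear_on_div:
  assumes \<Omega>: "open \<Omega>" and V: "subspace V" "V \<subseteq> vector_space_of (H1 \<Omega>)"
    and Q: "subspace Q" "Q \<subseteq> H1 \<Omega>"
  shows "bilinear_on V Q (\<lambda>v p. L2_inner \<Omega> (weak_div \<Omega> v) p)"
  by (rule bilinear_on_L2_inner[OF V(1) AE_linear_on_subset[OF AE_linear_on_weak_div[OF \<Omega>] V(2)]
      Q(1) AE_linear_on_subset[OF AE_linear_on_id Q(2)]])

lemma bilinear_on_grad_form: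
  assumes \<Omega>: "open \<Omega>" and Q: "subspace Q" "Q \<subseteq> H1 \<Omega>"
  shows "bilinear_on Q Q (grad_form \<Omega>)"
  unfolding grad_form_def[abs_def]
  by (intro bilinear_on_L2_inner Q(1) AE_linear_on_subset[OF AE_linear_on_weak_grad[OF \<Omega>] Q(2)])

lemma bilinear_on_mass:
  assumes Q: "subspace Q" "Q \<subseteq> H1 \<Omega>"
  shows "bilinear_on Q Q (L2_inner \<Omega>)"
  using bilinear_on_L2_inner[OF Q(1) AE_linear_on_subset[OF AE_linear_on_id Q(2)]
      Q(1) AE_linear_on_subset[OF AE_linear_on_id Q(2)]] by simp

lemma bilinear_on_zero_right:
  assumes "bilinear_on V Q b" "v \<in> V" "q \<in> Q"
  shows "b v 0 = 0"
  using bilinear_on_simps(4)[OF assms, of 0] by simp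

text \<open>A fixed fraction of the inf-sup constant pays for the fact that the supremum need not be
  attained; the resulting \<open>v\<close> is rescaled so that its energy is at most that of \<open>p\<close>.\<close>

lemma weak_inf_sup_witness:
  fixes \<Omega> :: "(real^'n) set" and \<delta> \<gamma>B \<xi> :: real
  assumes \<Omega>: "open \<Omega>" and V: "subspace V" "V \<subseteq> vector_space_of (H1 \<Omega>)"
    and Q: "subspace Q" "Q \<subseteq> H1 \<Omega>" and p: "p \<in> Q"
    and par: "lam \<ge> 0" "\<mu> > 0" "\<alpha> > 0" "h > 0" "\<delta> > 0" and \<gamma>B: "\<gamma>B > 0" and \<xi>: "\<xi> \<ge> 0"
    and infsup: "weak_inf_sup \<Omega> h V Q \<gamma>B \<xi>"
  defines "\<zeta> \<equiv> zeta TYPE('n) lam \<mu>"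
  defines "m \<equiv> \<alpha>\<^sup>2 / \<zeta>\<^sup>2 * L2_inner \<Omega> p p"
    and "s \<equiv> \<delta> * (\<alpha>\<^sup>2 / \<zeta>\<^sup>2) * h\<^sup>2 * grad_form \<Omega> p p"
  shows "\<exists>w\<in>V. elastic_form lam \<mu> \<Omega> w w \<le> m \<and>
    \<gamma>B / (2 * sqrt CARD('n)) * m - \<xi> / sqrt (CARD('n) * \<delta>) * (sqrt s * sqrt m)
      \<le> \<alpha> * L2_inner \<Omega> (weak_div \<Omega> w) p"
proof -
  define d where "d = real CARD('n)"
  have d: "d > 0" by (simp add: d_def)
  have \<zeta>: "\<zeta> > 0" unfolding \<zeta>_def by (rule zeta_power2(2)[OF par(1,2)])
  define P where "P = \<alpha> / \<zeta> * L2_norm \<Omega> p"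
  define G where "G = L2_norm \<Omega> (weak_grad \<Omega> p)"
  define r where "r = \<gamma>B / 2 * L2_norm \<Omega> p - \<xi> * h * G"
  have P0: "P \<ge> 0" using par \<zeta> by (simp add: P_def)
  have mP: "m = P\<^sup>2" by (simp add: m_def P_def power_mult_distrib power_divide L2_norm_power2)
  have "s = (sqrt \<delta> * (\<alpha> / \<zeta>) * h * G)\<^sup>2"
    using par by (simp add: s_def G_def power_mult_distrib power_divide L2_norm_power2 grad_form_def)
  then have sG: "sqrt s = sqrt \<delta> * (\<alpha> / \<zeta>) * h * G"
    using par \<zeta> by (simp add: G_def)
  \<comment> \<open>\<open>sqrt s\<close> and \<open>sqrt m\<close> share the weight \<alpha> /
    \<zeta>, and sqrt \<delta> cancels; what remains is the weak inf-sup bound with half of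
    \<open>\<gamma>B\<close>, rescaled.\<close>
  have "\<gamma>B / (2 * sqrt d) * m - \<xi> / sqrt (d * \<delta>) * (sqrt s * sqrt m)
      = P * (\<gamma>B / (2 * sqrt d) * P - \<xi> / (sqrt d * sqrt \<delta>) * (sqrt \<delta> * (\<alpha> / \<zeta>) * h * G))"
    using P0 unfolding sG mP by (simp add: real_sqrt_mult power2_eq_square algebra_simps)
  also have "\<dots> = P * (\<alpha> / (\<zeta> * sqrt d) * r)"
    using d \<zeta> par by (simp add: P_def r_def field_simps)
  finally have lhs: "\<gamma>B / (2 * sqrt d) * m - \<xi> / sqrt (d * \<delta>) * (sqrt s * sqrt m)
      = P * (\<alpha> / (\<zeta> * sqrt d) * r)" .
  note el = bilinear_on_elastic_form[OF \<Omega> V, of lam \<mu>] and dv = bilinear_on_div[OF \<Omega> V Q]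
  have "\<exists>w\<in>V. elastic_form lam \<mu> \<Omega> w w \<le> P\<^sup>2 \<and>
      P * (\<alpha> / (\<zeta> * sqrt d) * r) \<le> \<alpha> * L2_inner \<Omega> (weak_div \<Omega> w) p"
  \<comment> \<open>In these cases the lower bound is not positive and w = 0 serves.\<close>
  proof (cases "L2_norm \<Omega> p = 0 \<or> r \<le> 0")
    case True
    have "P * (\<alpha> / (\<zeta> * sqrt d) * r) \<le> 0"
    proof (cases "L2_norm \<Omega> p = 0")
      case False
      then have "\<alpha> / (\<zeta> * sqrt d) * r \<le> 0"
        using True par \<zeta> d by (intro mult_nonneg_nonpos) auto
      then show ?thesis using P0 by (rule mult_nonneg_nonpos[rotated])
    qed (simp add: P_def)
    moreover have "elastic_form lam \<mu> \<Omega> 0 0 = 0" "L2_inner \<Omega> (weak_div \<Omega> 0) p = 0"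
      using bilinear_on_zero_left[OF el subspace_0[OF V(1)] subspace_0[OF V(1)]]
        bilinear_on_zero_left[OF dv subspace_0[OF V(1)] p] by simp_all
    ultimately show ?thesis using subspace_0[OF V(1)] by (intro bexI[of _ 0]) auto
  next
    case False
    then have p_pos: "L2_norm \<Omega> p > 0" and r: "r > 0"
      using L2_norm_nonneg[of \<Omega> p] by linarith+
    have "ereal r < ereal (\<gamma>B * L2_norm \<Omega> p - \<xi> * h * G)"
      using p_pos \<gamma>B by (simp add: r_def)
    also have "\<dots> \<le> (SUP v\<in>V - {0}. ereal (L2_inner \<Omega> (weak_div \<Omega> v) p / H1_norm_vec \<Omega> v))"
      using infsup p by (simp add: weak_inf_sup_def G_def)
    finally obtain v where v: "v \<in> V" and "ereal r < ereal (L2_inner \<Omega> (weak_div \<Omega> v) p / H1_norm_vec \<Omega> v)"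
      unfolding less_SUP_iff by blast
    then have rv: "r < L2_inner \<Omega> (weak_div \<Omega> v) p / H1_norm_vec \<Omega> v" by simp
    define N where "N = H1_norm_vec \<Omega> v"
    \<comment> \<open>Division by zero has the value 0, which is excluded because the quotient
      exceeds r > 0.\<close>
    have "N \<noteq> 0" using rv r by (auto simp: N_def)
    moreover have "N \<ge> 0" by (simp add: N_def H1_norm_vec_def)
    ultimately have N: "N > 0" by simp
    have rN: "r * N \<le> L2_inner \<Omega> (weak_div \<Omega> v) p"
      using rv N by (simp add: N_def pos_less_divide_eq)
    \<comment> \<open>Scaled so that the energy bound sqrt d \<zeta> N of \<open>v\<close> becomes
      exactly \<open>P\<close>, the mass norm of \<open>p\<close>.\<close>
    define c where "c = P / (sqrt d * \<zeta> * N)"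
    have c0: "c \<ge> 0" using P0 d \<zeta> N by (simp add: c_def)
    have cP: "c * (sqrt d * \<zeta> * N) = P" using d \<zeta> N by (simp add: c_def)
    have cv: "c *\<^sub>R v \<in> V" by (rule subspace_mul[OF V(1) v])
    have "elastic_form lam \<mu> \<Omega> (c *\<^sub>R v) (c *\<^sub>R v) = c\<^sup>2 * elastic_form lam \<mu> \<Omega> v v"
      using v cv by (simp add: bilinear_on_simps[OF el] power2_eq_square)
    also have "\<dots> \<le> c\<^sup>2 * (d * \<zeta>\<^sup>2 * N\<^sup>2)"
      unfolding d_def \<zeta>_def N_def using v V(2) par
      by (intro mult_left_mono elastic_form_le \<Omega>) auto
    also have "\<dots> = (c * (sqrt d * \<zeta> * N))\<^sup>2" using d by (simp add: power_mult_distrib)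
    finally have "elastic_form lam \<mu> \<Omega> (c *\<^sub>R v) (c *\<^sub>R v) \<le> P\<^sup>2" unfolding cP .
    moreover have "P * (\<alpha> / (\<zeta> * sqrt d) * r) \<le> \<alpha> * L2_inner \<Omega> (weak_div \<Omega> (c *\<^sub>R v)) p"
    proof -
      have "P * (\<alpha> / (\<zeta> * sqrt d) * r) = \<alpha> * (c * (r * N))"
        using d \<zeta> N by (simp add: c_def mult_ac)
      also have "\<dots> \<le> \<alpha> * (c * L2_inner \<Omega> (weak_div \<Omega> v) p)"
        using rN c0 par by (intro mult_left_mono) auto
      finally show ?thesis using bilinear_on_simps(2)[OF dv v p] by simp
    qed
    ultimately show ?thesis using cv by blast
  qed
  then show ?thesis unfolding lhs[unfolded d_def] mP[symmetric] d_def .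
qed

text \<open>Treats both pairs at once: the displacement space consists of vector fields with
  components in a scalar space \<open>W\<close>, and the P1 space is the case of vanishing bubble
  coefficients.\<close>

lemma finite_element_pair:
  assumes \<Omega>: "open \<Omega>" and pair: "P1_P1_pair \<Omega> T V Q \<or> Mini_pair \<Omega> T V Q"
  obtains W where "subspace W" "W \<subseteq> P1_bubble_space \<Omega> T" "V = vector_space_of W" "Q = P1_space \<Omega> T"
proof -
  have "P1_space \<Omega> T \<subseteq> P1_bubble_space \<Omega> T"
  proof
    fix v assume v: "v \<in> P1_space \<Omega> T"
    then have "v \<in> H1_0 \<Omega>" by (simp add: P1_space_def)
    then show "v \<in> P1_bubble_space \<Omega> T"
      unfolding P1_bubble_space_def by (intro CollectI conjI bexI[OF _ v] exI[of _ "\<lambda>_. 0"]) simp_all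
  qed
  then show thesis
    using pair that[OF subspace_P1_space[OF \<Omega>]] that[OF subspace_P1_bubble_space[OF \<Omega>]]
    unfolding P1_P1_pair_def Mini_pair_def by blast
qed

text \<open>The physics enters here: definiteness, the bound on \<open>b\<close> and the inf-sup
  witness are the assumptions with analytic content, while the others are bilinearity, symmetry and
  signs.\<close>

lemma stabilized_saddle_point_Biot:
  fixes \<Omega> :: "(real^'n) set" and \<delta> \<gamma>B \<xi> :: real
  assumes \<Omega>: "open \<Omega>" "bounded \<Omega>" and par: "lam \<ge> 0" "\<mu> > 0" "\<alpha> > 0" "K > 0" "h > 0" "\<tau> > 0"
    and T: "is_mesh \<Omega> h T" and pair: "P1_P1_pair \<Omega> T V Q \<or> Mini_pair \<Omega> T V Q"
    and infsup: "weak_inf_sup \<Omega> h V Q \<gamma>B \<xi>" and \<delta>: "\<delta> > 0" "\<gamma>B > 0" "\<xi> \<ge> 0"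
  defines "\<rho> \<equiv> \<alpha>\<^sup>2 / (zeta TYPE('n) lam \<mu>)\<^sup>2"
  shows "stabilized_saddle_point V Q (elastic_form lam \<mu> \<Omega>)
    (\<lambda>v p. \<alpha> * L2_inner \<Omega> (weak_div \<Omega> v) p) (\<lambda>p q. \<tau> * darcy_form K \<Omega> p q)
    (\<lambda>p q. \<delta> * \<rho> * h\<^sup>2 * grad_form \<Omega> p q) (\<lambda>p q. \<rho> * L2_inner \<Omega> p q)
    (\<gamma>B / (2 * sqrt CARD('n))) (\<xi> / sqrt (CARD('n) * \<delta>))"
proof -
  obtain W where W: "subspace W" "W \<subseteq> P1_bubble_space \<Omega> T" and VW: "V = vector_space_of W"
    and Qeq: "Q = P1_space \<Omega> T"
    using finite_element_pair[OF \<Omega>(1) pair] by metis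
  have W0: "W \<subseteq> H1_0 \<Omega>" using W(2) by (auto simp: P1_bubble_space_def)
  have V: "subspace V" unfolding VW by (rule subspace_vector_space_of[OF W(1)])
  have V0: "V \<subseteq> vector_space_of (H1_0 \<Omega>)" using W0 by (auto simp: VW vector_space_of_def)
  have V1: "V \<subseteq> vector_space_of (H1 \<Omega>)" using V0 by (auto simp: vector_space_of_def H1_0_def)
  have Q: "subspace Q" "Q \<subseteq> H1 \<Omega>"
    unfolding Qeq using subspace_P1_space[OF \<Omega>(1)] by (auto simp: P1_space_def H1_0_def)
  define \<zeta> where "\<zeta> = zeta TYPE('n) lam \<mu>"
  have \<zeta>: "\<zeta> > 0" unfolding \<zeta>_def by (rule zeta_power2(2)[OF par(1,2)])
  have \<rho>: "\<rho> = (\<alpha> / \<zeta>)\<^sup>2" "\<rho> > 0" using par \<zeta> by (simp_all add: \<rho>_def \<zeta>_def power_divide)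
  show ?thesis
  proof
    show "subspace V" "subspace Q" by fact+
    show "bilinear_on V V (elastic_form lam \<mu> \<Omega>)" by (rule bilinear_on_elastic_form[OF \<Omega>(1) V V1])
    show "bilinear_on V Q (\<lambda>v p. \<alpha> * L2_inner \<Omega> (weak_div \<Omega> v) p)"
      by (rule bilinear_on_cmult[OF bilinear_on_div[OF \<Omega>(1) V V1 Q]])
    show "bilinear_on Q Q (\<lambda>p q. \<tau> * darcy_form K \<Omega> p q)"
      unfolding darcy_form_eq by (intro bilinear_on_cmult bilinear_on_grad_form \<Omega> Q)
    show "bilinear_on Q Q (\<lambda>p q. \<delta> * \<rho> * h\<^sup>2 * grad_form \<Omega> p q)"
      by (intro bilinear_on_cmult bilinear_on_grad_form \<Omega> Q)
    show "bilinear_on Q Q (\<lambda>p q. \<rho> * L2_inner \<Omega> p q)"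
      by (rule bilinear_on_cmult[OF bilinear_on_mass[OF Q]])
    show "elastic_form lam \<mu> \<Omega> u v = elastic_form lam \<mu> \<Omega> v u" for u v by (rule form_sym)
    show "\<tau> * darcy_form K \<Omega> p q = \<tau> * darcy_form K \<Omega> q p"
      "\<delta> * \<rho> * h\<^sup>2 * grad_form \<Omega> p q = \<delta> * \<rho> * h\<^sup>2 * grad_form \<Omega> q p"
      "\<rho> * L2_inner \<Omega> p q = \<rho> * L2_inner \<Omega> q p" for p q
      by (simp_all add: darcy_form_eq form_sym(2)[of _ p q] L2_inner_commute[of _ p q])
    show "0 \<le> elastic_form lam \<mu> \<Omega> u u" for u using par by (simp add: elastic_form_def)
    show "0 \<le> \<tau> * darcy_form K \<Omega> p p" "0 \<le> \<delta> * \<rho> * h\<^sup>2 * grad_form \<Omega> p p"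
      "0 \<le> \<rho> * L2_inner \<Omega> p p" for p
      using par \<delta> \<rho>(2) by (simp_all add: darcy_form_eq grad_form_def)
    show "u = 0" if u: "u \<in> V" and 0: "elastic_form lam \<mu> \<Omega> u u = 0" for u
    proof -
      have "L2_inner \<Omega> (strain \<Omega> u) (strain \<Omega> u) = 0"
        using 0 par by (simp add: elastic_form_def add_nonneg_eq_0_iff)
      then have norm: "L2_norm \<Omega> (\<lambda>x. u x $ i) = 0" for i
        using strain_eq_0_imp_component_eq_0[OF \<Omega>] u V0 by blast
      have "(\<lambda>x. u x $ i) = 0" for i
      proof (rule continuous_L2_norm_eq_0[OF \<Omega>(1) _ _ norm])
        have ui: "(\<lambda>x. u x $ i) \<in> W" using u unfolding VW by (rule vector_space_of_component)
        then have uB: "(\<lambda>x. u x $ i) \<in> P1_bubble_space \<Omega> T" using W(2) by blast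
        show "continuous_on UNIV (\<lambda>x. u x $ i)" by (rule P1_bubble_space_continuous(1)[OF T uB])
        show "u x $ i = 0" if "x \<notin> closure \<Omega>" for x
          by (rule P1_bubble_space_continuous(2)[OF T uB that])
        show "square_integrable \<Omega> (\<lambda>x. u x $ i)"
          using ui W0 by (intro H1_square_integrable(1)) (auto simp: H1_0_def)
      qed
      then have "u x $ i = 0" for x i by (metis zero_fun_apply)
      then show ?thesis by (simp add: fun_eq_iff vec_eq_iff)
    qed
    show "p = 0" if p: "p \<in> Q" and 0: "\<rho> * L2_inner \<Omega> p p = 0" for p
    proof (rule continuous_L2_norm_eq_0[OF \<Omega>(1)])
      show "continuous_on UNIV p" "square_integrable \<Omega> p" "L2_norm \<Omega> p = 0"
        using p Q(2) 0 \<rho>(2) by (auto simp: Qeq P1_space_def L2_norm_def intro: H1_square_integrable)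
      show "p x = 0" if "x \<notin> closure \<Omega>" for x
        using p that closure_subset[of \<Omega>] by (auto simp: Qeq P1_space_def)
    qed
    show "\<bar>\<alpha> * L2_inner \<Omega> (weak_div \<Omega> v) p\<bar>
        \<le> sqrt (elastic_form lam \<mu> \<Omega> v v) * sqrt (\<rho> * L2_inner \<Omega> p p)" if v: "v \<in> V" and p: "p \<in> Q" for v p
    proof -
      have div: "square_integrable \<Omega> (weak_div \<Omega> v)" and psq: "square_integrable \<Omega> p"
        using AE_linear_onD(1)[OF AE_linear_on_weak_div[OF \<Omega>(1)]] v V1 p Q(2)
        by (auto intro: H1_square_integrable)
      have "\<zeta> * L2_norm \<Omega> (weak_div \<Omega> v) \<le> sqrt (elastic_form lam \<mu> \<Omega> v v)"
        using div_le_elastic_form[OF \<Omega>(1) _ par(1,2)] v V1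
        by (intro real_le_rsqrt) (auto simp: \<zeta>_def power_mult_distrib L2_norm_power2)
      moreover have "sqrt (\<rho> * L2_inner \<Omega> p p) = \<alpha> / \<zeta> * L2_norm \<Omega> p"
        using par \<zeta> unfolding \<rho>(1) by (simp add: real_sqrt_mult L2_norm_def)
      \<comment> \<open>\<zeta> is inserted and divided out again, so that each factor becomes a
        norm of the problem.\<close>
      moreover have "\<bar>\<alpha> * L2_inner \<Omega> (weak_div \<Omega> v) p\<bar>
          \<le> (\<zeta> * L2_norm \<Omega> (weak_div \<Omega> v)) * (\<alpha> / \<zeta> * L2_norm \<Omega> p)"
        using L2_Cauchy_Schwarz[OF div psq] par \<zeta> by (simp add: abs_mult)
      moreover have "0 \<le> \<alpha> / \<zeta> * L2_norm \<Omega> p" using par \<zeta> by simp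
      ultimately show ?thesis by (metis mult_right_mono order_trans)
    qed
    show "\<exists>w\<in>V. elastic_form lam \<mu> \<Omega> w w \<le> \<rho> * L2_inner \<Omega> p p \<and>
        \<gamma>B / (2 * sqrt CARD('n)) * (\<rho> * L2_inner \<Omega> p p)
          - \<xi> / sqrt (CARD('n) * \<delta>) * (sqrt (\<delta> * \<rho> * h\<^sup>2 * grad_form \<Omega> p p) * sqrt (\<rho> * L2_inner \<Omega> p p))
        \<le> \<alpha> * L2_inner \<Omega> (weak_div \<Omega> w) p" if "p \<in> Q" for p
      unfolding \<rho>_def
      by (rule weak_inf_sup_witness[OF \<Omega>(1) V V1 Q that par(1-3,5) \<delta>(1-3) infsup])
    show "\<gamma>B / (2 * sqrt CARD('n)) > 0" using \<delta> by simp
  qed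
qed

lemma finite_element_pair_finite_span:
  assumes \<Omega>: "open \<Omega>" and T: "is_mesh \<Omega> h T" and pair: "P1_P1_pair \<Omega> T V Q \<or> Mini_pair \<Omega> T V Q"
  obtains SV SQ where "V \<subseteq> span SV" "finite SV" "Q \<subseteq> span SQ" "finite SQ"
proof -
  obtain W where W: "W \<subseteq> P1_bubble_space \<Omega> T" "V = vector_space_of W" "Q = P1_space \<Omega> T"
    using finite_element_pair[OF \<Omega> pair] by metis
  have finT: "finite T" using T by (simp add: is_mesh_def triangulation_def)
  obtain F where "finite F" "P1_bubble_space \<Omega> T \<subseteq> span F"
    using P1_bubble_space_finite_span[OF finT] by blast
  then have "\<exists>G. finite G \<and> V \<subseteq> span G"
    unfolding W(2) using W(1) by (intro vector_space_of_finite_span) auto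
  then show thesis using that P1_space_finite_span[OF finT] W(3) by blast
qed

lemma Biot_well_posed:
  fixes \<Omega> :: "(real^'n) set" and \<delta> \<gamma>B \<xi> :: real
  assumes \<Omega>: "open \<Omega>" "bounded \<Omega>" and par: "lam \<ge> 0" "\<mu> > 0" "\<alpha> > 0" "K > 0" "h > 0" "\<tau> > 0"
    and T: "is_mesh \<Omega> h T" and pair: "P1_P1_pair \<Omega> T V Q \<or> Mini_pair \<Omega> T V Q"
    and infsup: "weak_inf_sup \<Omega> h V Q \<gamma>B \<xi>" and \<delta>: "\<delta> > 0" "\<gamma>B > 0" "\<xi> \<ge> 0"
    and \<eta>: "\<eta> = \<delta> * (\<alpha>\<^sup>2 / (zeta TYPE('n) lam \<mu>)\<^sup>2)"
  defines "c1 \<equiv> \<gamma>B / (2 * sqrt CARD('n))" and "c2 \<equiv> \<xi> / sqrt (CARD('n) * \<delta>)"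
  shows "\<forall>x\<in>V \<times> Q. \<forall>y\<in>V \<times> Q.
      \<bar>Biot_form lam \<mu> \<alpha> K h \<tau> \<eta> \<Omega> V Q x y\<bar>
        \<le> 5 * X_norm lam \<mu> \<alpha> K h \<tau> \<eta> \<Omega> x * X_norm lam \<mu> \<alpha> K h \<tau> \<eta> \<Omega> y" (is ?bounded)
    and "(INF x\<in>V \<times> Q - {0}. SUP y\<in>V \<times> Q - {0}.
        ereal (Biot_form lam \<mu> \<alpha> K h \<tau> \<eta> \<Omega> V Q x y
          / (X_norm lam \<mu> \<alpha> K h \<tau> \<eta> \<Omega> x * X_norm lam \<mu> \<alpha> K h \<tau> \<eta> \<Omega> y)))
      \<ge> ereal (min (1/2) (c1\<^sup>2 / (2 * (1 + c2\<^sup>2))) / (1 + c1 / (1 + c2\<^sup>2)))" (is ?stable)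
    and "isomorphism_on (V \<times> Q) (dual V \<times> dual Q) (Biot_op lam \<mu> \<alpha> K h \<tau> \<eta> \<Omega> V Q)" (is ?iso)
proof -
  interpret S: stabilized_saddle_point V Q "elastic_form lam \<mu> \<Omega>"
    "\<lambda>v p. \<alpha> * L2_inner \<Omega> (weak_div \<Omega> v) p" "\<lambda>p q. \<tau> * darcy_form K \<Omega> p q"
    "\<lambda>p q. \<delta> * (\<alpha>\<^sup>2 / (zeta TYPE('n) lam \<mu>)\<^sup>2) * h\<^sup>2 * grad_form \<Omega> p q"
    "\<lambda>p q. \<alpha>\<^sup>2 / (zeta TYPE('n) lam \<mu>)\<^sup>2 * L2_inner \<Omega> p q" c1 c2
    unfolding c1_def c2_def
    by (rule stabilized_saddle_point_Biot[OF \<Omega> par T pair infsup \<delta>])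
  have form: "Biot_form lam \<mu> \<alpha> K h \<tau> \<eta> \<Omega> V Q x y = S.L x y" if "x \<in> V \<times> Q" "y \<in> V \<times> Q" for x y
    using that unfolding S.L_def
    unfolding Biot_form_def A_u_def B_op_def form_op_def darcy_form_def grad_form_def \<eta>
    by auto
  have norm: "X_norm lam \<mu> \<alpha> K h \<tau> \<eta> \<Omega> x = S.N x" for x
    unfolding S.N_def unfolding X_norm_def L2_norm_power2 \<eta> by (simp split: prod.split)
  have mem0: "0 \<in> V" "0 \<in> Q" using S.V S.Q by (simp_all add: subspace_0)
  \<comment> \<open>Testing with (v, 0) or (0, q) isolates the two rows of the block operator; the
    forms with a zero argument vanish by bilinearity on the subspaces.\<close>
  have op: "Biot_op lam \<mu> \<alpha> K h \<tau> \<eta> \<Omega> V Q x = S.form_operator x" if x: "x \<in> V \<times> Q" for x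
  proof -
    have x': "fst x \<in> V" "snd x \<in> Q" using x by auto
    have "fst (Biot_op lam \<mu> \<alpha> K h \<tau> \<eta> \<Omega> V Q x) v = (if v \<in> V then S.L x (v, 0) else 0)" for v
    proof (cases "v \<in> V")
      case True
      then have "S.L x (v, 0) = elastic_form lam \<mu> \<Omega> (fst x) v - \<alpha> * L2_inner \<Omega> (weak_div \<Omega> v) (snd x)"
        unfolding S.L_def fst_conv snd_conv
        by (simp only: bilinear_on_zero_right[OF S.b x'(1) mem0(2)]
            bilinear_on_zero_right[OF S.s x'(2) mem0(2)] bilinear_on_zero_right[OF S.t x'(2) mem0(2)])
      then show ?thesis
        using True x by (auto simp: Biot_op_def A_u_def adjoint_op_def B_op_def form_op_def scaleR_fun_def)
    qed (use x in \<open>auto simp: Biot_op_def A_u_def adjoint_op_def form_op_def scaleR_fun_def\<close>)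
    moreover have "snd (Biot_op lam \<mu> \<alpha> K h \<tau> \<eta> \<Omega> V Q x) q = (if q \<in> Q then S.L x (0, q) else 0)" for q
    proof (cases "q \<in> Q")
      case True
      then have "S.L x (0, q) = - \<alpha> * L2_inner \<Omega> (weak_div \<Omega> (fst x)) q - \<tau> * darcy_form K \<Omega> (snd x) q
          - \<eta> * h\<^sup>2 * grad_form \<Omega> (snd x) q"
        unfolding S.L_def fst_conv snd_conv \<eta>
        by (simp only: bilinear_on_zero_left[OF S.b mem0(1) x'(2)]
            bilinear_on_zero_right[OF S.a x'(1) mem0(1)])
      then show ?thesis
        using True x by (auto simp: Biot_op_def A_p_def L_p_def B_op_def form_op_def scaleR_fun_def)
    qed (use x in \<open>auto simp: Biot_op_def A_p_def L_p_def B_op_def form_op_def scaleR_fun_def\<close>)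
    ultimately show ?thesis
      unfolding S.form_operator_def by (intro prod_eqI ext) (simp_all only: fst_conv snd_conv)
  qed
  show ?bounded using S.L_bounded by (simp add: form norm)
  \<comment> \<open>One test vector per \<open>x\<close> bounds each supremum from below, and in the
    extended reals this bounds the infimum.\<close>
  show ?stable
  proof (rule INF_greatest)
    fix x assume x: "x \<in> V \<times> Q - {0}"
    then obtain y where y: "y \<in> V \<times> Q - {0}" and le: "S.\<kappa> / (1 + S.\<theta>) \<le> S.L x y / (S.N x * S.N y)"
      using S.inf_sup_L[of x] by blast
    show "ereal (min (1/2) (c1\<^sup>2 / (2 * (1 + c2\<^sup>2))) / (1 + c1 / (1 + c2\<^sup>2)))
        \<le> (SUP y\<in>V \<times> Q - {0}. ereal (Biot_form lam \<mu> \<alpha> K h \<tau> \<eta> \<Omega> V Q x y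
          / (X_norm lam \<mu> \<alpha> K h \<tau> \<eta> \<Omega> x * X_norm lam \<mu> \<alpha> K h \<tau> \<eta> \<Omega> y)))"
      by (rule SUP_upper2[OF y]) (use le form[of x y] x y in \<open>simp add: norm S.\<kappa>_def S.\<theta>_def\<close>)
  qed
  obtain SV SQ where "V \<subseteq> span SV" "finite SV" "Q \<subseteq> span SQ" "finite SQ"
    using finite_element_pair_finite_span[OF \<Omega>(1) T pair] by metis
  from isomorphism_on_cong[OF subspace_Times[OF S.V S.Q] _ S.isomorphism_on_form_operator[OF this]]
  show ?iso using op by blast
qed

theorem theorem3:
  fixes \<delta> \<gamma>B \<xi> :: real
  assumes "CARD('n::finite) = 2 \<or> CARD('n) = 3"
    and "\<delta> > 0" and "\<gamma>B > 0" and "\<xi> \<ge> 0"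
  shows "\<exists>\<beta>>0. \<exists>\<gamma>>0.
    \<forall>(\<Omega>::(real^'n) set) lam \<mu> \<alpha> K h \<tau> \<eta> T V Q.
      open \<Omega> \<and> bounded \<Omega> \<and> lipschitz_boundary \<Omega> \<and>
      lam \<ge> 0 \<and> \<mu> > 0 \<and> \<alpha> > 0 \<and> K > 0 \<and> h > 0 \<and> \<tau> > 0 \<and>
      is_mesh \<Omega> h T \<and> (P1_P1_pair \<Omega> T V Q \<or> Mini_pair \<Omega> T V Q) \<and>
      weak_inf_sup \<Omega> h V Q \<gamma>B \<xi> \<and>
      \<eta> = \<delta> * (\<alpha>\<^sup>2 / (zeta TYPE('n) lam \<mu>)\<^sup>2)
      \<longrightarrow>
      (\<forall>x\<in>V \<times> Q. \<forall>y\<in>V \<times> Q.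
        \<bar>Biot_form lam \<mu> \<alpha> K h \<tau> \<eta> \<Omega> V Q x y\<bar>
          \<le> \<beta> * X_norm lam \<mu> \<alpha> K h \<tau> \<eta> \<Omega> x * X_norm lam \<mu> \<alpha> K h \<tau> \<eta> \<Omega> y) \<and>
      (INF x\<in>V \<times> Q - {0}. SUP y\<in>V \<times> Q - {0}.
        ereal (Biot_form lam \<mu> \<alpha> K h \<tau> \<eta> \<Omega> V Q x y
          / (X_norm lam \<mu> \<alpha> K h \<tau> \<eta> \<Omega> x * X_norm lam \<mu> \<alpha> K h \<tau> \<eta> \<Omega> y))) \<ge> ereal \<gamma> \<and>
      isomorphism_on (V \<times> Q) (dual V \<times> dual Q) (Biot_op lam \<mu> \<alpha> K h \<tau> \<eta> \<Omega> V Q)"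
proof -
  \<comment> \<open>Fixed before the domain, the mesh and the physical parameters are chosen; only
    d, \<open>\<delta>\<close>, \<open>\<gamma>B\<close> and \<open>\<xi>\<close> occur.\<close>
  define c1 c2 where "c1 = \<gamma>B / (2 * sqrt CARD('n))" and "c2 = \<xi> / sqrt (CARD('n) * \<delta>)"
  define \<gamma> where "\<gamma> = min (1/2) (c1\<^sup>2 / (2 * (1 + c2\<^sup>2))) / (1 + c1 / (1 + c2\<^sup>2))"
  have c1: "c1 > 0" using assms by (simp add: c1_def)
  have c2: "1 + c2\<^sup>2 > 0" by (simp add: add_pos_nonneg)
  have \<gamma>: "\<gamma> > 0" unfolding \<gamma>_def using c1 c2 by (intro divide_pos_pos) (auto intro!: add_pos_pos divide_pos_pos)
  show ?thesis
  proof (rule exI[of _ 5], rule conjI, simp, rule exI[of _ \<gamma>], rule conjI, rule \<gamma>, intro allI impI, elim conjE)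
    fix \<Omega> :: "(real^'n) set" and lam \<mu> \<alpha> K h \<tau> \<eta> :: real and T V Q
    assume "open \<Omega>" "bounded \<Omega>" "lam \<ge> 0" "\<mu> > 0" "\<alpha> > 0" "K > 0" "h > 0" "\<tau> > 0" "is_mesh \<Omega> h T"
      "P1_P1_pair \<Omega> T V Q \<or> Mini_pair \<Omega> T V Q" "weak_inf_sup \<Omega> h V Q \<gamma>B \<xi>"
      and \<eta>: "\<eta> = \<delta> * (\<alpha>\<^sup>2 / (zeta TYPE('n) lam \<mu>)\<^sup>2)"
    note well_posed = Biot_well_posed[OF this(1-11) assms(2-4) \<eta>]
    show "(\<forall>x\<in>V \<times> Q. \<forall>y\<in>V \<times> Q.
        \<bar>Biot_form lam \<mu> \<alpha> K h \<tau> \<eta> \<Omega> V Q x y\<bar>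
          \<le> 5 * X_norm lam \<mu> \<alpha> K h \<tau> \<eta> \<Omega> x * X_norm lam \<mu> \<alpha> K h \<tau> \<eta> \<Omega> y) \<and>
      (INF x\<in>V \<times> Q - {0}. SUP y\<in>V \<times> Q - {0}.
        ereal (Biot_form lam \<mu> \<alpha> K h \<tau> \<eta> \<Omega> V Q x y
          / (X_norm lam \<mu> \<alpha> K h \<tau> \<eta> \<Omega> x * X_norm lam \<mu> \<alpha> K h \<tau> \<eta> \<Omega> y))) \<ge> ereal \<gamma> \<and>
      isomorphism_on (V \<times> Q) (dual V \<times> dual Q) (Biot_op lam \<mu> \<alpha> K h \<tau> \<eta> \<Omega> V Q)"
      unfolding \<gamma>_def c1_def c2_def by (intro conjI well_posed)
  qed
qed

end
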